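(* Let $(X,\mu)$ be a Lebesgue space with $\mu(X)=1$ and let $M$ be a uniformly integrable convex family of admissible semimetrics in the space $\mathbb{M}$. Then $M$ is precompact in the m-norm if and only if for every fixed $\varepsilon>0$ the $\varepsilon$-entropies of the semimetrics in $M$ are uniformly bounded, i.e. $\sup_{\rho\in M}\mathbb{H}_\varepsilon(\rho,\mu)<\infty$ for every $\varepsilon>0$.
   Context: A Lebesgue space with $\mu(X)=1$ is a standard probability space. A semimetric on $X$ is a function $\rho:X\times X\to[0,\infty)$ with $\rho(x,x)=0$, $\rho(x,y)=\rho(y,x)$ and $\rho(x,z)\le\rho(x,y)+\rho(y,z)$. It is admissible if it is measurable on $(X\times X,\mu\times\mu)$ and there is $X_1\subset X$ of full measure such that $(X_1,\rho)$ is separable. Write $L^1(X^2)=L^1(X\times X,\mu\times\mu)$. The m-norm of $f\in L^1(X^2)$ is $$\|f\|_m=\inf\{\|\rho\|_{L^1(X^2)}:\ \rho\text{ is a measurable summable semimetric},\ \rho(x,y)\ge|f(x,y)|\text{ for almost all }(x,y)\}\in[0,\infty]$$ ($\inf\emptyset=\infty$), and $\mathbb{M}=\{f\in L^1(X^2):\|f\|_m<\infty\}$ is the corresponding normed space (it contains all summable measurable semimetrics). Precompact in the m-norm means having compact closure in $\mathbb{M}$. A family $K\subset L^1(\Omega,\nu)$ is uniformly integrable if $\lim_{R\to\infty}\sup_{f\in K}\int_{|f|>R}|f|\,d\nu=0$. For $\varepsilon>0$, the $\varepsilon$-entropy $\mathbb{H}_\varepsilon(\rho,\mu)$ is $\log_2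 k$, where $k$ is the smallest positive integer for which $X$ is the union of measurable sets $X_0,X_1,\dots,X_k$ with $\mu(X_0)<\varepsilon$ and $\mathrm{diam}_\rho(X_j)<\varepsilon$ for $j=1,\dots,k$; if no such $k$ exists, $\mathbb{H}_\varepsilon(\rho,\mu)=\infty$. *)

theory Defs
  imports "HOL-Probability.Probability"
begin

text \<open>
  Rokhlin's model: the interval \<open>[0, a]\<close> with Lebesgue measure, together with countably many
  point masses. The \<open>n\<close>-th point is encoded as the real number \<open>- n - 1\<close>, hence is disjoint from the
  interval, and carries the mass \<open>p n\<close>. For \<open>a \<le> 0\<close> the continuous part is null, and
  \<open>p n = 0\<close> allows finitely many atoms or none.
\<close>

definition atom_pt :: "nat \<Rightarrow> real" where
  "atom_pt n = - real n - 1"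

definition interval_with_atoms :: "real \<Rightarrow> (nat \<Rightarrow> ennreal) \<Rightarrow> real measure" where
  "interval_with_atoms a p =
     measure_of ({0..a} \<union> range atom_pt)
       {S. S \<subseteq> {0..a} \<union> range atom_pt \<and> S \<in> sets lebesgue}
       (\<lambda>S. emeasure lebesgue (S \<inter> {0..a}) + (\<Sum>n. p n * indicator S (atom_pt n)))"

definition isomorphic_mod0 :: "'a measure \<Rightarrow> 'b measure \<Rightarrow> bool" where
  "isomorphic_mod0 M N \<longleftrightarrow>
     (\<exists>A \<in> null_sets M. \<exists>B \<in> null_sets N. \<exists>f g.
        let M' = restrict_space M (space M - A); N' = restrict_space N (space N - B) in
        f \<in> measurable M' N' \<and> g \<in> measurable N' M' \<and>
        (\<forall>x \<in> space M'. g (f x) = x) \<and> (\<forall>y \<in> space N'. f (g y) = y) \<and>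
        distr M' N' f = N')"

definition lebesgue_prob_space :: "'a measure \<Rightarrow> bool" where
  "lebesgue_prob_space \<mu> \<longleftrightarrow>
     prob_space \<mu> \<and> complete_measure \<mu> \<and> (\<exists>a p. isomorphic_mod0 \<mu> (interval_with_atoms a p))"

text \<open>
  The square \<open>(X \<times> X, \<mu> \<times> \<mu>)\<close> in the category of Lebesgue spaces: the library's product
  measure is not complete, hence the completion. Functions are only relevant on \<open>X \<times> X\<close>; their
  values elsewhere on the type play no role.
\<close>

definition sq :: "'a measure \<Rightarrow> ('a \<times> 'a) measure" where
  "sq \<mu> = completion (\<mu> \<Otimes>\<^sub>M \<mu>)"

definition semimetric_on :: "'a set \<Rightarrow> ('a \<times> 'a \<Rightarrow> real) \<Rightarrow> bool" where
  "semimetric_on X \<rho> \<longleftrightarrow>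
     (\<forall>x\<in>X. \<forall>y\<in>X. 0 \<le> \<rho> (x, y)) \<and>
     (\<forall>x\<in>X. \<rho> (x, x) = 0) \<and>
     (\<forall>x\<in>X. \<forall>y\<in>X. \<rho> (x, y) = \<rho> (y, x)) \<and>
     (\<forall>x\<in>X. \<forall>y\<in>X. \<forall>z\<in>X. \<rho> (x, z) \<le> \<rho> (x, y) + \<rho> (y, z))"

definition separable_on :: "'a set \<Rightarrow> ('a \<times> 'a \<Rightarrow> real) \<Rightarrow> bool" where
  "separable_on X \<rho> \<longleftrightarrow>
     (\<exists>D. countable D \<and> D \<subseteq> X \<and> (\<forall>x\<in>X. \<forall>e>0. \<exists>d\<in>D. \<rho> (x, d) < e))"

definition admissible :: "'a measure \<Rightarrow> ('a \<times> 'a \<Rightarrow> real) \<Rightarrow> bool" where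
  "admissible \<mu> \<rho> \<longleftrightarrow>
     semimetric_on (space \<mu>) \<rho> \<and> \<rho> \<in> borel_measurable (sq \<mu>) \<and>
     (\<exists>X1 \<in> sets \<mu>. space \<mu> - X1 \<in> null_sets \<mu> \<and> separable_on X1 \<rho>)"

definition m_norm :: "'a measure \<Rightarrow> ('a \<times> 'a \<Rightarrow> real) \<Rightarrow> ennreal" where
  "m_norm \<mu> f =
     (INF \<rho> \<in> {\<rho>. semimetric_on (space \<mu>) \<rho> \<and> integrable (sq \<mu>) \<rho> \<and> (AE z in sq \<mu>. \<bar>f z\<bar> \<le> \<rho> z)}.
        \<integral>\<^sup>+ z. ennreal \<bar>\<rho> z\<bar> \<partial>sq \<mu>)"

definition m_functions :: "'a measure \<Rightarrow> ('a \<times> 'a \<Rightarrow> real) set" where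
  "m_functions \<mu> = {f. integrable (sq \<mu>) f \<and> m_norm \<mu> f < \<infinity>}"

text \<open>
  The normed space consists of classes of functions modulo equality almost everywhere. The distance
  of two classes is the norm of the difference of arbitrary representatives.
\<close>

definition ae_class :: "'a measure \<Rightarrow> ('a \<times> 'a \<Rightarrow> real) \<Rightarrow> ('a \<times> 'a \<Rightarrow> real) set" where
  "ae_class \<mu> f = {g. integrable (sq \<mu>) g \<and> (AE z in sq \<mu>. g z = f z)}"

definition m_space :: "'a measure \<Rightarrow> ('a \<times> 'a \<Rightarrow> real) set set" where
  "m_space \<mu> = ae_class \<mu> ` m_functions \<mu>"

definition m_dist ::
  "'a measure \<Rightarrow> ('a \<times> 'a \<Rightarrow> real) set \<Rightarrow> ('a \<times> 'a \<Rightarrow> real) set \<Rightarrow> real" where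
  "m_dist \<mu> C D = enn2real (m_norm \<mu> (\<lambda>z. (SOME f. f \<in> C) z - (SOME g. g \<in> D) z))"

definition m_topology :: "'a measure \<Rightarrow> ('a \<times> 'a \<Rightarrow> real) set topology" where
  "m_topology \<mu> = Metric_space.mtopology (m_space \<mu>) (m_dist \<mu>)"

definition m_precompact :: "'a measure \<Rightarrow> ('a \<times> 'a \<Rightarrow> real) set \<Rightarrow> bool" where
  "m_precompact \<mu> K \<longleftrightarrow>
     compactin (m_topology \<mu>) (m_topology \<mu> closure_of (ae_class \<mu> ` K))"

definition convex_family :: "('b \<Rightarrow> real) set \<Rightarrow> bool" where
  "convex_family K \<longleftrightarrow>
     (\<forall>f\<in>K. \<forall>g\<in>K. \<forall>t. 0 \<le> t \<and> t \<le> 1 \<longrightarrow> (\<lambda>z. (1 - t) * f z + t * g z) \<in> K)"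

definition uniformly_integrable :: "'b measure \<Rightarrow> ('b \<Rightarrow> real) set \<Rightarrow> bool" where
  "uniformly_integrable \<nu> K \<longleftrightarrow>
     (\<forall>f\<in>K. integrable \<nu> f) \<and>
     ((\<lambda>R::real. SUP f\<in>K. \<integral>\<^sup>+ z. ennreal \<bar>f z\<bar> * indicator {z. \<bar>f z\<bar> > R} z \<partial>\<nu>) \<longlongrightarrow> 0) at_top"

definition diam :: "('a \<times> 'a \<Rightarrow> real) \<Rightarrow> 'a set \<Rightarrow> ennreal" where
  "diam \<rho> A = (SUP z \<in> A \<times> A. ennreal (\<rho> z))"

definition eps_cover :: "real \<Rightarrow> ('a \<times> 'a \<Rightarrow> real) \<Rightarrow> 'a measure \<Rightarrow> nat \<Rightarrow> bool" where
  "eps_cover \<epsilon> \<rho> \<mu> k \<longleftrightarrow>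
     (\<exists>A :: nat \<Rightarrow> 'a set.
        (\<forall>j\<le>k. A j \<in> sets \<mu>) \<and> (\<Union>j\<le>k. A j) = space \<mu> \<and>
        emeasure \<mu> (A 0) < ennreal \<epsilon> \<and> (\<forall>j\<in>{1..k}. diam \<rho> (A j) < ennreal \<epsilon>))"

definition eps_entropy :: "real \<Rightarrow> ('a \<times> 'a \<Rightarrow> real) \<Rightarrow> 'a measure \<Rightarrow> ennreal" where
  "eps_entropy \<epsilon> \<rho> \<mu> =
     (if \<exists>k\<ge>1. eps_cover \<epsilon> \<rho> \<mu> k
      then ennreal (log 2 (real (LEAST k. k \<ge> 1 \<and> eps_cover \<epsilon> \<rho> \<mu> k)))
      else \<infinity>)"

lemma emeasure_interval_with_atoms:
  fixes a p
  defines "X \<equiv> {0..a} \<union> range atom_pt"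
  shows "space (interval_with_atoms a p) = X"
    and "sets (interval_with_atoms a p) = {S. S \<subseteq> X \<and> S \<in> sets lebesgue}"
    and "S \<subseteq> X \<Longrightarrow> S \<in> sets lebesgue \<Longrightarrow> emeasure (interval_with_atoms a p) S =
           emeasure lebesgue (S \<inter> {0..a}) + (\<Sum>n. p n * indicator S (atom_pt n))"
proof -
  let ?F = "{S. S \<subseteq> X \<and> S \<in> sets lebesgue}"
  let ?m = "\<lambda>S. emeasure lebesgue (S \<inter> {0..a}) + (\<Sum>n. p n * indicator S (atom_pt n))"
  have "countable (range atom_pt)" by simp
  then have "range atom_pt \<in> null_sets lborel"
    by (rule countable_imp_null_set_lborel)
  then have "range atom_pt \<in> sets lebesgue"
    by (auto intro!: null_setsD2 null_sets_completionI)
  then have X: "X \<in> sets lebesgue"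
    unfolding X_def by (intro sets.Un) auto
  have F: "?F = sets (restrict_space lebesgue X)"
    using X by (auto simp: sets_restrict_space image_iff)
  have spX: "space (restrict_space lebesgue X) = X"
    by (simp add: space_restrict_space)
  have sa: "sigma_algebra X ?F"
    using sets.sigma_algebra_axioms[of "restrict_space lebesgue X"] unfolding F spX .
  have I: "interval_with_atoms a p = measure_of X ?F ?m"
    by (simp add: interval_with_atoms_def X_def)
  have P: "?F \<subseteq> Pow X" by auto
  show "space (interval_with_atoms a p) = X"
    unfolding I by (rule space_measure_of[OF P])
  show st: "sets (interval_with_atoms a p) = ?F"
    unfolding I sets_measure_of[OF P] by (rule sigma_algebra.sigma_sets_eq[OF sa])
  have ca: "countably_additive ?F ?m"
  proof (rule countably_additiveI)
    fix A :: "nat \<Rightarrow> real set"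
    assume A: "range A \<subseteq> ?F" "disjoint_family A"
    have ind: "(\<Sum>i. indicator (A i) x) = (indicator (\<Union>i. A i) x :: ennreal)" for x
      by (rule suminf_indicator[OF A(2)])
    have 1: "(\<Sum>i. emeasure lebesgue (A i \<inter> {0..a})) = emeasure lebesgue ((\<Union>i. A i) \<inter> {0..a})"
      unfolding UN_simps(4)[symmetric]
    proof (rule suminf_emeasure)
      show "range (\<lambda>i. A i \<inter> {0..a}) \<subseteq> sets lebesgue"
        using A(1) by (intro image_subsetI sets.Int) auto
      show "disjoint_family (\<lambda>i. A i \<inter> {0..a})"
        using A(2) by (auto simp: disjoint_family_on_def)
    qed
    have 2: "(\<Sum>i. \<Sum>n. p n * indicator (A i) (atom_pt n)) =
        (\<Sum>n. p n * indicator (\<Union>i. A i) (atom_pt n))"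
    proof -
      have "(\<Sum>i. \<Sum>n. p n * indicator (A i) (atom_pt n)) =
          (\<Sum>i. \<integral>\<^sup>+n. p n * indicator (A i) (atom_pt n) \<partial>count_space UNIV)"
        by (simp only: nn_integral_count_space_nat)
      also have "\<dots> = (\<integral>\<^sup>+n. (\<Sum>i. p n * indicator (A i) (atom_pt n)) \<partial>count_space UNIV)"
        by (rule nn_integral_suminf[symmetric]) simp
      also have "\<dots> = (\<Sum>n. p n * indicator (\<Union>i. A i) (atom_pt n))"
        by (simp only: nn_integral_count_space_nat ennreal_suminf_cmult ind)
      finally show ?thesis .
    qed
    show "(\<Sum>i. ?m (A i)) = ?m (\<Union>i. A i)"
      unfolding 2[symmetric] 1[symmetric]
      by (rule suminf_add[symmetric]) (rule summableI)+
  qed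
  have pos: "positive ?F ?m" by (simp add: positive_def)
  show "emeasure (interval_with_atoms a p) S = ?m S" if "S \<subseteq> X" "S \<in> sets lebesgue"
    by (rule emeasure_measure_of[OF I P pos[folded st] ca[folded st]]) (use that st in auto)
qed

lemma semimetric_add:
  "semimetric_on X r \<Longrightarrow> semimetric_on X s \<Longrightarrow> semimetric_on X (\<lambda>z. r z + s z)"
  unfolding semimetric_on_def
  by (auto intro: add_nonneg_nonneg) (smt (verit))

lemma m_norm_uminus: "m_norm \<mu> (\<lambda>z. f z - g z) = m_norm \<mu> (\<lambda>z. g z - f z)"
  unfolding m_norm_def by (simp add: abs_minus_commute)

lemma m_norm_cong_AE:
  assumes "AE z in sq \<mu>. f z = g z"
  shows "m_norm \<mu> f = m_norm \<mu> g"
proof -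
  have "(AE z in sq \<mu>. \<bar>f z\<bar> \<le> \<rho> z) \<longleftrightarrow> (AE z in sq \<mu>. \<bar>g z\<bar> \<le> \<rho> z)" for \<rho>
  proof
    assume "AE z in sq \<mu>. \<bar>f z\<bar> \<le> \<rho> z"
    with assms show "AE z in sq \<mu>. \<bar>g z\<bar> \<le> \<rho> z" by eventually_elim simp
  next
    assume "AE z in sq \<mu>. \<bar>g z\<bar> \<le> \<rho> z"
    with assms show "AE z in sq \<mu>. \<bar>f z\<bar> \<le> \<rho> z" by eventually_elim simp
  qed
  then show ?thesis unfolding m_norm_def by simp
qed

lemma m_norm_triangle:
  "m_norm \<mu> (\<lambda>z. f z + g z) \<le> m_norm \<mu> f + m_norm \<mu> g"
proof -
  let ?P = "\<lambda>f \<rho>. semimetric_on (space \<mu>) \<rho> \<and> integrable (sq \<mu>) \<rho> \<and> (AE z in sq \<mu>. \<bar>f z\<bar> \<le> \<rho> z)"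
  let ?I = "\<lambda>\<rho>. \<integral>\<^sup>+ z. ennreal \<bar>\<rho> z\<bar> \<partial>sq \<mu>"
  have *: "m_norm \<mu> (\<lambda>z. f z + g z) \<le> ?I r + ?I s" if r: "?P f r" and s: "?P g s" for r s
  proof -
    from r s have "AE z in sq \<mu>. \<bar>f z\<bar> \<le> r z" "AE z in sq \<mu>. \<bar>g z\<bar> \<le> s z" by auto
    then have "AE z in sq \<mu>. \<bar>f z + g z\<bar> \<le> r z + s z" by eventually_elim simp
    then have "?P (\<lambda>z. f z + g z) (\<lambda>z. r z + s z)"
      using r s by (auto intro: semimetric_add)
    then have "m_norm \<mu> (\<lambda>z. f z + g z) \<le> ?I (\<lambda>z. r z + s z)"
      unfolding m_norm_def by (intro INF_lower) simp
    also have "\<dots> \<le> (\<integral>\<^sup>+ z. ennreal \<bar>r z\<bar> + ennreal \<bar>s z\<bar> \<partial>sq \<mu>)"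
      by (intro nn_integral_mono) (simp flip: ennreal_plus)
    also have "\<dots> = ?I r + ?I s"
      using r s by (intro nn_integral_add) auto
    finally show ?thesis .
  qed
  show ?thesis
  proof (cases "m_norm \<mu> f = \<infinity> \<or> m_norm \<mu> g = \<infinity>")
    case True
    then show ?thesis by auto
  next
    case False
    show ?thesis
    proof (rule ennreal_le_epsilon)
      fix e :: real assume e: "0 < e"
      have "m_norm \<mu> f < m_norm \<mu> f + ennreal (e/2)" "m_norm \<mu> g < m_norm \<mu> g + ennreal (e/2)"
        using False e ennreal_add_left_cancel_less[of "m_norm \<mu> f" 0 "ennreal (e/2)"]
        ennreal_add_left_cancel_less[of "m_norm \<mu> g" 0 "ennreal (e/2)"] by auto
      then obtain r s where "?P f r" "?I r < m_norm \<mu> f + ennreal (e/2)"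
          and "?P g s" "?I s < m_norm \<mu> g + ennreal (e/2)"
        unfolding m_norm_def INF_less_iff by auto
      then have "m_norm \<mu> (\<lambda>z. f z + g z) \<le> (m_norm \<mu> f + ennreal (e/2)) + (m_norm \<mu> g + ennreal (e/2))"
        by (intro order_trans[OF *] add_mono) auto
      also have "\<dots> = m_norm \<mu> f + m_norm \<mu> g + (ennreal (e/2) + ennreal (e/2))"
        by (simp add: ac_simps)
      also have "ennreal (e/2) + ennreal (e/2) = ennreal e"
        using e by (simp flip: ennreal_plus)
      finally show "m_norm \<mu> (\<lambda>z. f z + g z) \<le> m_norm \<mu> f + m_norm \<mu> g + ennreal e" .
    qed
  qed
qed

lemma nn_integral_le_m_norm: "(\<integral>\<^sup>+ z. ennreal \<bar>f z\<bar> \<partial>sq \<mu>) \<le> m_norm \<mu> f"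
  unfolding m_norm_def
proof (rule INF_greatest)
  fix \<rho> assume "\<rho> \<in> {\<rho>. semimetric_on (space \<mu>) \<rho> \<and> integrable (sq \<mu>) \<rho> \<and> (AE z in sq \<mu>. \<bar>f z\<bar> \<le> \<rho> z)}"
  then have "AE z in sq \<mu>. \<bar>f z\<bar> \<le> \<rho> z" by simp
  then have "AE z in sq \<mu>. ennreal \<bar>f z\<bar> \<le> ennreal \<bar>\<rho> z\<bar>"
    by eventually_elim (auto intro: ennreal_leI)
  then show "(\<integral>\<^sup>+ z. ennreal \<bar>f z\<bar> \<partial>sq \<mu>) \<le> (\<integral>\<^sup>+ z. ennreal \<bar>\<rho> z\<bar> \<partial>sq \<mu>)"
    by (rule nn_integral_mono_AE)
qed

lemma m_norm_eq_0:
  assumes "integrable (sq \<mu>) f"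
  shows "m_norm \<mu> f = 0 \<longleftrightarrow> (AE z in sq \<mu>. f z = 0)"
proof
  assume "m_norm \<mu> f = 0"
  then have "(\<integral>\<^sup>+ z. ennreal \<bar>f z\<bar> \<partial>sq \<mu>) = 0"
    using nn_integral_le_m_norm[where f = f and \<mu> = \<mu>] by simp
  then show "AE z in sq \<mu>. f z = 0"
    using assms by (subst (asm) nn_integral_0_iff_AE) auto
next
  assume "AE z in sq \<mu>. f z = 0"
  then have "m_norm \<mu> f \<le> (\<integral>\<^sup>+ z. ennreal \<bar>0\<bar> \<partial>sq \<mu>)"
    unfolding m_norm_def by (intro INF_lower) (auto simp: semimetric_on_def)
  then show "m_norm \<mu> f = 0" by simp
qed

lemma some_ae_class:
  assumes "integrable (sq \<mu>) f"
  shows "integrable (sq \<mu>) (SOME g. g \<in> ae_class \<mu> f)"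
    and "AE z in sq \<mu>. (SOME g. g \<in> ae_class \<mu> f) z = f z"
proof -
  have "f \<in> ae_class \<mu> f" using assms by (simp add: ae_class_def)
  then have "(SOME g. g \<in> ae_class \<mu> f) \<in> ae_class \<mu> f" by (rule someI[of "\<lambda>g. g \<in> ae_class \<mu> f"])
  then show "integrable (sq \<mu>) (SOME g. g \<in> ae_class \<mu> f)"
    "AE z in sq \<mu>. (SOME g. g \<in> ae_class \<mu> f) z = f z"
    by (auto simp: ae_class_def)
qed

lemma m_dist_ae_class:
  assumes "integrable (sq \<mu>) f" "integrable (sq \<mu>) g"
  shows "m_dist \<mu> (ae_class \<mu> f) (ae_class \<mu> g) = enn2real (m_norm \<mu> (\<lambda>z. f z - g z))"
  unfolding m_dist_def
  by (rule arg_cong[where f = enn2real], rule m_norm_cong_AE)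
     (use some_ae_class(2)[OF assms(1)] some_ae_class(2)[OF assms(2)] in \<open>eventually_elim, simp\<close>)

lemma ae_class_eq_iff:
  assumes "integrable (sq \<mu>) f" "integrable (sq \<mu>) g"
  shows "ae_class \<mu> f = ae_class \<mu> g \<longleftrightarrow> (AE z in sq \<mu>. f z = g z)"
proof
  assume "ae_class \<mu> f = ae_class \<mu> g"
  moreover have "f \<in> ae_class \<mu> f" using assms by (simp add: ae_class_def)
  ultimately show "AE z in sq \<mu>. f z = g z" by (simp add: ae_class_def)
next
  assume *: "AE z in sq \<mu>. f z = g z"
  have "(AE z in sq \<mu>. h z = f z) \<longleftrightarrow> (AE z in sq \<mu>. h z = g z)" for h
  proof
    assume "AE z in sq \<mu>. h z = f z"
    with * show "AE z in sq \<mu>. h z = g z" by eventually_elim simp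
  next
    assume "AE z in sq \<mu>. h z = g z"
    with * show "AE z in sq \<mu>. h z = f z" by eventually_elim simp
  qed
  then show "ae_class \<mu> f = ae_class \<mu> g" by (simp add: ae_class_def)
qed

lemma m_norm_diff_finite:
  assumes "f \<in> m_functions \<mu>" "g \<in> m_functions \<mu>"
  shows "m_norm \<mu> (\<lambda>z. f z - g z) < \<infinity>"
proof -
  have "m_norm \<mu> (\<lambda>z. - g z) = m_norm \<mu> g"
    unfolding m_norm_def by simp
  then have "m_norm \<mu> (\<lambda>z. f z - g z) \<le> m_norm \<mu> f + m_norm \<mu> g"
    using m_norm_triangle[of \<mu> f "\<lambda>z. - g z"] by simp
  also have "\<dots> < \<infinity>"
    using assms by (simp add: m_functions_def)
  finally show ?thesis .
qed

lemma Metric_space_m_space: "Metric_space (m_space \<mu>) (m_dist \<mu>)"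
proof
  show "0 \<le> m_dist \<mu> C D" for C D by (simp add: m_dist_def)
  show "m_dist \<mu> C D = m_dist \<mu> D C" for C D
    unfolding m_dist_def by (subst m_norm_uminus) simp
  show "m_dist \<mu> C D = 0 \<longleftrightarrow> C = D" if CD: "C \<in> m_space \<mu>" "D \<in> m_space \<mu>" for C D
  proof -
    obtain f g where fg: "f \<in> m_functions \<mu>" "g \<in> m_functions \<mu>"
        and C: "C = ae_class \<mu> f" and D: "D = ae_class \<mu> g"
      using CD by (auto simp: m_space_def)
    have int: "integrable (sq \<mu>) f" "integrable (sq \<mu>) g"
      using fg by (auto simp: m_functions_def)
    show ?thesis
      using m_norm_diff_finite[OF fg] m_norm_eq_0[of \<mu> "\<lambda>z. f z - g z"] int
      unfolding C D m_dist_ae_class[OF int] ae_class_eq_iff[OF int]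
      by (auto simp: enn2real_eq_0_iff)
  qed
  show "m_dist \<mu> C E \<le> m_dist \<mu> C D + m_dist \<mu> D E"
    if CDE: "C \<in> m_space \<mu>" "D \<in> m_space \<mu>" "E \<in> m_space \<mu>" for C D E
  proof -
    obtain f g h where fgh: "f \<in> m_functions \<mu>" "g \<in> m_functions \<mu>" "h \<in> m_functions \<mu>"
        and C: "C = ae_class \<mu> f" and D: "D = ae_class \<mu> g" and E: "E = ae_class \<mu> h"
      using CDE by (auto simp: m_space_def)
    have int: "integrable (sq \<mu>) f" "integrable (sq \<mu>) g" "integrable (sq \<mu>) h"
      using fgh by (auto simp: m_functions_def)
    have fin: "m_norm \<mu> (\<lambda>z. f z - g z) < top" "m_norm \<mu> (\<lambda>z. g z - h z) < top"
      using m_norm_diff_finite[OF fgh(1,2)] m_norm_diff_finite[OF fgh(2,3)] by auto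
    have "m_norm \<mu> (\<lambda>z. f z - h z) \<le> m_norm \<mu> (\<lambda>z. f z - g z) + m_norm \<mu> (\<lambda>z. g z - h z)"
      using m_norm_triangle[of \<mu> "\<lambda>z. f z - g z" "\<lambda>z. g z - h z"] by simp
    then have "enn2real (m_norm \<mu> (\<lambda>z. f z - h z)) \<le>
        enn2real (m_norm \<mu> (\<lambda>z. f z - g z) + m_norm \<mu> (\<lambda>z. g z - h z))"
      by (rule enn2real_mono) (use fin in simp)
    then show ?thesis
      unfolding C D E by (simp add: m_dist_ae_class int enn2real_plus fin)
  qed
qed

end

theory Submission
  imports Defs
begin

text \<open>
  Call the mean of \<open>\<tau> (x, y)\<close> over pairs lying in a common block of a finite labelling \<open>q\<close> the spread of
  \<open>\<tau>\<close>. Given a convex family with uniformly bounded entropies, the key step finds one labelling on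
  which every truncated semimetric of the family has small spread. Otherwise choose inductively
  \<open>\<rho>\<^sub>j\<close> of spread \<open>> \<epsilon>\<close> on \<open>q\<^sub>j\<close> and a refinement \<open>q\<^sub>j\<^sub>+\<^sub>1\<close> on which \<open>\<rho>\<^sub>j\<close> has tiny spread.
  The average of \<open>\<rho>\<^sub>0, \<dots>, \<rho>\<^sub>n\<^sub>-\<^sub>1\<close> is in the family, so up to a small set \<open>X\<close> splits into \<open>k\<close> sets
  of small diameter with \<open>k\<close> independent of \<open>n\<close>. Conditional expectations of these sets along the
  \<open>q\<^sub>j\<close> form martingales of total energy at most 1, so for most \<open>j\<close> the partition is almost
  conditionally independent of \<open>q\<^sub>j\<^sub>+\<^sub>1\<close> given \<open>q\<^sub>j\<close>; then the distance \<open>\<rho>\<^sub>j\<close> from a point to its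
  centre is on average at least half the spread, a contradiction.

  With a common labelling, uniform integrability removes the truncation, and each \<open>\<rho>\<close> is close in the
  m-norm to a step function: \<open>\<bar>\<rho> (x, y) - \<rho> (c x, c y)\<bar> \<le> h x + h y\<close> with \<open>h x = \<rho> (x, c x)\<close>, and
  \<open>(x, y) \<mapsto> h x + h y\<close> off the diagonal is a semimetric. Total boundedness follows, and the space is
  complete. Conversely, a semimetric dominating \<open>\<rho> - \<kappa>\<close> with small integral is small around some
  point on a set of almost full measure, so \<open>\<rho>\<close> inherits the covers of \<open>\<kappa>\<close>.
\<close>

section \<open>Averages over the blocks of a finite labelling\<close>

definition block :: "'a measure \<Rightarrow> ('a \<Rightarrow> nat) \<Rightarrow> nat \<Rightarrow> 'a set" where
  "block \<mu> q i = {x \<in> space \<mu>. q x = i}"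

text \<open>A finite measurable partition is coded by the label of each point. Refinement is then a
  factorization \<open>q x = \<phi> (q' x)\<close>, and a common refinement is a pairing of
  labels.\<close>

definition labelling :: "'a measure \<Rightarrow> ('a \<Rightarrow> nat) \<Rightarrow> bool" where
  "labelling \<mu> q \<longleftrightarrow> q \<in> measurable \<mu> (count_space UNIV) \<and> finite (q ` space \<mu>)"

text \<open>The conditional expectation of \<open>f\<close> given the finite sigma-algebra generated
  by \<open>q\<close>, in a version that is constant on every block. On a null block division by
  zero makes it 0.\<close>

definition block_avg :: "'a measure \<Rightarrow> ('a \<Rightarrow> nat) \<Rightarrow> ('a \<Rightarrow> real) \<Rightarrow> 'a \<Rightarrow> real" where
  "block_avg \<mu> q f x =
     (\<integral>y. indicator (block \<mu> q (q x)) y * f y \<partial>\<mu>) / measure \<mu> (block \<mu> q (q x))"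

text \<open>The integral of \<tau> against the relatively independent self-joining of \<mu> over the
  partition: both points fall into one block and are independent given that block.\<close>

definition spread :: "'a measure \<Rightarrow> ('a \<Rightarrow> nat) \<Rightarrow> ('a \<times> 'a \<Rightarrow> real) \<Rightarrow> real" where
  "spread \<mu> q \<tau> = (\<integral>x. block_avg \<mu> q (\<lambda>y. \<tau> (x, y)) x \<partial>\<mu>)"

lemma block_sets [measurable]: "labelling \<mu> q \<Longrightarrow> block \<mu> q i \<in> sets \<mu>"
proof -
  assume "labelling \<mu> q"
  then have "q \<in> measurable \<mu> (count_space UNIV)" by (simp only: labelling_def)
  then have "q -` {i} \<inter> space \<mu> \<in> sets \<mu>" by (rule measurable_sets) simp
  also have "q -` {i} \<inter> space \<mu> = block \<mu> q i" by (auto simp: block_def)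
  finally show ?thesis .
qed

lemma labelling_measurable: "labelling \<mu> q \<Longrightarrow> q \<in> measurable \<mu> (count_space UNIV)"
  by (simp only: labelling_def)

lemma sum_block_indicator:
  assumes "labelling \<mu> q" "x \<in> space \<mu>"
  shows "(\<Sum>i\<in>q ` space \<mu>. indicator (block \<mu> q i) x * c i) = (c (q x) :: real)"
proof -
  have "(\<Sum>i\<in>q ` space \<mu>. indicator (block \<mu> q i) x * c i) =
      (\<Sum>i\<in>q ` space \<mu>. if i = q x then c i else 0)"
    using assms by (intro sum.cong) (auto simp: block_def indicator_def)
  also have "\<dots> = c (q x)" using assms by (simp add: labelling_def)
  finally show ?thesis .
qed

context prob_space
begin

text \<open>Written as a finite sum over labels, the average is visibly measurable in
  \<open>x\<close> even when the averaged function itself depends on \<open>x\<close>.\<close>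

lemma block_avg_eq_sum:
  assumes "labelling M q" "x \<in> space M"
  shows "block_avg M q f x = (\<Sum>i\<in>q ` space M. indicator (block M q i) x *
     ((\<integral>y. indicator (block M q i) y * f y \<partial>M) / measure M (block M q i)))"
  unfolding block_avg_def sum_block_indicator[OF assms] ..

lemma borel_measurable_labelling:
  "labelling M q \<Longrightarrow> (\<lambda>x. G (q x) :: real) \<in> borel_measurable M"
  by (rule measurable_compose[OF labelling_measurable]) auto

lemma borel_measurable_block_avg [measurable]:
  assumes "labelling M q" shows "block_avg M q f \<in> borel_measurable M"
  unfolding block_avg_def
  by (rule borel_measurable_labelling[OF assms, where G = "\<lambda>i. (\<integral>y. indicator (block M q i) y * f y \<partial>M) / measure M (block M q i)"])

lemma integrable_block_mult:
  fixes f :: "'a \<Rightarrow> real"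
  assumes "labelling M q" "integrable M f"
  shows "integrable M (\<lambda>x. indicator (block M q i) x * f x)"
  using integrable_mult_indicator[OF block_sets[OF assms(1)] assms(2)] by simp

lemma integrable_labelling_mult:
  assumes "labelling M q" "integrable M f"
  shows "integrable M (\<lambda>x. G (q x) * f x :: real)"
proof -
  have "integrable M (\<lambda>x. \<Sum>i\<in>q ` space M. G i * (indicator (block M q i) x * f x))"
    by (intro Bochner_Integration.integrable_sum integrable_mult_right integrable_block_mult assms)
  also have "?this \<longleftrightarrow> ?thesis"
  proof (rule Bochner_Integration.integrable_cong[OF refl])
    fix x assume "x \<in> space M"
    then show "(\<Sum>i\<in>q ` space M. G i * (indicator (block M q i) x * f x)) = G (q x) * f x"
      using sum_block_indicator[OF assms(1), of x "\<lambda>i. G i * f x"] by (simp add: mult.left_commute)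
  qed
  finally show ?thesis .
qed

lemma integrable_labelling:
  "labelling M q \<Longrightarrow> integrable M (\<lambda>x. G (q x) :: real)"
  using integrable_labelling_mult[of q "\<lambda>_. 1" G] by simp

lemma integrable_block_avg:
  "labelling M q \<Longrightarrow> integrable M (block_avg M q f)"
  unfolding block_avg_def
  by (rule integrable_labelling[where G = "\<lambda>i. (\<integral>y. indicator (block M q i) y * f y \<partial>M) / measure M (block M q i)"])

lemma integrable_mult_block_avg:
  "labelling M q \<Longrightarrow> integrable M g \<Longrightarrow> integrable M (\<lambda>x. block_avg M q f x * g x)"
  unfolding block_avg_def
  by (rule integrable_labelling_mult[where G = "\<lambda>i. (\<integral>y. indicator (block M q i) y * f y \<partial>M) / measure M (block M q i)"])

lemma integral_labelling_mult:
  fixes G :: "nat \<Rightarrow> real"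
  assumes "labelling M q" "integrable M f"
  shows "(\<integral>x. G (q x) * f x \<partial>M) =
    (\<Sum>i\<in>q ` space M. G i * (\<integral>x. indicator (block M q i) x * f x \<partial>M))"
proof -
  have "(\<integral>x. G (q x) * f x \<partial>M) =
      (\<integral>x. (\<Sum>i\<in>q ` space M. G i * (indicator (block M q i) x * f x)) \<partial>M)"
  proof (rule Bochner_Integration.integral_cong[OF refl])
    fix x assume "x \<in> space M"
    then show "G (q x) * f x = (\<Sum>i\<in>q ` space M. G i * (indicator (block M q i) x * f x))"
      using sum_block_indicator[OF assms(1), of x "\<lambda>i. G i * f x"] by (simp add: mult.left_commute)
  qed
  also have "\<dots> = (\<Sum>i\<in>q ` space M. G i * (\<integral>x. indicator (block M q i) x * f x \<partial>M))"
    using integrable_block_mult[OF assms] by (subst Bochner_Integration.integral_sum) auto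
  finally show ?thesis .
qed

text \<open>Self-adjointness of the conditional expectation: both sides are the sum over the blocks
  of the product of the two block integrals divided by the mass of the block.\<close>

lemma integral_block_avg_mult_commute:
  assumes "labelling M q" "integrable M f" "integrable M g"
  shows "(\<integral>x. block_avg M q f x * g x \<partial>M) = (\<integral>x. block_avg M q g x * f x \<partial>M)"
proof -
  let ?S = "\<lambda>f i. \<integral>y. indicator (block M q i) y * f y \<partial>M"
  have "(\<integral>x. block_avg M q f x * g x \<partial>M) =
      (\<Sum>i\<in>q ` space M. ?S f i / measure M (block M q i) * ?S g i)" (is "_ = ?R f g")
    unfolding block_avg_def
    by (rule integral_labelling_mult[OF assms(1,3), where G = "\<lambda>i. ?S f i / measure M (block M q i)"])
  moreover have "(\<integral>x. block_avg M q g x * f x \<partial>M) = ?R g f"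
    unfolding block_avg_def
    by (rule integral_labelling_mult[OF assms(1,2), where G = "\<lambda>i. ?S g i / measure M (block M q i)"])
  ultimately show ?thesis by (simp add: mult.commute)
qed

text \<open>There are only finitely many blocks, so the union of the null ones is null. This keeps
  the value 0 assigned on null blocks out of the almost-everywhere identities below.\<close>

lemma AE_block_pos:
  assumes "labelling M q"
  shows "AE x in M. 0 < measure M (block M q (q x))"
proof -
  have "AE x in M. \<forall>i\<in>q ` space M. measure M (block M q i) = 0 \<longrightarrow> x \<notin> block M q i"
  proof (rule AE_ball_countable'[where I="q ` space M"])
    fix i assume "i \<in> q ` space M"
    show "AE x in M. measure M (block M q i) = 0 \<longrightarrow> x \<notin> block M q i"
    proof (cases "measure M (block M q i) = 0")
      case True
      then have "block M q i \<in> null_sets M"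
        using assms by (simp add: null_sets_def emeasure_eq_measure)
      then show ?thesis using AE_not_in by auto
    qed simp
  qed (use assms in \<open>simp add: labelling_def countable_finite\<close>)
  then show ?thesis
  proof (rule AE_mp, intro AE_I2 impI)
    fix x assume "x \<in> space M" and *: "\<forall>i\<in>q ` space M. measure M (block M q i) = 0 \<longrightarrow> x \<notin> block M q i"
    then have "x \<in> block M q (q x)" "q x \<in> q ` space M" by (auto simp: block_def)
    with * have "measure M (block M q (q x)) \<noteq> 0" by blast
    then show "0 < measure M (block M q (q x))" using zero_less_measure_iff by blast
  qed
qed

text \<open>The factor is constant on the block over which the average at \<open>x\<close> is taken,
  so it comes out of the integral.\<close>

lemma block_avg_mult_labelling:
  "block_avg M q (\<lambda>y. G (q y) * f y) x = G (q x) * block_avg M q f x"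
proof -
  have "(\<lambda>y. indicator (block M q (q x)) y * (G (q y) * f y)) =
      (\<lambda>y. G (q x) * (indicator (block M q (q x)) y * f y))"
    by (auto simp: block_def indicator_def)
  then show ?thesis by (simp add: block_avg_def)
qed

lemma block_avg_const:
  assumes "labelling M q" "0 < measure M (block M q (q x))"
  shows "block_avg M q (\<lambda>_. c) x = c"
  using assms by (simp add: block_avg_def)

lemma block_avg_labelling:
  assumes "labelling M q" "0 < measure M (block M q (q x))"
  shows "block_avg M q (\<lambda>y. G (q y)) x = G (q x)"
  using block_avg_mult_labelling[of q G "\<lambda>_. 1" x] block_avg_const[OF assms, of 1] by simp

text \<open>An average is itself a function of the label, so averaging it again reproduces
  it.\<close>

lemma block_avg_block_avg:
  assumes "labelling M q" "0 < measure M (block M q (q x))"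
  shows "block_avg M q (block_avg M q f) x = block_avg M q f x"
proof -
  define S where "S = (\<lambda>i. (\<integral>y. indicator (block M q i) y * f y \<partial>M) / measure M (block M q i))"
  have "block_avg M q f = (\<lambda>x. S (q x))" by (simp add: fun_eq_iff S_def block_avg_def)
  then show ?thesis using block_avg_labelling[OF assms, of S] by simp
qed

lemma block_avg_mono:
  assumes "labelling M q" "integrable M f" "integrable M g" "\<And>y. y \<in> space M \<Longrightarrow> q y = q x \<Longrightarrow> f y \<le> g y"
  shows "block_avg M q f x \<le> block_avg M q g x"
  unfolding block_avg_def
  by (intro divide_right_mono integral_mono integrable_block_mult assms)
     (auto simp: indicator_def block_def assms)

lemma block_avg_add:
  assumes "labelling M q" "integrable M f" "integrable M g"
  shows "block_avg M q (\<lambda>y. f y + g y) x = block_avg M q f x + block_avg M q g x"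
  using integrable_block_mult[OF assms(1,2)] integrable_block_mult[OF assms(1,3)]
  unfolding block_avg_def by (simp add: distrib_left add_divide_distrib)

lemma block_avg_nonneg:
  assumes "\<And>y. y \<in> space M \<Longrightarrow> q y = q x \<Longrightarrow> 0 \<le> f y"
  shows "0 \<le> block_avg M q f x"
  unfolding block_avg_def
  by (intro divide_nonneg_nonneg Bochner_Integration.integral_nonneg) (auto simp: indicator_def block_def assms)

text \<open>Self-adjointness against the constant 1, whose average is 1 almost everywhere.\<close>

lemma integral_block_avg:
  assumes "labelling M q" "integrable M f"
  shows "(\<integral>x. block_avg M q f x \<partial>M) = (\<integral>x. f x \<partial>M)"
proof -
  have "(\<integral>x. block_avg M q f x \<partial>M) = (\<integral>x. block_avg M q (\<lambda>_. 1) x * f x \<partial>M)"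
    using integral_block_avg_mult_commute[OF assms, of "\<lambda>_. 1"] by simp
  also have "\<dots> = (\<integral>x. f x \<partial>M)"
  proof (rule integral_cong_AE)
    show "AE x in M. block_avg M q (\<lambda>_. 1) x * f x = f x"
      using AE_block_pos[OF assms(1)] by eventually_elim (simp add: block_avg_const[OF assms(1)])
  qed (use assms in auto)
  finally show ?thesis .
qed

text \<open>Pythagoras for the orthogonal projections onto nested spaces of step functions.\<close>

lemma integral_block_avg_diff_square:
  assumes q: "labelling M q" and q': "labelling M q'" and fac: "\<And>x. q x = \<phi> (q' x)"
    and f: "integrable M f"
  shows "(\<integral>x. (block_avg M q' f x - block_avg M q f x)\<^sup>2 \<partial>M) =
    (\<integral>x. block_avg M q' f x * f x \<partial>M) - (\<integral>x. block_avg M q f x * f x \<partial>M)"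
proof -
  let ?c = "block_avg M q f" and ?c' = "block_avg M q' f"
  \<comment> \<open>The defining property of a conditional expectation: tested against a function of
    the label, the average may be replaced by \<open>f\<close>.\<close>
  have tower: "(\<integral>x. block_avg M r f x * G (r x) \<partial>M) = (\<integral>x. G (r x) * f x \<partial>M)"
    if r: "labelling M r" for r and G :: "nat \<Rightarrow> real"
  proof -
    have "(\<integral>x. block_avg M r f x * G (r x) \<partial>M) = (\<integral>x. block_avg M r (\<lambda>x. G (r x)) x * f x \<partial>M)"
      by (rule integral_block_avg_mult_commute[OF r f integrable_labelling[OF r]])
    also have "\<dots> = (\<integral>x. G (r x) * f x \<partial>M)"
    proof (rule integral_cong_AE)
      show "AE x in M. block_avg M r (\<lambda>x. G (r x)) x * f x = G (r x) * f x"
        using AE_block_pos[OF r] by eventually_elim (simp add: block_avg_labelling[OF r])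
    qed (use r f borel_measurable_labelling[OF r] in auto)
    finally show ?thesis .
  qed
  define S where "S = (\<lambda>r i. (\<integral>y. indicator (block M r i) y * f y \<partial>M) / measure M (block M r i))"
  have S: "block_avg M r f x = S r (r x)" for r x by (simp add: S_def block_avg_def)
  have 1: "(\<integral>x. ?c' x * ?c' x \<partial>M) = (\<integral>x. ?c' x * f x \<partial>M)"
    using tower[OF q', of "S q'"] by (simp add: S)
  have 2: "(\<integral>x. ?c x * ?c x \<partial>M) = (\<integral>x. ?c x * f x \<partial>M)"
    using tower[OF q, of "S q"] by (simp add: S)
  \<comment> \<open>Because \<open>q\<close> factors through \<open>q'\<close>, the
    \<open>q\<close>-average is a function of the finer label and hence a test function for the
    \<open>q'\<close>-average.\<close>
  have 3: "(\<integral>x. ?c' x * ?c x \<partial>M) = (\<integral>x. ?c x * f x \<partial>M)"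
    using tower[OF q', of "\<lambda>i. S q (\<phi> i)"] by (simp add: S fac)
  have int: "integrable M (\<lambda>x. block_avg M r f x * block_avg M r' f x)" if "labelling M r" "labelling M r'" for r r'
    using that by (intro integrable_mult_block_avg integrable_block_avg)
  have "(\<integral>x. (?c' x - ?c x)\<^sup>2 \<partial>M) =
      (\<integral>x. ?c' x * ?c' x - 2 * (?c' x * ?c x) + ?c x * ?c x \<partial>M)"
    by (intro Bochner_Integration.integral_cong) (auto simp: power2_eq_square algebra_simps)
  also have "\<dots> = (\<integral>x. ?c' x * ?c' x \<partial>M) - 2 * (\<integral>x. ?c' x * ?c x \<partial>M) + (\<integral>x. ?c x * ?c x \<partial>M)"
    using int[OF q' q'] int[OF q' q] int[OF q q] by simp
  finally show ?thesis using 1 2 3 by simp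
qed

end

section \<open>Energy of a partition\<close>

context prob_space
begin

lemma integrable_indicator_prob: "A \<in> sets M \<Longrightarrow> integrable M (indicator A :: 'a \<Rightarrow> real)"
  by (intro integrable_real_indicator) (auto simp: emeasure_eq_measure)

lemma integrable_section_bounded:
  fixes \<tau> :: "'a \<times> 'a \<Rightarrow> real"
  assumes [measurable]: "\<tau> \<in> borel_measurable (M \<Otimes>\<^sub>M M)"
    and nn: "semimetric_on (space M) \<tau>"
    and bd: "\<And>x y. x \<in> space M \<Longrightarrow> y \<in> space M \<Longrightarrow> \<tau> (x, y) \<le> L"
    and x: "x \<in> space M"
  shows "integrable M (\<lambda>y. \<tau> (x, y))"
proof (rule integrable_const_bound[where B = L])
  show "AE y in M. norm (\<tau> (x, y)) \<le> L"
    using nn x bd by (intro AE_I2) (auto simp: semimetric_on_def)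
  show "(\<lambda>y. \<tau> (x, y)) \<in> borel_measurable M" using x by measurable
qed

lemma borel_measurable_block_avg_section:
  fixes \<tau> :: "'a \<times> 'a \<Rightarrow> real"
  assumes q: "labelling M q" and [measurable]: "\<tau> \<in> borel_measurable (M \<Otimes>\<^sub>M M)"
  shows "(\<lambda>x. block_avg M q (\<lambda>y. \<tau> (x, y)) x) \<in> borel_measurable M"
proof -
  note [measurable] = block_sets[OF q]
  have "(\<lambda>x. \<Sum>i\<in>q ` space M. indicator (block M q i) x *
     ((\<integral>y. indicator (block M q i) y * \<tau> (x, y) \<partial>M) / measure M (block M q i))) \<in> borel_measurable M"
    by measurable
  then show ?thesis
    by (rule measurable_cong[THEN iffD1, rotated]) (simp add: block_avg_eq_sum[OF q])
qed

text \<open>Only an inequality, because the average over a null block is 0; in this form it holds at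
  every point.\<close>

lemma block_avg_const_le:
  "labelling M q \<Longrightarrow> 0 \<le> c \<Longrightarrow> block_avg M q (\<lambda>_. c) x \<le> c"
  by (simp add: block_avg_def divide_le_eq)

lemma integrable_block_avg_section:
  fixes \<tau> :: "'a \<times> 'a \<Rightarrow> real"
  assumes q: "labelling M q" and m: "\<tau> \<in> borel_measurable (M \<Otimes>\<^sub>M M)"
    and nn: "semimetric_on (space M) \<tau>" and L: "0 \<le> L"
    and bd: "\<And>x y. x \<in> space M \<Longrightarrow> y \<in> space M \<Longrightarrow> \<tau> (x, y) \<le> L"
  shows "integrable M (\<lambda>x. block_avg M q (\<lambda>y. \<tau> (x, y)) x)"
proof (rule integrable_const_bound[where B = L])
  show "AE x in M. norm (block_avg M q (\<lambda>y. \<tau> (x, y)) x) \<le> L"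
  proof (rule AE_I2)
    fix x assume x: "x \<in> space M"
    have "0 \<le> block_avg M q (\<lambda>y. \<tau> (x, y)) x"
      using nn x by (intro block_avg_nonneg) (auto simp: semimetric_on_def)
    moreover have "block_avg M q (\<lambda>y. \<tau> (x, y)) x \<le> block_avg M q (\<lambda>_. L) x"
      using x by (intro block_avg_mono q integrable_section_bounded[OF m nn bd]) (auto intro: bd)
    ultimately show "norm (block_avg M q (\<lambda>y. \<tau> (x, y)) x) \<le> L"
      using block_avg_const_le[OF q L, of x] by simp
  qed
qed (rule borel_measurable_block_avg_section[OF q m])

text \<open>The sum of the squared L^2 norms of the conditional expectations of the cells, each
  written as the inner product of the expectation with the indicator. By Pythagoras it grows under
  refinement of \<open>q\<close> by the squared L^2 distances between the two expectations.\<close>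

definition partition_energy :: "nat \<Rightarrow> (nat \<Rightarrow> 'a set) \<Rightarrow> ('a \<Rightarrow> nat) \<Rightarrow> real" where
  "partition_energy k B q =
     (\<Sum>i\<le>k. \<integral>x. block_avg M q (indicator (B i)) x * indicator (B i) x \<partial>M)"

lemma block_avg_indicator_bounds:
  assumes q: "labelling M q" and B: "B \<in> sets M"
  shows "0 \<le> block_avg M q (indicator B) x" "block_avg M q (indicator B) x \<le> 1"
proof -
  show "0 \<le> block_avg M q (indicator B) x" by (rule block_avg_nonneg) simp
  have "block_avg M q (indicator B) x \<le> block_avg M q (\<lambda>_. 1) x"
    using B by (intro block_avg_mono q integrable_indicator_prob) (auto simp: indicator_def)
  also have "\<dots> \<le> 1" by (rule block_avg_const_le[OF q]) simp
  finally show "block_avg M q (indicator B) x \<le> 1" .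
qed

text \<open>Averages of indicators lie between 0 and 1, so each term is at most the mass of its
  cell, and the masses add up to 1.\<close>

lemma partition_energy_bounds:
  assumes q: "labelling M q" and B: "\<And>i. i \<le> k \<Longrightarrow> B i \<in> sets M"
    and part: "\<And>x. x \<in> space M \<Longrightarrow> (\<Sum>i\<le>k. indicator (B i) x) = (1::real)"
  shows "0 \<le> partition_energy k B q" "partition_energy k B q \<le> 1"
proof -
  have int: "integrable M (indicator (B i) :: 'a \<Rightarrow> real)" if "i \<le> k" for i
    using B[OF that] by (rule integrable_indicator_prob)
  show "0 \<le> partition_energy k B q"
    unfolding partition_energy_def
    by (intro sum_nonneg Bochner_Integration.integral_nonneg mult_nonneg_nonneg block_avg_indicator_bounds q B) auto
  have "partition_energy k B q \<le> (\<Sum>i\<le>k. \<integral>x. indicator (B i) x \<partial>M)"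
    unfolding partition_energy_def
  proof (intro sum_mono integral_mono)
    fix i x assume i: "i \<in> {..k}"
    show "integrable M (\<lambda>x. block_avg M q (indicator (B i)) x * indicator (B i) x)"
      using i by (intro integrable_mult_block_avg q int) auto
    show "integrable M (indicator (B i) :: 'a \<Rightarrow> real)" using int i by auto
    show "block_avg M q (indicator (B i)) x * indicator (B i) x \<le> (indicator (B i) x :: real)"
      using block_avg_indicator_bounds[OF q B] i by (intro mult_left_le_one_le) auto
  qed
  also have "\<dots> = (\<integral>x. (\<Sum>i\<le>k. indicator (B i) x) \<partial>M)"
    using int by (subst Bochner_Integration.integral_sum) auto
  also have "\<dots> = (\<integral>x. 1 \<partial>M)"
    by (intro Bochner_Integration.integral_cong part) auto
  finally show "partition_energy k B q \<le> 1" by (simp add: prob_space)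
qed

text \<open>
  If \<open>\<tau>\<close> is nearly constant on the blocks of the finer labelling \<open>q'\<close>, then a partition \<open>B\<close> can
  bring the points of \<open>B i\<close> close to \<open>p i\<close> only at the price of a jump of the energy of \<open>B\<close>
  between \<open>q\<close> and \<open>q'\<close>.
\<close>

lemma spread_le_of_centers:
  fixes \<tau> :: "'a \<times> 'a \<Rightarrow> real"
  assumes q: "labelling M q" and q': "labelling M q'" and fac: "\<And>x. q x = \<phi> (q' x)"
    and m: "\<tau> \<in> borel_measurable (M \<Otimes>\<^sub>M M)" and sm: "semimetric_on (space M) \<tau>"
    and L: "0 \<le> L" and bd: "\<And>x y. x \<in> space M \<Longrightarrow> y \<in> space M \<Longrightarrow> \<tau> (x, y) \<le> L"
    and B: "\<And>i. i \<le> k \<Longrightarrow> B i \<in> sets M"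
    and part: "\<And>x. x \<in> space M \<Longrightarrow> (\<Sum>i\<le>k. indicator (B i) x) = (1::real)"
    and p: "\<And>i. i \<le> k \<Longrightarrow> p i \<in> space M" and \<alpha>: "0 < \<alpha>"
  shows "spread M q \<tau> \<le> 2 * (\<Sum>i\<le>k. \<integral>y. indicator (B i) y * \<tau> (p i, y) \<partial>M) + 2 * spread M q' \<tau>
     + 2 * L * (real (k + 1) * \<alpha> + (partition_energy k B q' - partition_energy k B q) / \<alpha>)"
proof -
  let ?b = "\<lambda>i. indicator (B i) :: 'a \<Rightarrow> real"
  let ?t = "\<lambda>i y. \<tau> (p i, y)"
  let ?c = "\<lambda>i. block_avg M q (?b i)" and ?c' = "\<lambda>i. block_avg M q' (?b i)"
  let ?D = "\<lambda>r x. block_avg M r (\<lambda>y. \<tau> (x, y)) x"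
  have ib: "integrable M (?b i)" if "i \<le> k" for i using B[OF that] by (rule integrable_indicator_prob)
  have isec: "integrable M (\<lambda>y. \<tau> (x, y))" if "x \<in> space M" for x
    by (rule integrable_section_bounded[OF m sm bd that])
  have it: "integrable M (?t i)" if "i \<le> k" for i
    using isec[OF p[OF that]] .
  have iD: "integrable M (?D q)" "integrable M (?D q')"
    using integrable_block_avg_section[OF _ m sm L bd] q q' by auto
  have t0: "0 \<le> \<tau> (x, y)" if "x \<in> space M" "y \<in> space M" for x y
    using sm that by (auto simp: semimetric_on_def)
  have tri: "\<tau> (x, z) \<le> \<tau> (y, x) + \<tau> (y, z)" "\<tau> (y, z) \<le> \<tau> (x, z) + \<tau> (y, x)"
    "\<tau> (y, x) \<le> \<tau> (y, z) + \<tau> (x, z)"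
    if "x \<in> space M" "y \<in> space M" "z \<in> space M" for x y z
    using sm that unfolding semimetric_on_def by (metis add.commute)+
  \<comment> \<open>One cell \<open>B i\<close> at a time. The weight \<open>?c i\<close> is
    exchanged for \<open>?c' i\<close> and then for the indicator \<open>?b i\<close>; the first
    exchange costs energy, the second costs spread over \<open>q'\<close>.\<close>
  have step: "(\<integral>x. ?c i x * ?D q x \<partial>M) \<le> 2 * (\<integral>x. ?b i x * ?t i x \<partial>M)
      + 2 * (\<integral>x. ?b i x * ?D q' x \<partial>M)
      + 2 * L * (\<alpha> + ((\<integral>x. ?c' i x * ?b i x \<partial>M) - (\<integral>x. ?c i x * ?b i x \<partial>M)) / \<alpha>)"
    if i: "i \<le> k" for i
  proof -
    have c01: "0 \<le> ?c i x" "?c i x \<le> 1" "0 \<le> ?c' i x" "?c' i x \<le> 1" for x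
      using block_avg_indicator_bounds[OF q B[OF i]] block_avg_indicator_bounds[OF q' B[OF i]] by auto
    \<comment> \<open>The triangle inequality through \<open>p i\<close> bounds the mean distance by
      \<open>?t i x\<close> plus the \<open>q\<close>-average of \<open>?t i\<close>. Both have the
      same integral against \<open>?c i\<close>, which depends on the \<open>q\<close>-label
      only.\<close>
    have 1: "(\<integral>x. ?c i x * ?D q x \<partial>M) \<le> 2 * (\<integral>x. ?c i x * ?t i x \<partial>M)"
    proof -
      have "(\<integral>x. ?c i x * ?D q x \<partial>M) \<le> (\<integral>x. ?c i x * ?t i x + ?c i x * block_avg M q (?t i) x \<partial>M)"
      proof (rule integral_mono_AE)
        show "AE x in M. ?c i x * ?D q x \<le> ?c i x * ?t i x + ?c i x * block_avg M q (?t i) x"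
          using AE_block_pos[OF q] AE_space
        proof eventually_elim
          case (elim x)
          have "?D q x \<le> block_avg M q (\<lambda>y. ?t i x + ?t i y) x"
            using elim p[OF i] tri isec[of x] it[OF i] by (intro block_avg_mono q) auto
          also have "\<dots> = ?t i x + block_avg M q (?t i) x"
            using elim by (subst block_avg_add[OF q]) (auto intro: it i simp: block_avg_const[OF q])
          finally show ?case
            using c01(1)[of x] by (metis distrib_left mult_left_mono)
        qed
      qed (auto intro!: integrable_mult_block_avg integrable_block_avg iD it i q)
      also have "\<dots> = (\<integral>x. ?c i x * ?t i x \<partial>M) + (\<integral>x. ?c i x * block_avg M q (?t i) x \<partial>M)"
        by (intro Bochner_Integration.integral_add integrable_mult_block_avg integrable_block_avg it i q)
      also have "(\<integral>x. ?c i x * block_avg M q (?t i) x \<partial>M) = (\<integral>x. block_avg M q (?c i) x * ?t i x \<partial>M)"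
        by (subst integral_block_avg_mult_commute[OF q]) (auto intro!: integrable_block_avg q it i simp: mult.commute)
      also have "\<dots> = (\<integral>x. ?c i x * ?t i x \<partial>M)"
        by (rule integral_cong_AE)
          (use it[OF i] q in \<open>auto intro!: borel_measurable_times borel_measurable_block_avg AE_mp[OF AE_block_pos[OF q] AE_I2]
             simp: block_avg_block_avg[OF q]\<close>)
      finally show ?thesis by simp
    qed
    have 2: "(\<integral>x. ?c' i x * ?t i x \<partial>M) \<le> (\<integral>x. ?b i x * ?t i x \<partial>M) + (\<integral>x. ?b i x * ?D q' x \<partial>M)"
    proof -
      \<comment> \<open>Self-adjointness moves the average from the indicator to
        \<open>?t i\<close>, whose values at two points of a \<open>q'\<close>-block differ by at
        most their distance.\<close>
      have "(\<integral>x. ?c' i x * ?t i x \<partial>M) = (\<integral>x. block_avg M q' (?t i) x * ?b i x \<partial>M)"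
        by (rule integral_block_avg_mult_commute[OF q' ib it]) (use i in auto)
      also have "\<dots> \<le> (\<integral>x. ?b i x * ?t i x + ?b i x * ?D q' x \<partial>M)"
      proof (rule integral_mono_AE)
        show "AE x in M. block_avg M q' (?t i) x * ?b i x \<le> ?b i x * ?t i x + ?b i x * ?D q' x"
          using AE_block_pos[OF q'] AE_space
        proof eventually_elim
          case (elim x)
          have "block_avg M q' (?t i) x \<le> block_avg M q' (\<lambda>y. ?t i x + \<tau> (x, y)) x"
            using elim p[OF i] tri isec[of x] it[OF i] by (intro block_avg_mono q') (auto simp: add.commute)
          also have "\<dots> = ?t i x + ?D q' x"
            using elim isec[of x] by (subst block_avg_add[OF q']) (auto simp: block_avg_const[OF q'])
          finally show ?case by (auto simp: indicator_def)
        qed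
      qed (use ib[OF i] it[OF i] iD B[OF i] q' in \<open>auto intro!: integrable_block_avg integrable_mult_block_avg integrable_real_mult_indicator simp: mult.commute[of "indicator _ _"]\<close>)
      also have "\<dots> = (\<integral>x. ?b i x * ?t i x \<partial>M) + (\<integral>x. ?b i x * ?D q' x \<partial>M)"
        using it[OF i] iD B[OF i]
        by (intro Bochner_Integration.integral_add) (auto intro!: integrable_real_mult_indicator simp: mult.commute[of "indicator _ _"])
      finally show ?thesis .
    qed
    have 3: "(\<integral>x. ?c i x * ?t i x \<partial>M) \<le> (\<integral>x. ?c' i x * ?t i x \<partial>M)
      + L * (\<alpha> + (\<integral>x. (?c' i x - ?c i x)\<^sup>2 \<partial>M) / \<alpha>)"
    proof -
      have isq: "integrable M (\<lambda>x. (?c' i x - ?c i x)\<^sup>2)"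
      proof (rule integrable_const_bound[where B = 1])
        show "AE x in M. norm ((?c' i x - ?c i x)\<^sup>2) \<le> 1"
          using c01 by (intro AE_I2) (auto simp: abs_square_le_1 abs_le_iff, (smt (verit))+)
      qed (use q q' in auto)
      have "(\<integral>x. ?c i x * ?t i x \<partial>M) \<le>
          (\<integral>x. ?c' i x * ?t i x + (L * \<alpha> + (L / \<alpha>) * (?c' i x - ?c i x)\<^sup>2) \<partial>M)"
      proof (rule integral_mono)
        fix x assume x: "x \<in> space M"
        let ?d = "?c' i x - ?c i x"
        \<comment> \<open>The expression equals
          \<open>\<alpha>\<^sup>2 - \<alpha> * \<bar>?d\<bar> + ?d\<^sup>2\<close>. Dividing by
          \<alpha> trades the first power of the error for its square, which the energy
          controls.\<close>
        have "0 \<le> (\<alpha> - \<bar>?d\<bar>)\<^sup>2 + \<alpha> * \<bar>?d\<bar>" using \<alpha> by (intro add_nonneg_nonneg) auto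
        then have "\<alpha> * \<bar>?d\<bar> \<le> \<alpha> * \<alpha> + ?d\<^sup>2" by (simp add: power2_eq_square algebra_simps)
        then have "\<bar>?d\<bar> \<le> \<alpha> + ?d\<^sup>2 / \<alpha>" using \<alpha> by (simp add: field_simps)
        then have "L * \<bar>?d\<bar> \<le> L * \<alpha> + (L / \<alpha>) * ?d\<^sup>2"
          using mult_left_mono[OF _ L] by (fastforce simp: distrib_left)
        moreover have "- ?d * ?t i x \<le> \<bar>?d\<bar> * L"
          using t0[OF p[OF i] x] bd[OF p[OF i] x] by (intro mult_mono) auto
        ultimately show "?c i x * ?t i x \<le> ?c' i x * ?t i x + (L * \<alpha> + (L / \<alpha>) * ?d\<^sup>2)"
          by (simp add: algebra_simps)
      qed (use isq it[OF i] q q' in \<open>auto intro!: integrable_mult_block_avg\<close>)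
      also have "\<dots> = (\<integral>x. ?c' i x * ?t i x \<partial>M) + (L * \<alpha> + (L / \<alpha>) * (\<integral>x. (?c' i x - ?c i x)\<^sup>2 \<partial>M))"
        using isq integrable_mult_block_avg[OF q' it[OF i]] by (simp add: prob_space)
      finally show ?thesis by (simp add: algebra_simps)
    qed
    define J where "J = L * (\<alpha> + ((\<integral>x. ?c' i x * ?b i x \<partial>M) - (\<integral>x. ?c i x * ?b i x \<partial>M)) / \<alpha>)"
    \<comment> \<open>Pythagoras turns the squared distance of the two averages into the energy gain
      of this cell.\<close>
    have "(\<integral>x. ?c i x * ?D q x \<partial>M) \<le> 2 * (\<integral>x. ?b i x * ?t i x \<partial>M)
        + 2 * (\<integral>x. ?b i x * ?D q' x \<partial>M) + 2 * J"
      using 1 2 3 unfolding integral_block_avg_diff_square[OF q q' fac ib[OF i]] J_def[symmetric]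
      by linarith
    then show ?thesis unfolding J_def by (simp only: mult.assoc)
  qed
  have iDc: "integrable M (\<lambda>x. ?c i x * ?D q x)" for i
    by (rule integrable_mult_block_avg[OF q iD(1)])
  \<comment> \<open>The indicators of the cells sum to 1, hence so do their averages almost
    everywhere, and the spread splits into the contributions of the cells.\<close>
  have "spread M q \<tau> = (\<integral>x. (\<Sum>i\<le>k. ?c i x * ?D q x) \<partial>M)"
    unfolding spread_def
  proof (rule integral_cong_AE)
    show "AE x in M. ?D q x = (\<Sum>i\<le>k. ?c i x * ?D q x)"
      using AE_block_pos[OF q] AE_space
    proof eventually_elim
      case (elim x)
      have "(\<Sum>i\<le>k. ?c i x) = block_avg M q (\<lambda>x. \<Sum>i\<le>k. ?b i x) x"
        unfolding block_avg_def sum_distrib_left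
        by (subst Bochner_Integration.integral_sum)
           (auto intro!: integrable_block_mult q ib simp: sum_divide_distrib simp del: sum.inter_filter sum_mult_indicator)
      also have "\<dots> = block_avg M q (\<lambda>x. 1) x"
      proof -
        have "(\<integral>y. indicator (block M q (q x)) y * (\<Sum>i\<le>k. ?b i y) \<partial>M) = (\<integral>y. indicator (block M q (q x)) y * 1 \<partial>M)"
          by (intro Bochner_Integration.integral_cong refl) (subst part, auto)
        then show ?thesis unfolding block_avg_def by simp
      qed
      also have "\<dots> = 1" using elim by (simp add: block_avg_const[OF q])
      finally show ?case by (simp flip: sum_distrib_right)
    qed
  qed (use iD iDc in auto)
  also have "\<dots> = (\<Sum>i\<le>k. \<integral>x. ?c i x * ?D q x \<partial>M)"
    using iDc by (intro Bochner_Integration.integral_sum) auto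
  also have "\<dots> \<le> (\<Sum>i\<le>k. 2 * (\<integral>x. ?b i x * ?t i x \<partial>M)
      + 2 * (\<integral>x. ?b i x * ?D q' x \<partial>M)
      + 2 * L * (\<alpha> + ((\<integral>x. ?c' i x * ?b i x \<partial>M) - (\<integral>x. ?c i x * ?b i x \<partial>M)) / \<alpha>))"
    by (intro sum_mono step) auto
  also have "\<dots> = 2 * (\<Sum>i\<le>k. \<integral>x. ?b i x * ?t i x \<partial>M) + 2 * (\<Sum>i\<le>k. \<integral>x. ?b i x * ?D q' x \<partial>M)
      + 2 * L * (real (k + 1) * \<alpha> + (partition_energy k B q' - partition_energy k B q) / \<alpha>)"
    unfolding partition_energy_def
    by (simp add: sum.distrib flip: sum_distrib_left sum_divide_distrib sum_subtractf)
  also have "(\<Sum>i\<le>k. \<integral>x. ?b i x * ?D q' x \<partial>M) = (\<integral>x. (\<Sum>i\<le>k. ?b i x * ?D q' x) \<partial>M)"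
    using iD B by (intro Bochner_Integration.integral_sum[symmetric])
      (auto intro!: integrable_real_mult_indicator simp: mult.commute[of "indicator _ _"])
  also have "\<dots> = spread M q' \<tau>"
    unfolding spread_def
    by (intro Bochner_Integration.integral_cong refl) (simp add: part flip: sum_distrib_right)
  finally show ?thesis .
qed

end

section \<open>A common labelling for a convex family\<close>

text \<open>Measurability for the uncompleted product makes every section measurable, and
  separability on the whole space gives countable covers by balls without exceptional
  points.\<close>

definition regular_semimetric :: "'a measure \<Rightarrow> ('a \<times> 'a \<Rightarrow> real) \<Rightarrow> bool" where
  "regular_semimetric \<mu> \<rho> \<longleftrightarrow> semimetric_on (space \<mu>) \<rho> \<and>
     \<rho> \<in> borel_measurable (\<mu> \<Otimes>\<^sub>M \<mu>) \<and> separable_on (space \<mu>) \<rho>"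

text \<open>Equality on a square over a set of full measure is stronger than equality almost
  everywhere: it lets pointwise information, such as a small diameter, pass between the two
  semimetrics.\<close>

definition regular_version :: "'a measure \<Rightarrow> ('a \<times> 'a \<Rightarrow> real) \<Rightarrow> ('a \<times> 'a \<Rightarrow> real) \<Rightarrow> bool" where
  "regular_version \<mu> \<rho> \<rho>' \<longleftrightarrow> regular_semimetric \<mu> \<rho>' \<and>
     (\<exists>X\<in>sets \<mu>. space \<mu> - X \<in> null_sets \<mu> \<and> (\<forall>x\<in>X. \<forall>y\<in>X. \<rho>' (x, y) = \<rho> (x, y)))"

lemma semimetric_min:
  "semimetric_on X \<rho> \<Longrightarrow> 0 \<le> L \<Longrightarrow> semimetric_on X (\<lambda>z. min (\<rho> z) L)"
proof -
  assume \<rho>: "semimetric_on X \<rho>" and L: "0 \<le> L"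
  have *: "min a L \<le> min b L + min c L" if "a \<le> b + c" "0 \<le> b" "0 \<le> c" for a b c :: real
    using that L by (auto simp: min_def)
  show ?thesis
    using \<rho> L unfolding semimetric_on_def by (auto intro!: *)
qed

lemma diam_lessD:
  assumes "diam \<rho> A < ennreal e" "x \<in> A" "y \<in> A" "0 \<le> \<rho> (x, y)"
  shows "\<rho> (x, y) < e"
proof -
  have "ennreal (\<rho> (x, y)) \<le> diam \<rho> A"
    unfolding diam_def using assms by (intro SUP_upper2[of "(x, y)"]) auto
  then have "ennreal (\<rho> (x, y)) < ennreal e" using assms(1) by (rule le_less_trans)
  then show ?thesis using assms(4) by (simp add: ennreal_less_iff)
qed

text \<open>The average of n + 1 members is a two-point convex combination in which the new member
  has weight 1 / (n + 1).\<close>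

lemma convex_family_average:
  assumes K: "convex_family K" and f: "\<And>j. f j \<in> K" and n: "1 \<le> (n::nat)"
  shows "(\<lambda>z. (\<Sum>j<n. f j z) / real n) \<in> K"
  using n
proof (induction n rule: nat_induct_at_least)
  case base
  show ?case using f[of 0] by simp
next
  case (Suc n)
  let ?t = "1 / real (Suc n)"
  have "(\<lambda>z. (1 - ?t) * ((\<Sum>j<n. f j z) / real n) + ?t * f n z) \<in> K"
    using K[unfolded convex_family_def, rule_format, OF Suc.IH f[of n], of ?t] by simp
  also have "(\<lambda>z. (1 - ?t) * ((\<Sum>j<n. f j z) / real n) + ?t * f n z) =
      (\<lambda>z. (\<Sum>j<Suc n. f j z) / real (Suc n))"
  proof
    fix z
    have "1 - ?t = real n / real (Suc n)" by (simp add: field_simps)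
    then show "(1 - ?t) * ((\<Sum>j<n. f j z) / real n) + ?t * f n z = (\<Sum>j<Suc n. f j z) / real (Suc n)"
      using Suc(1) by (simp add: add_divide_distrib)
  qed
  finally show ?case .
qed

context prob_space
begin

text \<open>Countably many \<eta>-balls around a dense sequence cover the space, so finitely many of
  them cover all but mass \<eta>. Label i + 1 marks the points whose first ball is the i-th; label 0
  collects the uncovered points.\<close>

lemma labelling_of_regular:
  assumes reg: "regular_semimetric M \<rho>" and \<eta>: "0 < \<eta>"
  shows "\<exists>q d m. labelling M q \<and> measure M (block M q 0) < \<eta> \<and> (\<forall>x. q x \<le> m) \<and>
     (\<forall>x\<in>space M. q x \<noteq> 0 \<longrightarrow> d (q x) \<in> space M \<and> \<rho> (d (q x), x) < \<eta>)"
proof -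
  have sm: "semimetric_on (space M) \<rho>" and [measurable]: "\<rho> \<in> borel_measurable (M \<Otimes>\<^sub>M M)"
    using reg by (auto simp: regular_semimetric_def)
  obtain D where D: "countable D" "D \<subseteq> space M" "\<And>x e. x \<in> space M \<Longrightarrow> 0 < e \<Longrightarrow> \<exists>d\<in>D. \<rho> (x, d) < e"
    using reg unfolding regular_semimetric_def separable_on_def by blast
  have "D \<noteq> {}" using not_empty D(3)[OF _ \<eta>] by blast
  define e where "e = from_nat_into D"
  have eD: "e i \<in> space M" for i
    using from_nat_into[OF \<open>D \<noteq> {}\<close>] D(2) unfolding e_def by auto
  define U where "U i = {x \<in> space M. \<rho> (e i, x) < \<eta>}" for i
  have [measurable]: "(\<lambda>x. \<rho> (e i, x)) \<in> borel_measurable M" for i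
    using eD by (intro measurable_compose[OF _ \<open>\<rho> \<in> _\<close>] measurable_Pair1') auto
  have U [measurable]: "U i \<in> sets M" for i unfolding U_def by measurable
  have cover: "(\<Union>m. \<Union>i<m. U i) = space M"
  proof (intro equalityI subsetI)
    fix x assume x: "x \<in> space M"
    then obtain d where d: "d \<in> D" "\<rho> (x, d) < \<eta>" using D(3) \<eta> by blast
    then obtain i where "e i = d" using from_nat_into_surj[OF D(1)] e_def by blast
    moreover have "\<rho> (d, x) = \<rho> (x, d)" using sm x d D(2) unfolding semimetric_on_def by blast
    ultimately show "x \<in> (\<Union>m. \<Union>i<m. U i)" 
      using x d by (auto simp: U_def intro!: exI[of _ "Suc i"] bexI[of _ i])
  qed (auto simp: U_def)
  have "(\<lambda>m. measure M (\<Union>i<m. U i)) \<longlonglongrightarrow> measure M (\<Union>m. \<Union>i<m. U i)"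
  proof (rule finite_Lim_measure_incseq)
    show "incseq (\<lambda>m. \<Union>i<m. U i)" by (intro monoI UN_mono) auto
  qed auto
  then have "(\<lambda>m. measure M (\<Union>i<m. U i)) \<longlonglongrightarrow> 1" unfolding cover by (simp add: prob_space)
  then have "\<forall>\<^sub>F m in sequentially. 1 - \<eta> < measure M (\<Union>i<m. U i)"
    using \<eta> by (intro order_tendstoD) auto
  then obtain m where m: "1 - \<eta> < measure M (\<Union>i<m. U i)" by (auto simp: eventually_sequentially)
  define q where "q x = (if \<exists>i<m. x \<in> U i then Suc (LEAST i. x \<in> U i) else 0)" for x
  have qm: "q x \<le> m" for x
  proof (cases "\<exists>i<m. x \<in> U i")
    case True
    then obtain i where "i < m" "x \<in> U i" by blast
    then have "(LEAST i. x \<in> U i) < m" using Least_le[of "\<lambda>i. x \<in> U i" i] by simp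
    then show ?thesis using True by (simp add: q_def)
  qed (simp only: q_def if_False)
  have "q \<in> measurable M (count_space UNIV)" unfolding q_def by measurable
  moreover have "finite (q ` space M)"
    by (rule finite_subset[of _ "{..m}"]) (use qm in auto)
  ultimately have "labelling M q" by (simp only: labelling_def)
  moreover have "measure M (block M q 0) < \<eta>"
  proof -
    have "block M q 0 = space M - (\<Union>i<m. U i)" unfolding block_def q_def by auto
    then show ?thesis using m by (simp add: prob_compl)
  qed
  moreover have "\<rho> (e (q x - 1), x) < \<eta>" if "q x \<noteq> 0" for x
  proof -
    have "\<exists>i. x \<in> U i" "q x = Suc (LEAST i. x \<in> U i)"
      using that unfolding q_def by (auto split: if_splits)
    then have "x \<in> U (q x - 1)" using LeastI_ex[of "\<lambda>i. x \<in> U i"] by simp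
    then show ?thesis by (simp add: U_def)
  qed
  ultimately show ?thesis
    using qm eD by (intro exI[of _ q] exI[of _ "\<lambda>i. e (i - 1)"] exI[of _ m]) auto
qed

lemma labelling_pair:
  assumes "labelling M q" "labelling M r"
  shows "labelling M (\<lambda>x. prod_encode (q x, r x))"
proof -
  have [measurable]: "q \<in> measurable M (count_space UNIV)" "r \<in> measurable M (count_space UNIV)"
    using assms by (simp_all only: labelling_def)
  have "(\<lambda>x. prod_encode (q x, r x)) \<in> measurable M (count_space UNIV)" by measurable
  moreover have "finite ((\<lambda>x. prod_encode (q x, r x)) ` space M)"
  proof (rule finite_subset)
    show "(\<lambda>x. prod_encode (q x, r x)) ` space M \<subseteq> prod_encode ` (q ` space M \<times> r ` space M)" by auto
    show "finite (prod_encode ` (q ` space M \<times> r ` space M))"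
      by (rule finite_imageI, rule finite_cartesian_product) (use assms in \<open>auto simp only: labelling_def\<close>)
  qed
  ultimately show ?thesis by (simp only: labelling_def)
qed

lemma refine_labelling:
  assumes reg: "regular_semimetric M \<rho>" and L: "0 < L" and \<eta>: "0 < \<eta>" and q: "labelling M q"
  shows "\<exists>q' \<phi>. labelling M q' \<and> (\<forall>x. q x = \<phi> (q' x)) \<and> spread M q' (\<lambda>z. min (\<rho> z) L) \<le> \<eta>"
proof -
  \<comment> \<open>Distances are at most \<open>2 * e\<close> inside a block with nonzero ball
    label; the other blocks have total mass below \<open>e\<close> and truncated distances at most
    \<open>L\<close>. Together this gives \<open>e * (L + 2)\<close>.\<close>
  define e where "e = \<eta> / (L + 2)"
  have e: "0 < e" "e * (L + 2) = \<eta>" using L \<eta> by (auto simp: e_def)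
  obtain r d m where r: "labelling M r" "measure M (block M r 0) < e"
    "\<And>x. x \<in> space M \<Longrightarrow> r x \<noteq> 0 \<Longrightarrow> d (r x) \<in> space M \<and> \<rho> (d (r x), x) < e"
    using labelling_of_regular[OF reg e(1)] by blast
  define q' where "q' x = prod_encode (q x, r x)" for x
  have q': "labelling M q'" unfolding q'_def by (rule labelling_pair[OF q r(1)])
  let ?\<tau> = "\<lambda>z. min (\<rho> z) L"
  have sm0: "semimetric_on (space M) \<rho>" and m0: "\<rho> \<in> borel_measurable (M \<Otimes>\<^sub>M M)"
    using reg by (auto simp: regular_semimetric_def)
  have sm: "semimetric_on (space M) ?\<tau>" using semimetric_min[OF sm0] L by simp
  have m: "?\<tau> \<in> borel_measurable (M \<Otimes>\<^sub>M M)" using m0 by measurable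
  have "block_avg M q' (\<lambda>y. ?\<tau> (x, y)) x \<le> 2 * e + L * indicator (block M r 0) x" if x: "x \<in> space M" for x
  proof -
    define c where "c = 2 * e + L * indicator (block M r 0) x"
    have "0 \<le> c" using L e by (simp add: c_def)
    have "block_avg M q' (\<lambda>y. ?\<tau> (x, y)) x \<le> block_avg M q' (\<lambda>_. c) x"
    proof (intro block_avg_mono q')
      fix y assume y: "y \<in> space M" "q' y = q' x"
      then have ryx: "r y = r x" by (simp add: q'_def)
      show "?\<tau> (x, y) \<le> c"
      proof (cases "r x = 0")
        case True
        then show ?thesis using x e L by (simp add: c_def block_def)
      next
        case False
        then have *: "d (r x) \<in> space M" "\<rho> (d (r x), x) < e" "\<rho> (d (r x), y) < e"
          using r(3)[OF x] r(3)[OF y(1)] ryx by auto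
        have "\<rho> (x, y) \<le> \<rho> (x, d (r x)) + \<rho> (d (r x), y)" "\<rho> (x, d (r x)) = \<rho> (d (r x), x)"
          using sm0 x y *(1) unfolding semimetric_on_def by blast+
        then have "\<rho> (x, y) \<le> 2 * e" using * by simp
        then show ?thesis using L by (simp add: c_def indicator_def min_le_iff_disj add_increasing2)
      qed
    qed (use x in \<open>auto intro!: integrable_section_bounded[OF m sm, of L]\<close>)
    also have "\<dots> \<le> c" by (rule block_avg_const_le[OF q' \<open>0 \<le> c\<close>])
    finally show ?thesis by (simp add: c_def)
  qed
  then have "spread M q' ?\<tau> \<le> (\<integral>x. 2 * e + L * indicator (block M r 0) x \<partial>M)"
    unfolding spread_def
    using L by (intro integral_mono integrable_block_avg_section[OF q' m sm, of L])
      (auto intro!: integrable_indicator_prob block_sets r(1))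
  also have "\<dots> = 2 * e + L * measure M (block M r 0)"
    using block_sets[OF r(1)] by (simp add: integrable_indicator_prob prob_space)
  also have "\<dots> \<le> 2 * e + L * e" using r(2) L by simp
  also have "\<dots> = \<eta>" using e(2) by (simp add: algebra_simps)
  finally show ?thesis
    using q' by (intro exI[of _ q'] exI[of _ "\<lambda>i. fst (prod_decode i)"]) (auto simp: q'_def)
qed

text \<open>A cover becomes a measurable partition with one centre per cell. Points outside the full
  set \<open>X\<close> join the exceptional cell 0, which they enlarge only by a null set, so the
  small distances are distances between points of \<open>X\<close>.\<close>

lemma small_distance_centers:
  assumes cov: "eps_cover e \<sigma> M k" and e: "0 < e" and X: "X \<in> sets M" "space M - X \<in> null_sets M"
    and nn: "\<And>z. z \<in> X \<times> X \<Longrightarrow> 0 \<le> \<sigma> z"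
  shows "\<exists>B p. (\<forall>i\<le>k. B i \<in> sets M) \<and> (\<forall>x\<in>space M. (\<Sum>i\<le>k. indicator (B i) x) = (1::real)) \<and>
    (\<forall>i. p i \<in> space M) \<and> measure M (B 0) < e \<and>
    (\<forall>i\<in>{1..k}. \<forall>y\<in>B i. p i \<in> X \<and> y \<in> X \<and> \<sigma> (p i, y) < e)"
proof -
  obtain A :: "nat \<Rightarrow> 'a set" where A: "\<And>j. j \<le> k \<Longrightarrow> A j \<in> sets M" "(\<Union>j\<le>k. A j) = space M"
      "emeasure M (A 0) < ennreal e" "\<And>j. j \<in> {1..k} \<Longrightarrow> diam \<sigma> (A j) < ennreal e"
    using cov unfolding eps_cover_def by blast
  define b where "b x = (if x \<in> X then LEAST j. x \<in> A j else 0)" for x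
  define B where "B i = {x \<in> space M. b x = i}" for i
  have ex: "\<exists>j\<le>k. x \<in> A j" if "x \<in> space M" for x using A(2) that by blast
  have bk: "b x \<le> k" if x: "x \<in> space M" for x
  proof -
    from ex[OF x] obtain j where "j \<le> k" "x \<in> A j" by blast
    then show ?thesis using Least_le[of "\<lambda>j. x \<in> A j" j] by (auto simp: b_def)
  qed
  have bA: "x \<in> A (b x)" if x: "x \<in> space M" "x \<in> X" for x
  proof -
    have "\<exists>j. x \<in> A j" using ex[OF x(1)] by auto
    from LeastI_ex[OF this] show ?thesis using x(2) by (simp add: b_def)
  qed
  have Beq: "B i = (X \<inter> (A i - (\<Union>j<i. A j))) \<union> (if i = 0 then space M - X else {})"
    if i: "i \<le> k" for i
  proof -
    have "(LEAST j. x \<in> A j) = i \<longleftrightarrow> x \<in> A i - (\<Union>j<i. A j)" if "x \<in> space M" for x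
    proof
      assume i: "(LEAST j. x \<in> A j) = i"
      have "\<exists>j. x \<in> A j" using ex[OF that] by auto
      from LeastI_ex[OF this] have "x \<in> A i" unfolding i .
      moreover have "x \<notin> A j" if "j < i" for j
        using not_less_Least[of j "\<lambda>j. x \<in> A j"] that unfolding i by simp
      ultimately show "x \<in> A i - (\<Union>j<i. A j)" by simp
    next
      assume *: "x \<in> A i - (\<Union>j<i. A j)"
      show "(LEAST j. x \<in> A j) = i"
      proof (rule Least_equality)
        show "i \<le> j" if "x \<in> A j" for j
          using * that by (cases "j < i") auto
      qed (use * in simp)
    qed
    then show ?thesis using sets.sets_into_space[OF X(1)] unfolding B_def b_def by auto
  qed
  have B: "B i \<in> sets M" if "i \<le> k" for i
    unfolding Beq[OF that] using A(1) X that by auto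
  have part: "(\<Sum>i\<le>k. indicator (B i) x) = (1::real)" if x: "x \<in> space M" for x
  proof -
    have "(\<Sum>i\<le>k. indicator (B i) x) = (\<Sum>i\<le>k. if i = b x then 1 else (0::real))"
      using x by (intro sum.cong) (auto simp: B_def indicator_def)
    then show ?thesis using bk[OF x] by simp
  qed
  have B0: "measure M (B 0) < e"
  proof -
    have "emeasure M (B 0) \<le> emeasure M (A 0 \<union> (space M - X))"
      using A(1)[of 0] X by (intro emeasure_mono) (auto simp: Beq)
    also have "\<dots> = emeasure M (A 0)"
      using A(1)[of 0] X by (intro emeasure_Un_null_set) auto
    also have "\<dots> < ennreal e" by fact
    finally show ?thesis by (simp add: emeasure_eq_measure ennreal_less_iff)
  qed
  \<comment> \<open>An empty cell still receives a centre in the space, because later integrals are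
    formed for every index.\<close>
  define p where "p i = (if B i \<noteq> {} then SOME x. x \<in> B i else SOME x. x \<in> space M)" for i
  have pB: "p i \<in> B i" if "B i \<noteq> {}" for i unfolding p_def if_P[OF that] using that by (rule some_in_eq[THEN iffD2])
  have pS: "p i \<in> space M" for i
  proof (cases "B i = {}")
    case True
    then show ?thesis using some_in_eq[of "space M"] not_empty by (simp add: p_def)
  next
    case False
    then show ?thesis using pB[OF False] by (simp add: B_def)
  qed
  have close: "p i \<in> X \<and> y \<in> X \<and> \<sigma> (p i, y) < e" if i: "i \<in> {1..k}" and y: "y \<in> B i" for i y
  proof -
    have *: "p i \<in> B i" using y by (intro pB) auto
    have X: "p i \<in> X" "y \<in> X" using * y i by (auto simp: B_def b_def split: if_splits)
    moreover have "p i \<in> A i" "y \<in> A i"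
      using bA[of "p i"] bA[of y] X * y by (auto simp: B_def)
    ultimately show ?thesis using diam_lessD[OF A(4)[OF i], of "p i" y] nn[of "(p i, y)"] by simp
  qed
  show ?thesis
    using B part pS B0 close by (intro exI[of _ B] exI[of _ p] conjI) simp_all
qed

text \<open>An energy increment argument. The number of cells is bounded before the number
  \<open>n\<close> of stages is chosen, and the energy gained over all stages is at most 1; for
  large \<open>n\<close> the gain per stage cannot pay for a spread above \<epsilon>.\<close>

lemma common_labelling:
  assumes conv: "convex_family F"
    and reg: "\<And>\<rho>. \<rho> \<in> F \<Longrightarrow> regular_version M \<rho> (r \<rho>)"
    and ent: "\<And>e::real. 0 < e \<Longrightarrow> \<exists>K::nat. \<forall>\<rho>\<in>F. \<exists>k\<le>K. eps_cover e \<rho> M k"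
    and L: "0 < L" and \<epsilon>: "0 < \<epsilon>"
  shows "\<exists>q. labelling M q \<and> (\<forall>\<rho>\<in>F. spread M q (\<lambda>z. min (r \<rho> z) L) \<le> \<epsilon>)"
proof (rule ccontr)
  assume neg: "\<not> ?thesis"
  let ?T = "\<lambda>\<rho> z. min (r \<rho> z) L"
  have rg: "regular_semimetric M (r \<rho>)" if "\<rho> \<in> F" for \<rho> using reg[OF that] by (simp add: regular_version_def)
  from neg have "\<forall>q. \<exists>\<rho>. labelling M q \<longrightarrow> \<rho> \<in> F \<and> \<epsilon> < spread M q (?T \<rho>)"
    by (meson not_le)
  then obtain R where R: "\<And>q. labelling M q \<Longrightarrow> R q \<in> F" "\<And>q. labelling M q \<Longrightarrow> \<epsilon> < spread M q (?T (R q))"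
    by metis
  \<comment> \<open>The remaining spread enters the main estimate twice and so contributes
    \<epsilon>/8 per stage.\<close>
  have "\<forall>q. \<exists>q'. labelling M q \<longrightarrow> labelling M q' \<and> (\<exists>\<phi>. \<forall>x. q x = \<phi> (q' x)) \<and> spread M q' (?T (R q)) \<le> \<epsilon> / 16"
  proof
    fix q
    show "\<exists>q'. labelling M q \<longrightarrow> labelling M q' \<and> (\<exists>\<phi>. \<forall>x. q x = \<phi> (q' x)) \<and> spread M q' (?T (R q)) \<le> \<epsilon> / 16"
    proof (cases "labelling M q")
      case True
      have "0 < \<epsilon> / 16" using \<epsilon> by simp
      from refine_labelling[OF rg[OF R(1)[OF True]] L this True] show ?thesis by iprover
    qed simp
  qed
  then obtain N where N: "\<And>q. labelling M q \<Longrightarrow> labelling M (N q)"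
      "\<And>q. labelling M q \<Longrightarrow> \<exists>\<phi>. \<forall>x. q x = \<phi> (N q x)"
      "\<And>q. labelling M q \<Longrightarrow> spread M (N q) (?T (R q)) \<le> \<epsilon> / 16"
    by metis
  define Q where "Q j = (N ^^ j) (\<lambda>_. 0)" for j
  have "labelling M (\<lambda>_. 0)" unfolding labelling_def by (auto intro: finite_subset[of _ "{0}"])
  then have Q: "labelling M (Q j)" for j
    unfolding Q_def by (induction j) (auto intro: N(1))
  have QS: "Q (Suc j) = N (Q j)" for j by (simp add: Q_def)
  define f where "f j = R (Q j)" for j
  have f: "f j \<in> F" for j unfolding f_def by (rule R(1)[OF Q])
  \<comment> \<open>In the mean distance to the centres, the cells of small diameter contribute at
    most \<open>e'\<close> and the exceptional cell at most \<open>L * e'\<close>; the sum is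
    \<epsilon>/16.\<close>
  define e' where "e' = \<epsilon> / (16 * (1 + L))"
  have e': "0 < e'" "e' * (1 + L) = \<epsilon> / 16"
    using L \<epsilon> by (simp_all add: e'_def divide_simps)
  obtain K where K: "\<And>\<rho>. \<rho> \<in> F \<Longrightarrow> \<exists>k\<le>K. eps_cover e' \<rho> M k" using ent[OF e'(1)] by blast
  \<comment> \<open>With at most \<open>K + 1\<close> cells, the term proportional to \<alpha> is at
    most \<epsilon>/16 per stage.\<close>
  define \<alpha> where "\<alpha> = \<epsilon> / (16 * L * (real K + 1))"
  have \<alpha>: "0 < \<alpha>" "L * (real K + 1) * \<alpha> = \<epsilon> / 16" 
    using L \<epsilon> by (simp_all add: \<alpha>_def divide_simps)
  \<comment> \<open>The total energy gain contributes at most \<open>L / \<alpha>\<close>, which for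
    this \<open>n\<close> is at most \<epsilon>/16 per stage.\<close>
  obtain n :: nat where n0: "16 * L / (\<alpha> * \<epsilon>) < real n" using reals_Archimedean2 by blast
  have "0 < 16 * L / (\<alpha> * \<epsilon>)" using L \<epsilon> \<alpha> by simp
  then have n: "1 \<le> n" using n0 by (cases n) auto
  have n1: "L / \<alpha> \<le> real n * (\<epsilon> / 16)"
    using n0 \<alpha>(1) \<epsilon> by (simp add: field_simps)
  define \<sigma> where "\<sigma> z = (\<Sum>j<n. f j z) / real n" for z
  have "\<sigma> \<in> F" unfolding \<sigma>_def[abs_def] by (rule convex_family_average[OF conv f n])
  then obtain k where k: "k \<le> K" "eps_cover e' \<sigma> M k" using K by blast
  have "\<forall>j. \<exists>X\<in>sets M. space M - X \<in> null_sets M \<and> (\<forall>x\<in>X. \<forall>y\<in>X. r (f j) (x, y) = f j (x, y))"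
    using reg[OF f] unfolding regular_version_def by blast
  then obtain X where X: "\<And>j. X j \<in> sets M" "\<And>j. space M - X j \<in> null_sets M"
      "\<And>j x y. x \<in> X j \<Longrightarrow> y \<in> X j \<Longrightarrow> r (f j) (x, y) = f j (x, y)" by metis
  \<comment> \<open>One full set on which all the chosen semimetrics agree with their regular
    versions, and hence \<sigma> with the average of these versions.\<close>
  define Y where "Y = (\<Inter>j. X j)"
  have Y: "Y \<in> sets M" unfolding Y_def using X(1) by auto
  have "space M - Y = (\<Union>j. space M - X j)" unfolding Y_def by auto
  then have Y0: "space M - Y \<in> null_sets M" by (simp only: null_sets_UN[OF X(2)])
  have Ys: "Y \<subseteq> space M" using sets.sets_into_space[OF Y] .
  have sm: "semimetric_on (space M) (r (f j))" and m: "r (f j) \<in> borel_measurable (M \<Otimes>\<^sub>M M)" for j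
    using rg[OF f] by (auto simp: regular_semimetric_def)
  have rnn: "0 \<le> r (f j) (x, y)" if "x \<in> space M" "y \<in> space M" for j x y
    using sm[of j] that unfolding semimetric_on_def by blast
  have smT: "semimetric_on (space M) (?T (f j))" and mT: "?T (f j) \<in> borel_measurable (M \<Otimes>\<^sub>M M)" for j
    using semimetric_min[OF sm] L m[of j] by auto
  have \<sigma>eq: "\<sigma> (x, y) = (\<Sum>j<n. r (f j) (x, y)) / real n" if "x \<in> Y" "y \<in> Y" for x y
    unfolding \<sigma>_def using that X(3) by (auto simp: Y_def)
  obtain B p where B: "\<And>i. i \<le> k \<Longrightarrow> B i \<in> sets M"
      "\<And>x. x \<in> space M \<Longrightarrow> (\<Sum>i\<le>k. indicator (B i) x) = (1::real)"
      "\<And>i. p i \<in> space M" "measure M (B 0) < e'"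
      "\<And>i y. i \<in> {1..k} \<Longrightarrow> y \<in> B i \<Longrightarrow> p i \<in> Y \<and> y \<in> Y \<and> \<sigma> (p i, y) < e'"
  proof -
    have "0 \<le> \<sigma> z" if "z \<in> Y \<times> Y" for z
      using that Ys \<sigma>eq by (auto intro!: divide_nonneg_nonneg sum_nonneg rnn)
    from small_distance_centers[OF k(2) e'(1) Y Y0 this] show ?thesis using that by blast
  qed
  let ?S = "\<lambda>j. \<Sum>i\<le>k. \<integral>y. indicator (B i) y * ?T (f j) (p i, y) \<partial>M"
  have isec: "integrable M (\<lambda>y. indicator (B i) y * ?T (f j) (p i, y))" if "i \<le> k" for i j
    using integrable_real_mult_indicator[OF B(1)[OF that] integrable_section_bounded[where L = L, OF mT smT _ B(3)]]
    by (simp add: mult.commute)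
  \<comment> \<open>A small \<sigma> bounds the sum of the distances over all stages, not each stage
    alone: by \<open>real n * e'\<close> on the small cells. On the exceptional cell the truncation
    gives \<open>real n * L\<close>.\<close>
  have S: "(\<Sum>j<n. ?S j) \<le> real n * (\<epsilon> / 16)"
  proof -
    have "(\<Sum>j<n. ?S j) = (\<Sum>i\<le>k. \<integral>y. (\<Sum>j<n. indicator (B i) y * ?T (f j) (p i, y)) \<partial>M)"
      by (subst sum.swap, intro sum.cong refl Bochner_Integration.integral_sum[symmetric] isec) auto
    also have "\<dots> \<le> (\<Sum>i\<le>k. real n * ((if i = 0 then L else e') * measure M (B i)))"
    proof (rule sum_mono)
      fix i assume i: "i \<in> {..k}"
      have "(\<integral>y. (\<Sum>j<n. indicator (B i) y * ?T (f j) (p i, y)) \<partial>M) \<le>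
          (\<integral>y. real n * (if i = 0 then L else e') * indicator (B i) y \<partial>M)"
      proof (rule integral_mono)
        fix y assume y: "y \<in> space M"
        have "(\<Sum>j<n. ?T (f j) (p i, y)) \<le> real n * (if i = 0 then L else e')" if "y \<in> B i"
        proof (cases "i = 0")
          case True
          have "(\<Sum>j<n. ?T (f j) (p i, y)) \<le> (\<Sum>j<n. L)" by (intro sum_mono) auto
          then show ?thesis using True by simp
        next
          case False
          then have "p i \<in> Y" "y \<in> Y" "\<sigma> (p i, y) < e'" using B(5)[of i y] that i by auto
          then have "(\<Sum>j<n. r (f j) (p i, y)) \<le> real n * e'" using n by (simp add: \<sigma>eq field_simps)
          moreover have "(\<Sum>j<n. ?T (f j) (p i, y)) \<le> (\<Sum>j<n. r (f j) (p i, y))" by (intro sum_mono) auto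
          ultimately show ?thesis using False by simp
        qed
        then show "(\<Sum>j<n. indicator (B i) y * ?T (f j) (p i, y)) \<le> real n * (if i = 0 then L else e') * indicator (B i) y"
          by (cases "y \<in> B i") auto
      next
        show "integrable M (\<lambda>y. \<Sum>j<n. indicator (B i) y * ?T (f j) (p i, y))"
          using i by (intro Bochner_Integration.integrable_sum isec) simp
        show "integrable M (\<lambda>y. real n * (if i = 0 then L else e') * indicator (B i) y)"
          using i B(1) by (intro integrable_mult_right integrable_indicator_prob) simp
      qed
      also have "\<dots> = real n * ((if i = 0 then L else e') * measure M (B i))"
        using i B(1) by (simp add: mult.assoc)
      finally show "(\<integral>y. (\<Sum>j<n. indicator (B i) y * ?T (f j) (p i, y)) \<partial>M) \<le> \<dots>" .
    qed
    also have "\<dots> \<le> (\<Sum>i\<le>k. real n * ((if i = 0 then L * e' else 0) + e' * measure M (B i)))"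
      using L B(4) e'(1) by (intro sum_mono mult_left_mono) (auto intro!: add_increasing2 mult_left_mono)
    also have "\<dots> = real n * (L * e' + e' * (\<Sum>i\<le>k. measure M (B i)))"
      by (simp add: sum.distrib flip: sum_distrib_left)
    also have "(\<Sum>i\<le>k. measure M (B i)) = (\<integral>y. (\<Sum>i\<le>k. indicator (B i) y) \<partial>M)"
      using B(1) by (subst Bochner_Integration.integral_sum) (auto intro!: integrable_indicator_prob)
    also have "\<dots> = (\<integral>y. 1 \<partial>M)" by (intro Bochner_Integration.integral_cong refl B(2))
    finally have "(\<Sum>j<n. ?S j) \<le> real n * (e' * (1 + L))" by (simp add: prob_space algebra_simps)
    then show ?thesis unfolding e'(2) .
  qed
  let ?E = "partition_energy k B"
  have step: "\<epsilon> \<le> 2 * ?S j + \<epsilon> / 8 + 2 * L * (real (k + 1) * \<alpha> + (?E (Q (Suc j)) - ?E (Q j)) / \<alpha>)" for j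
  proof -
    obtain \<phi> where \<phi>: "\<And>x. Q j x = \<phi> (Q (Suc j) x)" using N(2)[OF Q, of j] unfolding QS by blast
    have "spread M (Q j) (?T (f j)) \<le> 2 * ?S j + 2 * spread M (Q (Suc j)) (?T (f j))
        + 2 * L * (real (k + 1) * \<alpha> + (?E (Q (Suc j)) - ?E (Q j)) / \<alpha>)"
      using L by (intro spread_le_of_centers[OF Q Q \<phi> mT smT _ _ B(1) B(2) B(3) \<alpha>(1)]) auto
    moreover have "\<epsilon> < spread M (Q j) (?T (f j))" unfolding f_def by (rule R(2)[OF Q])
    moreover have "spread M (Q (Suc j)) (?T (f j)) \<le> \<epsilon> / 16" unfolding f_def QS by (rule N(3)[OF Q])
    ultimately show ?thesis by linarith
  qed
  \<comment> \<open>Summing over the stages telescopes the energies. Four contributions of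
    \<epsilon>/8 per stage give only half of the assumed spread.\<close>
  have "real n * \<epsilon> = (\<Sum>j<n. \<epsilon>)" by simp
  also have "\<dots> \<le> (\<Sum>j<n. 2 * ?S j + \<epsilon> / 8 + 2 * L * (real (k + 1) * \<alpha> + (?E (Q (Suc j)) - ?E (Q j)) / \<alpha>))"
    by (intro sum_mono step)
  also have "\<dots> = 2 * (\<Sum>j<n. ?S j) + real n * (\<epsilon> / 8) + 2 * L * (real n * (real (k + 1) * \<alpha>) + (\<Sum>j<n. ?E (Q (Suc j)) - ?E (Q j)) / \<alpha>)"
    by (simp add: sum.distrib flip: sum_distrib_left sum_divide_distrib)
  also have "(\<Sum>j<n. ?E (Q (Suc j)) - ?E (Q j)) = ?E (Q n) - ?E (Q 0)"
    by (rule sum_lessThan_telescope)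
  also have "2 * (\<Sum>j<n. ?S j) + real n * (\<epsilon> / 8) + 2 * L * (real n * (real (k + 1) * \<alpha>) + (?E (Q n) - ?E (Q 0)) / \<alpha>)
     \<le> 2 * (real n * (\<epsilon> / 16)) + real n * (\<epsilon> / 8) + 2 * (real n * (\<epsilon> / 16)) + 2 * (real n * (\<epsilon> / 16))"
  proof -
    have "L * ((?E (Q n) - ?E (Q 0)) / \<alpha>) \<le> L * (1 / \<alpha>)"
      using partition_energy_bounds[OF Q, of k B] B(1,2) L \<alpha>(1)
      by (intro mult_left_mono divide_right_mono) (auto, smt (verit))
    then have 1: "L * ((?E (Q n) - ?E (Q 0)) / \<alpha>) \<le> real n * (\<epsilon> / 16)"
      using n1 by (simp only: mult_1_right times_divide_eq_right order_trans)
    have "L * real (k + 1) * \<alpha> \<le> L * (real K + 1) * \<alpha>"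
      using k(1) L \<alpha>(1) by (intro mult_right_mono mult_left_mono) auto
    then have "real n * (L * real (k + 1) * \<alpha>) \<le> real n * (\<epsilon> / 16)"
      unfolding \<alpha>(2) by (intro mult_left_mono) auto
    then have 2: "L * (real n * (real (k + 1) * \<alpha>)) \<le> real n * (\<epsilon> / 16)" by (simp add: ac_simps)
    have "2 * L * (real n * (real (k + 1) * \<alpha>) + (?E (Q n) - ?E (Q 0)) / \<alpha>) =
        2 * (L * (real n * (real (k + 1) * \<alpha>))) + 2 * (L * ((?E (Q n) - ?E (Q 0)) / \<alpha>))"
      by (simp only: distrib_left mult.assoc)
    then show ?thesis using 1 2 S by linarith
  qed
  finally have "real n * \<epsilon> \<le> real n * (\<epsilon> / 2)" by simp
  then show False using n \<epsilon> by simp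
qed

end

section \<open>Regular versions of admissible semimetrics\<close>

lemma semimetric_retract:
  assumes "semimetric_on X \<rho>" "\<And>x. x \<in> S \<Longrightarrow> \<pi> x \<in> X"
  shows "semimetric_on S (\<lambda>z. \<rho> (\<pi> (fst z), \<pi> (snd z)))"
  using assms unfolding semimetric_on_def by simp

lemma semimetric_on_subset: "semimetric_on X \<rho> \<Longrightarrow> Y \<subseteq> X \<Longrightarrow> semimetric_on Y \<rho>"
  unfolding semimetric_on_def by blast

text \<open>A dense set of \<open>X\<close> may miss \<open>Y\<close>. So every pair of a dense
  point and a radius 1 / (n + 1) is replaced by a point of \<open>Y\<close> within that radius,
  wherever one exists.\<close>

lemma separable_on_subset:
  assumes sm: "semimetric_on X \<rho>" and sep: "separable_on X \<rho>" and Y: "Y \<subseteq> X"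
  shows "separable_on Y \<rho>"
proof -
  obtain D where D: "countable D" "D \<subseteq> X" "\<And>x e. x \<in> X \<Longrightarrow> 0 < e \<Longrightarrow> \<exists>d\<in>D. \<rho> (x, d) < e"
    using sep unfolding separable_on_def by blast
  define P where "P = {(d, n). d \<in> D \<and> (\<exists>y\<in>Y. \<rho> (y, d) < 1 / real (Suc n))}"
  define c where "c = (\<lambda>(d, n). SOME y. y \<in> Y \<and> \<rho> (y, d) < 1 / real (Suc n))"
  have c: "c (d, n) \<in> Y" "\<rho> (c (d, n), d) < 1 / real (Suc n)" if "(d, n) \<in> P" for d n
  proof -
    have "\<exists>y. y \<in> Y \<and> \<rho> (y, d) < 1 / real (Suc n)" using that by (auto simp: P_def)
    from someI_ex[OF this] show "c (d, n) \<in> Y" "\<rho> (c (d, n), d) < 1 / real (Suc n)"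
      by (simp_all add: c_def)
  qed
  have "countable P"
    by (rule countable_subset[of _ "D \<times> (UNIV :: nat set)"]) (auto simp: P_def D)
  moreover have "c ` P \<subseteq> Y" using c by auto
  moreover have "\<exists>d\<in>c ` P. \<rho> (x, d) < e" if x: "x \<in> Y" and e: "0 < e" for x and e :: real
  proof -
    obtain n where n: "1 / real (Suc n) < e / 2" using nat_approx_posE[of "e / 2"] e by auto
    obtain d where d: "d \<in> D" "\<rho> (x, d) < 1 / real (Suc n)" using D(3)[of x "1 / real (Suc n)"] x Y by auto
    then have P: "(d, n) \<in> P" using x by (auto simp: P_def)
    have "\<rho> (x, c (d, n)) \<le> \<rho> (x, d) + \<rho> (d, c (d, n))" "\<rho> (d, c (d, n)) = \<rho> (c (d, n), d)"
      using sm x d(1) D(2) Y c(1)[OF P] unfolding semimetric_on_def by blast+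
    then have "\<rho> (x, c (d, n)) < e" using c(2)[OF P] d(2) n by simp
    then show ?thesis using P by blast
  qed
  ultimately show ?thesis unfolding separable_on_def
    by (intro exI[of _ "c ` P"] conjI ballI allI impI) auto
qed

text \<open>By completeness, a set that agrees almost everywhere with a measurable one is
  measurable; this applies to the sublevel sets.\<close>

lemma (in complete_measure) borel_measurable_AE_eq:
  fixes g g' :: "'a \<Rightarrow> real"
  assumes g': "g' \<in> borel_measurable M" and ae: "AE x in M. g x = g' x"
  shows "g \<in> borel_measurable M"
  unfolding borel_measurable_iff_less
proof
  fix a
  have A: "{x \<in> space M. g' x < a} \<in> sets M"
    by (rule borel_measurable_iff_less[THEN iffD1, OF g', rule_format])
  have "AE x in M. x \<in> {x \<in> space M. g' x < a} \<longleftrightarrow> x \<in> {x \<in> space M. g x < a}"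
    using ae by eventually_elim auto
  then show "{x \<in> space M. g x < a} \<in> sets M" by (rule in_sets_AE[OF _ A]) (rule Collect_subset)
qed

section \<open>Sections and integrals on the completed square\<close>

lemma space_sq: "space (sq \<mu>) = space \<mu> \<times> space \<mu>"
  by (simp add: sq_def space_pair_measure)

context prob_space
begin

lemma AE_sq_iff: "(AE z in sq M. P z) \<longleftrightarrow> (AE z in M \<Otimes>\<^sub>M M. P z)"
  unfolding sq_def by (rule AE_completion_iff)

text \<open>The completion has the same almost-everywhere statements as the product, so Fubini for
  null sets applies.\<close>

lemma AE_sq_sections:
  assumes "AE z in sq M. P z" shows "AE x in M. AE y in M. P (x, y)"
proof -
  interpret pair_sigma_finite M M ..
  show ?thesis using AE_pair[of P] assms by (simp add: AE_sq_iff)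
qed

lemma AE_sq_Times:
  assumes X: "X \<in> sets M" "space M - X \<in> null_sets M"
  shows "AE z in sq M. z \<in> X \<times> X"
proof -
  interpret pair_sigma_finite M M ..
  have ae: "AE x in M. x \<in> X"
    using AE_not_in[OF X(2)] AE_space by eventually_elim auto
  have "AE z in M \<Otimes>\<^sub>M M. z \<in> X \<times> X"
  proof (rule AE_pair_measure)
    show "{z \<in> space (M \<Otimes>\<^sub>M M). z \<in> X \<times> X} \<in> sets (M \<Otimes>\<^sub>M M)"
      using X(1) by measurable
    show "AE x in M. AE y in M. (x, y) \<in> X \<times> X"
      using ae by eventually_elim (use ae in auto)
  qed
  then show ?thesis by (simp only: AE_sq_iff)
qed

text \<open>A function measurable for the completion agrees almost everywhere with a
  product-measurable one. For almost every \<open>x\<close> the two sections differ on a null set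
  only, and completeness of the base makes the given section measurable.\<close>

lemma AE_measurable_section:
  fixes f :: "'a \<times> 'a \<Rightarrow> real"
  assumes "complete_measure M" "f \<in> borel_measurable (sq M)"
  shows "AE x in M. (\<lambda>y. f (x, y)) \<in> borel_measurable M"
proof -
  obtain f' where f': "f' \<in> borel_measurable (M \<Otimes>\<^sub>M M)" "AE z in M \<Otimes>\<^sub>M M. f z = f' z"
    using completion_ex_borel_measurable_real assms(2) unfolding sq_def by blast
  have "AE x in M. AE y in M. f (x, y) = f' (x, y)"
    using f'(2) by (intro AE_sq_sections) (simp add: AE_sq_iff)
  with AE_space show ?thesis
  proof eventually_elim
    case (elim x)
    have "(\<lambda>y. f' (x, y)) \<in> borel_measurable M" using f'(1) elim(1) by measurable
    then show ?case
      using elim(2) by (rule complete_measure.borel_measurable_AE_eq[OF assms(1)])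
  qed
qed

text \<open>Tonelli for the completion, through a product-measurable representative: for almost
  every \<open>x\<close> the section integrals of the two functions agree.\<close>

lemma nn_integral_sq:
  assumes "f \<in> borel_measurable (sq M)"
  shows "(\<integral>\<^sup>+ z. f z \<partial>sq M) = (\<integral>\<^sup>+ x. \<integral>\<^sup>+ y. f (x, y) \<partial>M \<partial>M)"
proof -
  obtain f' where f': "f' \<in> borel_measurable (M \<Otimes>\<^sub>M M)" "AE z in M \<Otimes>\<^sub>M M. f z = f' z"
    using completion_ex_borel_measurable assms unfolding sq_def by blast
  have "AE x in M. AE y in M. f (x, y) = f' (x, y)"
    using f'(2) by (intro AE_sq_sections) (simp add: AE_sq_iff)
  then have "AE x in M. (\<integral>\<^sup>+ y. f (x, y) \<partial>M) = (\<integral>\<^sup>+ y. f' (x, y) \<partial>M)"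
    by eventually_elim (rule nn_integral_cong_AE)
  then have "(\<integral>\<^sup>+ x. \<integral>\<^sup>+ y. f (x, y) \<partial>M \<partial>M) = (\<integral>\<^sup>+ x. \<integral>\<^sup>+ y. f' (x, y) \<partial>M \<partial>M)"
    by (rule nn_integral_cong_AE)
  also have "\<dots> = (\<integral>\<^sup>+ z. f' z \<partial>(M \<Otimes>\<^sub>M M))"
    using f'(1) by (rule nn_integral_fst)
  also have "\<dots> = (\<integral>\<^sup>+ z. f z \<partial>(M \<Otimes>\<^sub>M M))"
    using f'(2) by (intro nn_integral_cong_AE) (auto elim: eventually_mono)
  finally show ?thesis by (simp add: sq_def nn_integral_completion)
qed

text \<open>
  The full-measure set is shrunk until all sections are measurable and everything outside is retracted
  to one point of it. Joint measurability then comes from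
  \<open>\<rho> (x, y) = (INF d\<in>D. \<rho> (x, d) + \<rho> (d, y))\<close> with \<open>D\<close> countable and dense.
\<close>

lemma admissible_regular_version:
  assumes compl: "complete_measure M" and adm: "admissible M \<rho>"
  shows "\<exists>\<rho>'. regular_version M \<rho> \<rho>'"
proof -
  have sm: "semimetric_on (space M) \<rho>" and m: "\<rho> \<in> borel_measurable (sq M)"
    and "\<exists>X1\<in>sets M. space M - X1 \<in> null_sets M \<and> separable_on X1 \<rho>"
    using adm by (simp_all only: admissible_def)
  then obtain X1 where X1: "X1 \<in> sets M" "space M - X1 \<in> null_sets M" "separable_on X1 \<rho>"
    by blast
  obtain N where N: "\<And>x. x \<in> space M - N \<Longrightarrow> (\<lambda>y. \<rho> (x, y)) \<in> borel_measurable M" "N \<in> null_sets M"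
    by (rule AE_E3[OF AE_measurable_section[OF compl m]]) (rule that)
  define X where "X = X1 - N"
  have X: "X \<in> sets M" unfolding X_def using X1(1) N(2) by auto
  have Xs: "X \<subseteq> X1" "X \<subseteq> space M" "X1 \<subseteq> space M"
    using sets.sets_into_space[OF X] sets.sets_into_space[OF X1(1)] by (auto simp: X_def)
  have sec: "(\<lambda>y. \<rho> (x, y)) \<in> borel_measurable M" if "x \<in> X" for x
    by (rule N(1)) (use that Xs in \<open>auto simp: X_def\<close>)
  have "space M - X \<subseteq> (space M - X1) \<union> N" by (auto simp: X_def)
  then have X0: "space M - X \<in> null_sets M"
    by (rule null_sets_subset[rotated 2]) (use X1(2) N(2) X in auto)
  have "X \<noteq> {}"
  proof
    assume "X = {}"
    then have "emeasure M (space M) = 0" using X0 by (simp add: null_sets_def)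
    then show False by (simp add: emeasure_space_1)
  qed
  then obtain x0 where x0: "x0 \<in> X" by blast
  define \<pi> where "\<pi> x = (if x \<in> X then x else x0)" for x
  have \<pi>: "\<pi> x \<in> X" for x using x0 by (simp add: \<pi>_def)
  have \<pi>m: "\<pi> \<in> measurable M M" unfolding \<pi>_def
    using X x0 Xs by (intro measurable_If_set measurable_const) auto
  define \<rho>' where "\<rho>' = (\<lambda>z. \<rho> (\<pi> (fst z), \<pi> (snd z)))"
  have smX: "semimetric_on X \<rho>" by (rule semimetric_on_subset[OF sm Xs(2)])
  have smX1: "semimetric_on X1 \<rho>" by (rule semimetric_on_subset[OF sm Xs(3)])
  have sm': "semimetric_on (space M) \<rho>'"
    unfolding \<rho>'_def by (rule semimetric_retract[OF smX \<pi>])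
  obtain D where D: "countable D" "D \<subseteq> X" "\<And>x e. x \<in> X \<Longrightarrow> 0 < e \<Longrightarrow> \<exists>d\<in>D. \<rho> (x, d) < e"
    using separable_on_subset[OF smX1 X1(3) Xs(1)] unfolding separable_on_def by blast
  have "separable_on (space M) \<rho>'"
    unfolding separable_on_def
  proof (intro exI[of _ D] conjI ballI allI impI)
    show "D \<subseteq> space M" using D(2) Xs by auto
    show "\<exists>d\<in>D. \<rho>' (x, d) < e" if "0 < e" for x and e :: real
      using D(3)[OF \<pi>[of x] that] D(2) by (auto simp: \<rho>'_def \<pi>_def)
  qed (rule D)
  moreover have "\<rho>' \<in> borel_measurable (M \<Otimes>\<^sub>M M)"
    unfolding borel_measurable_iff_less
  proof
    fix a
    have eq: "{z \<in> space (M \<Otimes>\<^sub>M M). \<rho>' z < a} =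
        (\<Union>d\<in>D. {z \<in> space (M \<Otimes>\<^sub>M M). \<rho> (d, \<pi> (fst z)) + \<rho> (d, \<pi> (snd z)) < a})"
    proof (intro equalityI subsetI)
      fix z assume z: "z \<in> {z \<in> space (M \<Otimes>\<^sub>M M). \<rho>' z < a}"
      let ?x = "\<pi> (fst z)" and ?y = "\<pi> (snd z)"
      \<comment> \<open>The detour through \<open>d\<close> costs at most twice the distance from
        \<open>d\<close> to \<open>?x\<close>, so \<open>d\<close> is taken within half of the
        slack.\<close>
      have "0 < (a - \<rho> (?x, ?y)) / 2" using z by (simp add: \<rho>'_def)
      then obtain d where d: "d \<in> D" "\<rho> (?x, d) < (a - \<rho> (?x, ?y)) / 2" using D(3)[OF \<pi>] by blast
      then have dX: "d \<in> X" using D(2) by auto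
      have "\<rho> (d, ?y) \<le> \<rho> (d, ?x) + \<rho> (?x, ?y)" "\<rho> (d, ?x) = \<rho> (?x, d)"
        using smX dX \<pi>[of "fst z"] \<pi>[of "snd z"] unfolding semimetric_on_def by blast+
      then have "\<rho> (d, ?x) + \<rho> (d, ?y) < a" using d(2) by simp
      then show "z \<in> (\<Union>d\<in>D. {z \<in> space (M \<Otimes>\<^sub>M M). \<rho> (d, \<pi> (fst z)) + \<rho> (d, \<pi> (snd z)) < a})"
        using z d(1) by auto
    next
      fix z assume "z \<in> (\<Union>d\<in>D. {z \<in> space (M \<Otimes>\<^sub>M M). \<rho> (d, \<pi> (fst z)) + \<rho> (d, \<pi> (snd z)) < a})"
      then obtain d where d: "d \<in> D" "z \<in> space (M \<Otimes>\<^sub>M M)" "\<rho> (d, \<pi> (fst z)) + \<rho> (d, \<pi> (snd z)) < a" by auto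
      then have dX: "d \<in> X" using D(2) by auto
      have "\<rho> (\<pi> (fst z), \<pi> (snd z)) \<le> \<rho> (\<pi> (fst z), d) + \<rho> (d, \<pi> (snd z))" "\<rho> (\<pi> (fst z), d) = \<rho> (d, \<pi> (fst z))"
        using smX dX \<pi>[of "fst z"] \<pi>[of "snd z"] unfolding semimetric_on_def by blast+
      then show "z \<in> {z \<in> space (M \<Otimes>\<^sub>M M). \<rho>' z < a}" using d by (simp add: \<rho>'_def)
    qed
    show "{z \<in> space (M \<Otimes>\<^sub>M M). \<rho>' z < a} \<in> sets (M \<Otimes>\<^sub>M M)"
      unfolding eq
    proof (rule sets.countable_UN''[OF D(1)])
      fix d assume "d \<in> D"
      then have sd: "(\<lambda>y. \<rho> (d, y)) \<in> borel_measurable M" by (intro sec subsetD[OF D(2)])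
      have [measurable]: "(\<lambda>x. \<rho> (d, \<pi> x)) \<in> borel_measurable M" by (rule measurable_compose[OF \<pi>m sd])
      show "{z \<in> space (M \<Otimes>\<^sub>M M). \<rho> (d, \<pi> (fst z)) + \<rho> (d, \<pi> (snd z)) < a} \<in> sets (M \<Otimes>\<^sub>M M)"
        by measurable
    qed
  qed
  moreover have "\<forall>x\<in>X. \<forall>y\<in>X. \<rho>' (x, y) = \<rho> (x, y)" by (simp add: \<rho>'_def \<pi>_def)
  ultimately show ?thesis
    unfolding regular_version_def regular_semimetric_def using sm' X X0
    by (intro exI[of _ \<rho>'] conjI bexI[of _ X])
qed

lemma regular_version_AE:
  assumes "regular_version M \<rho> \<rho>'" shows "AE z in sq M. \<rho> z = \<rho>' z"
proof -
  obtain X where X: "X \<in> sets M" "space M - X \<in> null_sets M" "\<forall>x\<in>X. \<forall>y\<in>X. \<rho>' (x, y) = \<rho> (x, y)"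
    using assms unfolding regular_version_def by blast
  from AE_sq_Times[OF X(1,2)] show ?thesis by eventually_elim (use X(3) in auto)
qed

section \<open>Reference points and quantization on blocks\<close>

text \<open>A double integral of the tail below \<open>t\<close> leaves at least one section whose
  tail is below \<open>t\<close>. Comparing with such a reference point gives bounds that are
  uniform over a uniformly integrable family.\<close>

lemma exists_hub:
  assumes rv: "regular_version M \<rho> \<rho>'" and L: "0 \<le> L"
    and tail: "(\<integral>\<^sup>+ z. ennreal \<bar>\<rho> z\<bar> * indicator {z. \<bar>\<rho> z\<bar> > L} z \<partial>sq M) < ennreal t"
  shows "\<exists>p\<in>space M. integrable M (\<lambda>y. \<rho>' (p, y)) \<and> (\<integral>y. \<rho>' (p, y) \<partial>M) \<le> L + t \<and>
    (\<integral>y. \<rho>' (p, y) * indicator {y. \<rho>' (p, y) > L} y \<partial>M) \<le> t"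
proof -
  have sm: "semimetric_on (space M) \<rho>'" and m [measurable]: "\<rho>' \<in> borel_measurable (M \<Otimes>\<^sub>M M)"
    using rv by (auto simp: regular_version_def regular_semimetric_def)
  have nn: "0 \<le> \<rho>' (x, y)" if "x \<in> space M" "y \<in> space M" for x y
    using sm that by (auto simp: semimetric_on_def)
  have t: "0 < t" using tail by (cases "0 < t") (auto simp: ennreal_neg)
  let ?g = "\<lambda>z. ennreal (\<rho>' z) * indicator {z. \<rho>' z > L} z"
  have gm: "?g \<in> borel_measurable (sq M)"
    unfolding sq_def by (rule measurable_completion) measurable
  have "(\<integral>\<^sup>+ z. ennreal \<bar>\<rho> z\<bar> * indicator {z. \<bar>\<rho> z\<bar> > L} z \<partial>sq M) = (\<integral>\<^sup>+ z. ?g z \<partial>sq M)"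
  proof (rule nn_integral_cong_AE)
    show "AE z in sq M. ennreal \<bar>\<rho> z\<bar> * indicator {z. \<bar>\<rho> z\<bar> > L} z = ?g z"
      using regular_version_AE[OF rv] AE_space
    proof eventually_elim
      case (elim z)
      then have "0 \<le> \<rho>' z" using nn by (cases z) (auto simp: space_sq)
      then show ?case using elim by (simp add: indicator_def)
    qed
  qed
  then have *: "(\<integral>\<^sup>+ x. \<integral>\<^sup>+ y. ?g (x, y) \<partial>M \<partial>M) < ennreal t"
    using tail by (simp only: nn_integral_sq[OF gm])
  have "\<exists>p\<in>space M. (\<integral>\<^sup>+ y. ?g (p, y) \<partial>M) < ennreal t"
  proof (rule ccontr)
    assume "\<not> ?thesis"
    then have "(\<integral>\<^sup>+ x. ennreal t \<partial>M) \<le> (\<integral>\<^sup>+ x. \<integral>\<^sup>+ y. ?g (x, y) \<partial>M \<partial>M)"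
      by (intro nn_integral_mono) (simp add: not_less)
    then show False using * by (simp add: emeasure_space_1)
  qed
  then obtain p where p: "p \<in> space M" "(\<integral>\<^sup>+ y. ?g (p, y) \<partial>M) < ennreal t" by blast
  have pm [measurable]: "(\<lambda>y. \<rho>' (p, y)) \<in> borel_measurable M" using p(1) by measurable
  let ?u = "\<lambda>y. \<rho>' (p, y) * indicator {y. \<rho>' (p, y) > L} y"
  have um: "?u \<in> borel_measurable M" by measurable
  have u0: "AE y in M. 0 \<le> ?u y" using nn[OF p(1)] by (intro AE_I2) auto
  have ueq: "(\<integral>\<^sup>+ y. ennreal (?u y) \<partial>M) = (\<integral>\<^sup>+ y. ?g (p, y) \<partial>M)"
    by (intro nn_integral_cong) (auto simp: indicator_def)
  have ui: "integrable M ?u"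
    using um u0 p(2) by (intro integrableI_nonneg) (auto simp: ueq intro: less_trans)
  have ut: "(\<integral>y. ?u y \<partial>M) \<le> t"
    using p(2) t unfolding ueq[symmetric] nn_integral_eq_integral[OF ui u0]
    by (simp add: ennreal_less_iff[OF integral_nonneg_AE[OF u0]])
  have le: "\<rho>' (p, y) \<le> L + ?u y" for y using L by (auto simp: indicator_def)
  have i: "integrable M (\<lambda>y. \<rho>' (p, y))"
  proof (rule Bochner_Integration.integrable_bound[where f = "\<lambda>y. L + ?u y"])
    show "AE y in M. norm (\<rho>' (p, y)) \<le> norm (L + ?u y)"
      using le nn[OF p(1)] by (intro AE_I2) (smt (verit) real_norm_def)
  qed (use ui in auto)
  have "(\<integral>y. \<rho>' (p, y) \<partial>M) \<le> (\<integral>y. L + ?u y \<partial>M)" by (intro integral_mono i le) (use ui in auto)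
  also have "\<dots> \<le> L + t" using ui ut by (simp add: prob_space)
  finally show ?thesis using p(1) i ut by blast
qed

text \<open>If \<open>w\<close> exceeded its mean everywhere on \<open>B\<close>, a function
  strictly positive on \<open>B\<close> and zero elsewhere would have integral 0, making
  \<open>B\<close> null.\<close>

lemma exists_below_average:
  assumes w: "integrable M w" and B: "B \<in> sets M" "0 < measure M B"
  shows "\<exists>z\<in>B. measure M B * w z \<le> (\<integral>x. indicator B x * w x \<partial>M)"
proof (rule ccontr)
  assume neg: "\<not> ?thesis"
  define c where "c = (\<integral>x. indicator B x * w x \<partial>M) / measure M B"
  have c: "c < w z" if "z \<in> B" for z
    using neg B(2) that by (auto simp: c_def divide_less_eq mult.commute)
  have i: "integrable M (\<lambda>x. indicator B x * w x)"
    using integrable_real_mult_indicator[OF B(1) w] by (simp add: mult.commute)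
  have ib: "integrable M (\<lambda>x. c * indicator B x)" using B(1) by (intro integrable_mult_right integrable_indicator_prob)
  let ?f = "\<lambda>x. indicator B x * w x - c * indicator B x"
  have "(\<integral>x. ?f x \<partial>M) = 0"
    using i ib B by (simp add: c_def)
  moreover have "AE x in M. 0 \<le> ?f x" using c by (intro AE_I2) (auto simp: indicator_def less_imp_le)
  ultimately have "AE x in M. ?f x = 0"
    using integral_nonneg_eq_0_iff_AE[of M ?f] i ib by auto
  then have "AE x in M. x \<notin> B" by eventually_elim (use c in \<open>auto simp: indicator_def\<close>)
  then have "measure M B = 0" using B(1) by (simp add: AE_iff_measurable[OF B(1)] prob_eq_0)
  then show False using B(2) by simp
qed

text \<open>Each centre is a point of its block whose mean distance to the block, with tail terms
  added, is at most the block average; so the distance to the centres integrates to about the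
  spread. The last bound confines the centres of blocks of positive mass to a ball around
  \<open>p\<close> whose radius is fixed by \<epsilon>, \<open>t\<close>, \<open>L\<close> and that
  mass.\<close>

lemma quantize:
  assumes reg: "regular_semimetric M \<rho>" and q: "labelling M q" and L: "0 < L"
    and sp: "spread M q (\<lambda>z. min (\<rho> z) (2 * L)) \<le> \<epsilon>"
    and p: "p \<in> space M" "integrable M (\<lambda>y. \<rho> (p, y))" "(\<integral>y. \<rho> (p, y) \<partial>M) \<le> L + t"
      "(\<integral>y. \<rho> (p, y) * indicator {y. \<rho> (p, y) > L} y \<partial>M) \<le> t"
  shows "\<exists>c. (\<forall>i. c i \<in> space M) \<and> integrable M (\<lambda>x. \<rho> (x, c (q x))) \<and>
     (\<integral>x. \<rho> (x, c (q x)) \<partial>M) \<le> \<epsilon> + 4 * t \<and>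
     (\<forall>i. measure M (block M q i) * \<rho> (c i, p) \<le> \<epsilon> + 5 * t + L)"
proof -
  have sm: "semimetric_on (space M) \<rho>" and m [measurable]: "\<rho> \<in> borel_measurable (M \<Otimes>\<^sub>M M)"
    using reg by (auto simp: regular_semimetric_def)
  have nn: "0 \<le> \<rho> (x, y)" and sym: "\<rho> (x, y) = \<rho> (y, x)" if "x \<in> space M" "y \<in> space M" for x y
    using sm that by (auto simp: semimetric_on_def)
  have tri: "\<rho> (x, z) \<le> \<rho> (x, y) + \<rho> (y, z)" if "x \<in> space M" "y \<in> space M" "z \<in> space M" for x y z
    using sm that by (auto simp: semimetric_on_def)
  let ?\<tau> = "\<lambda>z. min (\<rho> z) (2 * L)"
  have smT: "semimetric_on (space M) ?\<tau>" using semimetric_min[OF sm] L by simp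
  have mT [measurable]: "?\<tau> \<in> borel_measurable (M \<Otimes>\<^sub>M M)" by measurable
  note it = integrable_section_bounded[where L = "2 * L", OF mT smT]
  define u where "u y = 2 * (\<rho> (p, y) * indicator {y. \<rho> (p, y) > L} y)" for y
  have u0: "0 \<le> u y" if "y \<in> space M" for y using nn[OF p(1) that] by (simp add: u_def)
  have pm [measurable]: "(\<lambda>y. \<rho> (p, y)) \<in> borel_measurable M" using p(2) by auto
  have iu: "integrable M u"
  proof (rule Bochner_Integration.integrable_bound[OF integrable_mult_right[OF p(2), of 2]])
    show "AE y in M. norm (u y) \<le> norm (2 * \<rho> (p, y))" by (intro AE_I2) (auto simp: u_def indicator_def)
  qed (unfold u_def, measurable)
  have uint: "(\<integral>y. u y \<partial>M) \<le> 2 * t" using p(4) by (simp add: u_def)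
  \<comment> \<open>If \<open>\<rho> (x, y)\<close> exceeds \<open>2 * L\<close>, the larger of the
    distances to \<open>p\<close> exceeds \<open>L\<close>, and twice that distance is a value of
    \<open>u\<close> and bounds \<open>\<rho> (x, y)\<close>. Hence the truncation at
    \<open>2 * L\<close> and the factor 2 in \<open>u\<close>.\<close>
  have dom: "\<rho> (x, y) \<le> ?\<tau> (x, y) + u x + u y" if x: "x \<in> space M" and y: "y \<in> space M" for x y
  proof (cases "\<rho> (x, y) \<le> 2 * L")
    case True
    then show ?thesis using u0[OF x] u0[OF y] by simp
  next
    case False
    have "\<rho> (x, y) \<le> \<rho> (p, x) + \<rho> (p, y)" using tri[OF x p(1) y] sym[OF x p(1)] by simp
    then show ?thesis using False nn[OF p(1) x] nn[OF p(1) y] L by (auto simp: u_def indicator_def)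
  qed
  let ?D = "\<lambda>x. block_avg M q (\<lambda>y. ?\<tau> (x, y)) x"
  have iD: "integrable M ?D" by (rule integrable_block_avg_section[where L = "2 * L", OF q mT smT]) (use L in auto)
  \<comment> \<open>On blocks of positive mass this is the block average of the bound
    \<open>dom\<close> over its second point. Its integral is the spread plus twice the integral of
    \<open>u\<close>.\<close>
  define w where "w x = ?D x + (u x + block_avg M q u x)" for x
  have iw: "integrable M w" unfolding w_def using iD iu integrable_block_avg[OF q] by auto
  have wint: "(\<integral>x. w x \<partial>M) \<le> \<epsilon> + 4 * t"
    unfolding w_def using iD iu integrable_block_avg[OF q, of u] uint sp
    by (simp add: integral_block_avg[OF q] spread_def)
  \<comment> \<open>For a null block any point of the space serves as centre.\<close>
  have "\<forall>i. \<exists>z. z \<in> space M \<and> (0 < measure M (block M q i) \<longrightarrow> z \<in> block M q i \<and>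
      measure M (block M q i) * w z \<le> (\<integral>x. indicator (block M q i) x * w x \<partial>M))"
  proof
    fix i
    show "\<exists>z. z \<in> space M \<and> (0 < measure M (block M q i) \<longrightarrow> z \<in> block M q i \<and>
      measure M (block M q i) * w z \<le> (\<integral>x. indicator (block M q i) x * w x \<partial>M))"
    proof (cases "0 < measure M (block M q i)")
      case True
      from exists_below_average[OF iw block_sets[OF q] True]
      show ?thesis by (auto simp: block_def)
    next
      case False
      then show ?thesis using p(1) by blast
    qed
  qed
  then obtain c where c: "\<And>i. c i \<in> space M"
      "\<And>i. 0 < measure M (block M q i) \<Longrightarrow> c i \<in> block M q i"
      "\<And>i. 0 < measure M (block M q i) \<Longrightarrow>
        measure M (block M q i) * w (c i) \<le> (\<integral>x. indicator (block M q i) x * w x \<partial>M)"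
    by metis
  have cm [measurable]: "(\<lambda>x. c (q x)) \<in> measurable M M"
    by (rule measurable_compose[OF labelling_measurable[OF q]]) (use c(1) in simp)
  have hm: "(\<lambda>x. \<rho> (x, c (q x))) \<in> borel_measurable M" by measurable
  let ?g = "\<lambda>x. ?\<tau> (x, c (q x)) + (u (c (q x)) + u x)"
  have ig1: "integrable M (\<lambda>x. ?\<tau> (x, c (q x)))"
  proof (rule integrable_const_bound[where B = "2 * L"])
    show "AE x in M. norm (?\<tau> (x, c (q x))) \<le> 2 * L"
      using nn c(1) L by (intro AE_I2) (auto simp: min_def)
  qed measurable
  have ig: "integrable M ?g"
    using ig1 iu integrable_labelling[OF q, of "\<lambda>i. u (c i)"] by auto
  have hg: "\<rho> (x, c (q x)) \<le> ?g x" if "x \<in> space M" for x using dom[OF that c(1)[of "q x"]] by simp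
  have ih: "integrable M (\<lambda>x. \<rho> (x, c (q x)))"
  proof (rule Bochner_Integration.integrable_bound[OF ig hm])
    show "AE x in M. norm (\<rho> (x, c (q x))) \<le> norm (?g x)"
      using hg nn c(1) by (intro AE_I2) (smt (verit) real_norm_def)
  qed
  have "(\<integral>x. \<rho> (x, c (q x)) \<partial>M) \<le> (\<integral>x. ?g x \<partial>M)" by (rule integral_mono[OF ih ig hg])
  also have "\<dots> = (\<Sum>i\<in>q ` space M. (\<integral>x. indicator (block M q i) x * ?g x \<partial>M))"
    using integral_labelling_mult[OF q ig, of "\<lambda>_. 1"] by simp
  also have "\<dots> \<le> (\<Sum>i\<in>q ` space M. (\<integral>x. indicator (block M q i) x * w x \<partial>M))"
  proof (rule sum_mono)
    fix i
    let ?b = "indicator (block M q i) :: 'a \<Rightarrow> real"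
    show "(\<integral>x. ?b x * ?g x \<partial>M) \<le> (\<integral>x. ?b x * w x \<partial>M)"
    proof (cases "0 < measure M (block M q i)")
      case True
      have qc: "q (c i) = i" using c(2)[OF True] by (simp add: block_def)
      have ii: "integrable M (\<lambda>x. ?b x * ?\<tau> (c i, x))" "integrable M (\<lambda>x. ?b x * u x)" "integrable M (\<lambda>x. ?b x * u (c i))"
        using integrable_block_mult[OF q it[OF _ c(1)]] integrable_block_mult[OF q iu] integrable_block_mult[OF q, of "\<lambda>_. u (c i)"] by auto
      \<comment> \<open>By symmetry, integrating the bound over the block gives the mass times
        \<open>w (c i)\<close>, which the choice of \<open>c i\<close> controls.\<close>
      have "(\<integral>x. ?b x * ?g x \<partial>M) = (\<integral>x. ?b x * ?\<tau> (c i, x) + (?b x * u (c i) + ?b x * u x) \<partial>M)"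
        using sym c(1) by (intro Bochner_Integration.integral_cong) (auto simp: indicator_def block_def)
      also have "\<dots> = (\<integral>x. ?b x * ?\<tau> (c i, x) \<partial>M) + (measure M (block M q i) * u (c i) + (\<integral>x. ?b x * u x \<partial>M))"
        using ii block_sets[OF q] by simp
      also have "\<dots> = measure M (block M q i) * w (c i)"
        using True unfolding w_def block_avg_def qc by (simp add: field_simps)
      also have "\<dots> \<le> (\<integral>x. ?b x * w x \<partial>M)" by (rule c(3)[OF True])
      finally show ?thesis .
    next
      case False
      then have "block M q i \<in> null_sets M"
        using block_sets[OF q] by (auto simp: null_sets_def emeasure_eq_measure zero_less_measure_iff)
      then have ae: "AE x in M. x \<notin> block M q i" by (rule AE_not_in)
      have "(\<integral>x. ?b x * f x \<partial>M) = 0" for f :: "'a \<Rightarrow> real"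
        using ae by (intro integral_eq_zero_AE) (auto elim: eventually_mono)
      then show ?thesis by simp
    qed
  qed
  also have "\<dots> = (\<integral>x. w x \<partial>M)"
    using integral_labelling_mult[OF q iw, of "\<lambda>_. 1"] by simp
  finally have h: "(\<integral>x. \<rho> (x, c (q x)) \<partial>M) \<le> \<epsilon> + 4 * t" using wint by simp
  have "measure M (block M q i) * \<rho> (c i, p) \<le> \<epsilon> + 5 * t + L" for i
  proof -
    \<comment> \<open>The way from \<open>c i\<close> to \<open>p\<close> through a point of the
      block is averaged over the block.\<close>
    have "measure M (block M q i) * \<rho> (c i, p) = (\<integral>x. \<rho> (c i, p) * indicator (block M q i) x \<partial>M)"
      using block_sets[OF q] by simp
    also have "\<dots> \<le> (\<integral>x. \<rho> (x, c (q x)) + \<rho> (p, x) \<partial>M)"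
    proof (rule integral_mono)
      fix x assume x: "x \<in> space M"
      show "\<rho> (c i, p) * indicator (block M q i) x \<le> \<rho> (x, c (q x)) + \<rho> (p, x)"
        using tri[OF c(1)[of i] x p(1)] sym[OF c(1)[of i] x] sym[OF p(1) x] nn[OF p(1) x] nn[OF x c(1)[of "q x"]]
        by (auto simp: indicator_def block_def)
    qed (use ih p(2) block_sets[OF q] in \<open>auto intro!: integrable_indicator_prob\<close>)
    also have "\<dots> \<le> \<epsilon> + 5 * t + L" using ih p(2,3) h by simp
    finally show ?thesis .
  qed
  then show ?thesis using c(1) ih h by blast
qed

end

section \<open>Total boundedness\<close>

lemma m_norm_le:
  assumes "semimetric_on (space \<mu>) d" "integrable (sq \<mu>) d" "AE z in sq \<mu>. \<bar>f z\<bar> \<le> d z"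
  shows "m_norm \<mu> f \<le> (\<integral>\<^sup>+ z. ennreal \<bar>d z\<bar> \<partial>sq \<mu>)"
  unfolding m_norm_def by (rule INF_lower) (use assms in auto)

context prob_space
begin

text \<open>
  The dominating semimetric is \<open>H x + H y\<close>, set to zero between points identified by both
  semimetrics and the labelling. Using this equivalence instead of equality spares the measurability
  of the diagonal.
\<close>

lemma m_norm_diff_le:
  assumes sm1: "semimetric_on (space M) \<rho>1" and sm2: "semimetric_on (space M) \<rho>2"
    and m1: "\<rho>1 \<in> borel_measurable (M \<Otimes>\<^sub>M M)" and m2: "\<rho>2 \<in> borel_measurable (M \<Otimes>\<^sub>M M)"
    and q: "labelling M q" and c1: "\<And>i. c1 i \<in> space M" and c2: "\<And>i. c2 i \<in> space M"
    and h1: "integrable M (\<lambda>x. \<rho>1 (x, c1 (q x)))" "(\<integral>x. \<rho>1 (x, c1 (q x)) \<partial>M) \<le> s"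
    and h2: "integrable M (\<lambda>x. \<rho>2 (x, c2 (q x)))" "(\<integral>x. \<rho>2 (x, c2 (q x)) \<partial>M) \<le> s"
    and \<eta>: "0 \<le> \<eta>"
    and near: "\<And>i j. 0 < measure M (block M q i) \<Longrightarrow> 0 < measure M (block M q j) \<Longrightarrow>
      \<bar>\<rho>1 (c1 i, c1 j) - \<rho>2 (c2 i, c2 j)\<bar> \<le> \<eta>"
  shows "m_norm M (\<lambda>z. \<rho>1 z - \<rho>2 z) \<le> ennreal (4 * s + \<eta>)"
proof -
  have nn1: "0 \<le> \<rho>1 (x, y)" and sym1: "\<rho>1 (x, y) = \<rho>1 (y, x)" if "x \<in> space M" "y \<in> space M" for x y
    using sm1 that by (auto simp: semimetric_on_def)
  have tri1: "\<rho>1 (x, z) \<le> \<rho>1 (x, y) + \<rho>1 (y, z)" if "x \<in> space M" "y \<in> space M" "z \<in> space M" for x y z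
    using sm1 that by (auto simp: semimetric_on_def)
  have nn2: "0 \<le> \<rho>2 (x, y)" and sym2: "\<rho>2 (x, y) = \<rho>2 (y, x)" if "x \<in> space M" "y \<in> space M" for x y
    using sm2 that by (auto simp: semimetric_on_def)
  have tri2: "\<rho>2 (x, z) \<le> \<rho>2 (x, y) + \<rho>2 (y, z)" if "x \<in> space M" "y \<in> space M" "z \<in> space M" for x y z
    using sm2 that by (auto simp: semimetric_on_def)
  have refl: "\<rho>1 (x, x) = 0" "\<rho>2 (x, x) = 0" if "x \<in> space M" for x
    using sm1 sm2 that by (auto simp: semimetric_on_def)
  \<comment> \<open>Half of \<eta> at each end pays for the discrepancy between the two matrices of
    centre distances. Twice the integral of \<open>H\<close> is at most
    \<open>4 * s + \<eta>\<close>.\<close>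
  define H where "H x = \<rho>1 (x, c1 (q x)) + \<rho>2 (x, c2 (q x)) + \<eta> / 2" for x
  define E where "E z \<longleftrightarrow> \<rho>1 z = 0 \<and> \<rho>2 z = 0 \<and> q (fst z) = q (snd z)" for z
  define d where "d z = (if E z then 0 else H (fst z) + H (snd z))" for z
  have H0: "0 \<le> H x" if "x \<in> space M" for x
    using nn1[OF that c1] nn2[OF that c2] \<eta> by (simp add: H_def)
  have Eref: "E (x, x)" if "x \<in> space M" for x using refl[OF that] by (simp add: E_def)
  have Esym: "E (x, y) \<longleftrightarrow> E (y, x)" if "x \<in> space M" "y \<in> space M" for x y
    using sym1[OF that] sym2[OF that] by (auto simp: E_def)
  have Etrans: "E (x, z)" if "x \<in> space M" "y \<in> space M" "z \<in> space M" "E (x, y)" "E (y, z)" for x y z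
    using tri1[OF that(1-3)] tri2[OF that(1-3)] nn1[OF that(1,3)] nn2[OF that(1,3)] that(4,5)
    by (auto simp: E_def)
  \<comment> \<open>The triangle inequality for \<open>d\<close> needs this when one leg of the
    detour is zero: its endpoints then have equal \<open>H\<close>.\<close>
  have EH: "H x = H y" if xy: "x \<in> space M" "y \<in> space M" and e: "E (x, y)" for x y
  proof -
    have qq: "q x = q y" "\<rho>1 (x, y) = 0" "\<rho>2 (x, y) = 0" using e by (auto simp: E_def)
    have "\<rho>1 (x, c1 (q x)) = \<rho>1 (y, c1 (q y))"
      using tri1[OF xy c1[of "q y"]] tri1[OF xy(2) xy(1) c1[of "q y"]] sym1[OF xy] qq by simp
    moreover have "\<rho>2 (x, c2 (q x)) = \<rho>2 (y, c2 (q y))"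
      using tri2[OF xy c2[of "q y"]] tri2[OF xy(2) xy(1) c2[of "q y"]] sym2[OF xy] qq by simp
    ultimately show ?thesis by (simp add: H_def)
  qed
  have smd: "semimetric_on (space M) d"
    unfolding semimetric_on_def
  proof (intro conjI ballI)
    fix x y z assume x: "x \<in> space M" and y: "y \<in> space M" and z: "z \<in> space M"
    show "0 \<le> d (x, y)" using H0[OF x] H0[OF y] by (simp add: d_def)
    show "d (x, y) = d (y, x)" using Esym[OF x y] by (simp add: d_def)
    show "d (x, z) \<le> d (x, y) + d (y, z)"
      using H0[OF x] H0[OF y] H0[OF z] Etrans[OF x y z] EH[OF x y] EH[OF y z]
        Etrans[OF y x z] Etrans[OF x z y] Esym[OF x y] Esym[OF y z]
      by (auto simp: d_def)
  next
    fix x assume "x \<in> space M" then show "d (x, x) = 0" using Eref by (simp add: d_def)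
  qed
  have iH: "integrable M H"
    unfolding H_def[abs_def] by (intro Bochner_Integration.integrable_add h1(1) h2(1)) simp
  note [measurable] = m1 m2
  have Hm [measurable]: "H \<in> borel_measurable M" by (rule borel_measurable_integrable[OF iH])
  have dm: "d \<in> borel_measurable (M \<Otimes>\<^sub>M M)"
  proof -
    \<comment> \<open>For the real-valued copy of the label, equality of two labels is a measurable
      condition on the product.\<close>
    define Q where "Q x = real (q x)" for x
    have [measurable]: "Q \<in> borel_measurable M"
      unfolding Q_def[abs_def] by (rule borel_measurable_labelling[OF q])
    have "d = (\<lambda>z. if \<rho>1 z = 0 \<and> \<rho>2 z = 0 \<and> Q (fst z) = Q (snd z) then 0 else H (fst z) + H (snd z))"
      by (simp add: fun_eq_iff d_def E_def Q_def)
    also have "\<dots> \<in> borel_measurable (M \<Otimes>\<^sub>M M)" by measurable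
    finally show ?thesis .
  qed
  have dle: "d z \<le> H (fst z) + H (snd z)" "0 \<le> d z" if "z \<in> space M \<times> space M" for z
    using H0 that by (auto simp: d_def)
  have dH: "(\<integral>\<^sup>+ z. ennreal \<bar>d z\<bar> \<partial>sq M) \<le> ennreal (4 * s + \<eta>)"
  proof -
    have "(\<integral>\<^sup>+ z. ennreal \<bar>d z\<bar> \<partial>sq M) \<le> (\<integral>\<^sup>+ z. ennreal (H (fst z)) + ennreal (H (snd z)) \<partial>sq M)"
    proof (rule nn_integral_mono)
      fix z assume "z \<in> space (sq M)"
      then have z: "z \<in> space M \<times> space M" by (simp add: space_sq)
      then have "ennreal \<bar>d z\<bar> \<le> ennreal (H (fst z) + H (snd z))" using dle[OF z] by (intro ennreal_leI) auto
      also have "\<dots> = ennreal (H (fst z)) + ennreal (H (snd z))"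
        using H0 z by (intro ennreal_plus) auto
      finally show "ennreal \<bar>d z\<bar> \<le> ennreal (H (fst z)) + ennreal (H (snd z))" .
    qed
    also have "\<dots> = (\<integral>\<^sup>+ x. \<integral>\<^sup>+ y. ennreal (H x) + ennreal (H y) \<partial>M \<partial>M)"
      by (subst nn_integral_sq) (auto simp: sq_def intro!: measurable_completion)
    also have "\<dots> = (\<integral>\<^sup>+ x. ennreal (H x) \<partial>M) + (\<integral>\<^sup>+ x. ennreal (H x) \<partial>M)"
      by (simp add: nn_integral_add emeasure_space_1)
    also have "(\<integral>\<^sup>+ x. ennreal (H x) \<partial>M) = ennreal (\<integral>x. H x \<partial>M)"
      using iH H0 by (intro nn_integral_eq_integral AE_I2) auto
    also have "\<dots> + \<dots> = ennreal (2 * (\<integral>x. H x \<partial>M))"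
      using H0 by (subst ennreal_plus[symmetric]) (auto intro!: Bochner_Integration.integral_nonneg)
    also have "\<dots> \<le> ennreal (4 * s + \<eta>)"
    proof (rule ennreal_leI)
      have "(\<integral>x. H x \<partial>M) = (\<integral>x. \<rho>1 (x, c1 (q x)) \<partial>M) + (\<integral>x. \<rho>2 (x, c2 (q x)) \<partial>M) + \<eta> / 2"
        unfolding H_def using h1(1) h2(1) by (simp add: prob_space)
      then show "2 * (\<integral>x. H x \<partial>M) \<le> 4 * s + \<eta>" using h1(2) h2(2) by simp
    qed
    finally show ?thesis .
  qed
  have intd: "integrable (sq M) d"
  proof (rule integrableI_bounded)
    show "d \<in> borel_measurable (sq M)" unfolding sq_def by (rule measurable_completion[OF dm])
    show "(\<integral>\<^sup>+ z. ennreal (norm (d z)) \<partial>sq M) < \<infinity>" using dH by (auto intro: le_less_trans)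
  qed
  \<comment> \<open>The bound \<open>near\<close> concerns labels whose blocks have positive mass;
    almost every point has such a label.\<close>
  define Y where "Y = {x \<in> space M. 0 < measure M (block M q (q x))}"
  have "(\<lambda>x. measure M (block M q (q x))) \<in> borel_measurable M" by (rule borel_measurable_labelling[OF q])
  then have Y: "Y \<in> sets M" unfolding Y_def by measurable
  have "AE x in M. x \<in> Y" using AE_block_pos[OF q] AE_space unfolding Y_def by eventually_elim simp
  then have Y0: "space M - Y \<in> null_sets M"
    using Y by (subst (asm) AE_iff_null) (auto simp: set_diff_eq)
  have "AE z in sq M. \<bar>\<rho>1 z - \<rho>2 z\<bar> \<le> d z"
    using AE_sq_Times[OF Y Y0]
  proof eventually_elim
    case (elim z)
    obtain x y where z: "z = (x, y)" and xY: "x \<in> Y" and yY: "y \<in> Y" using elim by auto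
    have x: "x \<in> space M" and y: "y \<in> space M" using xY yY by (auto simp: Y_def)
    show ?case
    proof (cases "E z")
      case True
      then show ?thesis by (auto simp: E_def d_def z)
    next
      case False
      let ?a = "c1 (q x)" and ?b = "c1 (q y)" and ?a' = "c2 (q x)" and ?b' = "c2 (q y)"
      have "\<bar>\<rho>1 (?a, ?b) - \<rho>2 (?a', ?b')\<bar> \<le> \<eta>"
        using xY yY by (intro near) (auto simp: Y_def)
      moreover have "\<bar>\<rho>1 (x, y) - \<rho>1 (?a, ?b)\<bar> \<le> \<rho>1 (x, ?a) + \<rho>1 (y, ?b)"
        using tri1[OF x c1[of "q x"] y] tri1[OF c1[of "q x"] c1[of "q y"] y]
          tri1[OF c1[of "q x"] x c1[of "q y"]] tri1[OF x y c1[of "q y"]]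
          sym1[OF x c1[of "q x"]] sym1[OF y c1[of "q y"]] by simp
      moreover have "\<bar>\<rho>2 (x, y) - \<rho>2 (?a', ?b')\<bar> \<le> \<rho>2 (x, ?a') + \<rho>2 (y, ?b')"
        using tri2[OF x c2[of "q x"] y] tri2[OF c2[of "q x"] c2[of "q y"] y]
          tri2[OF c2[of "q x"] x c2[of "q y"]] tri2[OF x y c2[of "q y"]]
          sym2[OF x c2[of "q x"]] sym2[OF y c2[of "q y"]] by simp
      ultimately have "\<bar>\<rho>1 (x, y) - \<rho>2 (x, y)\<bar> \<le> H x + H y" unfolding H_def by linarith
      then show ?thesis using False by (simp add: d_def z)
    qed
  qed
  from m_norm_le[OF smd intd this] dH show ?thesis by (rule order_trans)
qed

lemma uniformly_integrable_tail:
  assumes ui: "uniformly_integrable \<nu> F" and t: "0 < (t::real)"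
  shows "\<exists>L>0. \<forall>f\<in>F. (\<integral>\<^sup>+ z. ennreal \<bar>f z\<bar> * indicator {z. \<bar>f z\<bar> > L} z \<partial>\<nu>) < ennreal t"
proof -
  let ?I = "\<lambda>f L. \<integral>\<^sup>+ z. ennreal \<bar>f z\<bar> * indicator {z. \<bar>f z\<bar> > L} z \<partial>\<nu>"
  have "((\<lambda>L. SUP f\<in>F. ?I f L) \<longlongrightarrow> 0) at_top" using ui by (simp add: uniformly_integrable_def)
  then have "\<forall>\<^sub>F L in at_top. (SUP f\<in>F. ?I f L) < ennreal t" using t by (intro order_tendstoD) auto
  then obtain N where N: "\<And>L. N \<le> L \<Longrightarrow> (SUP f\<in>F. ?I f L) < ennreal t"
    unfolding eventually_at_top_linorder by blast
  show ?thesis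
  \<comment> \<open>The maximum with 1 makes the threshold positive.\<close>
  proof (intro exI[of _ "max N 1"] conjI ballI)
    fix f assume "f \<in> F"
    then have "?I f (max N 1) \<le> (SUP f\<in>F. ?I f (max N 1))" by (rule SUP_upper)
    also have "\<dots> < ennreal t" by (rule N) simp
    finally show "?I f (max N 1) < ennreal t" .
  qed simp
qed

text \<open>Pigeonhole: one member of \<open>F\<close> is kept for each of the finitely many
  codes.\<close>

lemma finite_net_of_code:
  assumes fin: "finite (code ` F)" and close: "\<And>f g. f \<in> F \<Longrightarrow> g \<in> F \<Longrightarrow> code f = code g \<Longrightarrow> P f g"
  shows "\<exists>K. finite K \<and> K \<subseteq> F \<and> (\<forall>f\<in>F. \<exists>g\<in>K. P f g)"
proof -
  define K where "K = inv_into F code ` (code ` F)"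
  have "finite K" using fin by (simp add: K_def)
  moreover have "K \<subseteq> F" unfolding K_def by (auto intro: inv_into_into)
  moreover have "\<exists>g\<in>K. P f g" if f: "f \<in> F" for f
    using close[OF f inv_into_into[of "code f" code F]] f f_inv_into_f[of "code f" code F]
    by (auto simp: K_def)
  ultimately show ?thesis by blast
qed

text \<open>After quantization a semimetric is known, up to a small m-norm error, from the distances
  between finitely many centres. Rounding these to multiples of \<open>t\<close> leaves finitely
  many matrices, and members with the same rounded matrix are close.\<close>

lemma finite_m_norm_net:
  assumes compl: "complete_measure M"
    and adm: "\<And>\<rho>. \<rho> \<in> F \<Longrightarrow> admissible M \<rho>" and conv: "convex_family F"
    and ui: "uniformly_integrable (sq M) F"
    and ent: "\<And>e::real. 0 < e \<Longrightarrow> \<exists>K::nat. \<forall>\<rho>\<in>F. \<exists>k\<le>K. eps_cover e \<rho> M k"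
    and \<delta>: "0 < \<delta>"
  shows "\<exists>K. finite K \<and> K \<subseteq> F \<and> (\<forall>\<rho>\<in>F. \<exists>\<kappa>\<in>K. m_norm M (\<lambda>z. \<rho> z - \<kappa> z) < ennreal \<delta>)"
proof -
  \<comment> \<open>The mean distance to the centres is at most \<open>5 * t\<close> and rounding
    costs \<open>t\<close>, so equal codes give m-distance at most
    \<open>4 * (5 * t) + t\<close>.\<close>
  define t where "t = \<delta> / 64"
  have t: "0 < t" "21 * t < \<delta>" using \<delta> by (auto simp: t_def)
  obtain r where r: "\<And>\<rho>. \<rho> \<in> F \<Longrightarrow> regular_version M \<rho> (r \<rho>)"
    using admissible_regular_version[OF compl adm] by metis
  have rg: "regular_semimetric M (r \<rho>)" if "\<rho> \<in> F" for \<rho> using r[OF that] by (simp add: regular_version_def)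
  have sm: "semimetric_on (space M) (r \<rho>)" and m: "r \<rho> \<in> borel_measurable (M \<Otimes>\<^sub>M M)" if "\<rho> \<in> F" for \<rho>
    using rg[OF that] by (auto simp: regular_semimetric_def)
  obtain L where L: "0 < L"
      "\<And>f. f \<in> F \<Longrightarrow> (\<integral>\<^sup>+ z. ennreal \<bar>f z\<bar> * indicator {z. \<bar>f z\<bar> > L} z \<partial>sq M) < ennreal t"
    using uniformly_integrable_tail[OF ui t(1)] by blast
  \<comment> \<open>Tails are cut at \<open>L\<close> but spreads are truncated at
    \<open>2 * L\<close>, which suits a detour through a reference point.\<close>
  have "0 < 2 * L" using L by simp
  from common_labelling[OF conv r ent this t(1)]
  obtain q where q: "labelling M q" "\<And>\<rho>. \<rho> \<in> F \<Longrightarrow> spread M q (\<lambda>z. min (r \<rho> z) (2 * L)) \<le> t"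
    by metis
  have "\<forall>\<rho>. \<exists>p. \<rho> \<in> F \<longrightarrow> p \<in> space M \<and> integrable M (\<lambda>y. r \<rho> (p, y)) \<and>
    (\<integral>y. r \<rho> (p, y) \<partial>M) \<le> L + t \<and> (\<integral>y. r \<rho> (p, y) * indicator {y. r \<rho> (p, y) > L} y \<partial>M) \<le> t"
  proof
    fix \<rho>
    show "\<exists>p. \<rho> \<in> F \<longrightarrow> p \<in> space M \<and> integrable M (\<lambda>y. r \<rho> (p, y)) \<and>
    (\<integral>y. r \<rho> (p, y) \<partial>M) \<le> L + t \<and> (\<integral>y. r \<rho> (p, y) * indicator {y. r \<rho> (p, y) > L} y \<partial>M) \<le> t"
    proof (cases "\<rho> \<in> F")
      case True
      from exists_hub[OF r[OF True] less_imp_le[OF L(1)] L(2)[OF True]]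
      show ?thesis unfolding Bex_def by iprover
    qed simp
  qed
  from choice[OF this] obtain p where p: "\<And>\<rho>. \<rho> \<in> F \<Longrightarrow> p \<rho> \<in> space M"
      "\<And>\<rho>. \<rho> \<in> F \<Longrightarrow> integrable M (\<lambda>y. r \<rho> (p \<rho>, y))"
      "\<And>\<rho>. \<rho> \<in> F \<Longrightarrow> (\<integral>y. r \<rho> (p \<rho>, y) \<partial>M) \<le> L + t"
      "\<And>\<rho>. \<rho> \<in> F \<Longrightarrow> (\<integral>y. r \<rho> (p \<rho>, y) * indicator {y. r \<rho> (p \<rho>, y) > L} y \<partial>M) \<le> t"
    by iprover
  have sums: "t + 4 * t = 5 * t" "t + 5 * t + L = 6 * t + L" by simp_all
  have "\<forall>\<rho>. \<exists>c. \<rho> \<in> F \<longrightarrow> (\<forall>i. c i \<in> space M) \<and> integrable M (\<lambda>x. r \<rho> (x, c (q x))) \<and>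
     (\<integral>x. r \<rho> (x, c (q x)) \<partial>M) \<le> 5 * t \<and>
     (\<forall>i. measure M (block M q i) * r \<rho> (c i, p \<rho>) \<le> 6 * t + L)"
  proof (intro allI)
    fix \<rho>
    show "\<exists>c. \<rho> \<in> F \<longrightarrow> (\<forall>i. c i \<in> space M) \<and> integrable M (\<lambda>x. r \<rho> (x, c (q x))) \<and>
     (\<integral>x. r \<rho> (x, c (q x)) \<partial>M) \<le> 5 * t \<and>
     (\<forall>i. measure M (block M q i) * r \<rho> (c i, p \<rho>) \<le> 6 * t + L)"
    proof (cases "\<rho> \<in> F")
      case True
      from quantize[OF rg[OF True] q(1) L(1) q(2)[OF True] p(1)[OF True] p(2)[OF True] p(3)[OF True] p(4)[OF True],
          unfolded sums]
      show ?thesis by iprover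
    qed simp
  qed
  from choice[OF this] obtain c where c: "\<And>\<rho> i. \<rho> \<in> F \<Longrightarrow> c \<rho> i \<in> space M"
      "\<And>\<rho>. \<rho> \<in> F \<Longrightarrow> integrable M (\<lambda>x. r \<rho> (x, c \<rho> (q x)))"
      "\<And>\<rho>. \<rho> \<in> F \<Longrightarrow> (\<integral>x. r \<rho> (x, c \<rho> (q x)) \<partial>M) \<le> 5 * t"
      "\<And>\<rho> i. \<rho> \<in> F \<Longrightarrow> measure M (block M q i) * r \<rho> (c \<rho> i, p \<rho>) \<le> 6 * t + L"
    by iprover
  let ?m = "\<lambda>i. measure M (block M q i)"
  define I where "I = {i \<in> q ` space M. 0 < ?m i}"
  have finI: "finite I" using q(1) by (simp add: I_def labelling_def)
  \<comment> \<open>Only labels of positive mass are recorded, since for these the distance from the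
    centre to the reference point is bounded; \<open>b\<close> bounds the entries through that
    point.\<close>
  define code where "code \<rho> = (\<lambda>z\<in>I \<times> I. \<lfloor>r \<rho> (c \<rho> (fst z), c \<rho> (snd z)) / t\<rfloor>)" for \<rho>
  define b where "b z = \<lfloor>((6 * t + L) / ?m (fst z) + (6 * t + L) / ?m (snd z)) / t\<rfloor>" for z
  have "code \<rho> \<in> (\<Pi>\<^sub>E z\<in>I \<times> I. {0..b z})" if \<rho>: "\<rho> \<in> F" for \<rho>
  proof -
    have "0 \<le> \<lfloor>r \<rho> (c \<rho> i, c \<rho> j) / t\<rfloor> \<and> \<lfloor>r \<rho> (c \<rho> i, c \<rho> j) / t\<rfloor> \<le> b (i, j)" if i: "i \<in> I" and j: "j \<in> I" for i j
    proof
      have smr: "semimetric_on (space M) (r \<rho>)" by (rule sm[OF \<rho>])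
      have S: "c \<rho> i \<in> space M" "c \<rho> j \<in> space M" "p \<rho> \<in> space M" using c(1)[OF \<rho>] p(1)[OF \<rho>] by auto
      have "0 \<le> r \<rho> (c \<rho> i, c \<rho> j)" using smr S unfolding semimetric_on_def by blast
      then show "0 \<le> \<lfloor>r \<rho> (c \<rho> i, c \<rho> j) / t\<rfloor>" using t by simp
      have le: "r \<rho> (c \<rho> i, p \<rho>) \<le> (6 * t + L) / ?m i" if "i \<in> I" for i
        using c(4)[OF \<rho>, of i] that by (simp add: I_def pos_le_divide_eq mult.commute)
      have "r \<rho> (c \<rho> i, c \<rho> j) \<le> r \<rho> (c \<rho> i, p \<rho>) + r \<rho> (p \<rho>, c \<rho> j)"
        "r \<rho> (p \<rho>, c \<rho> j) = r \<rho> (c \<rho> j, p \<rho>)"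
        using smr S unfolding semimetric_on_def by blast+
      then have "r \<rho> (c \<rho> i, c \<rho> j) \<le> (6 * t + L) / ?m i + (6 * t + L) / ?m j"
        using le[OF i] le[OF j] by simp
      then show "\<lfloor>r \<rho> (c \<rho> i, c \<rho> j) / t\<rfloor> \<le> b (i, j)"
        unfolding b_def using t by (intro floor_mono divide_right_mono) auto
    qed
    then show ?thesis unfolding code_def by auto
  qed
  then have "code ` F \<subseteq> (\<Pi>\<^sub>E z\<in>I \<times> I. {0..b z})" by blast
  then have fin: "finite (code ` F)"
    by (rule finite_subset) (intro finite_PiE finite_cartesian_product finI finite_atLeastAtMost_int)
  have close: "m_norm M (\<lambda>z. \<rho> z - \<kappa> z) < ennreal \<delta>"
    if \<rho>: "\<rho> \<in> F" and \<kappa>: "\<kappa> \<in> F" and eq: "code \<rho> = code \<kappa>" for \<rho> \<kappa>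
  proof -
    have "AE z in sq M. \<rho> z - \<kappa> z = r \<rho> z - r \<kappa> z"
      using regular_version_AE[OF r[OF \<rho>]] regular_version_AE[OF r[OF \<kappa>]] by eventually_elim simp
    then have "m_norm M (\<lambda>z. \<rho> z - \<kappa> z) = m_norm M (\<lambda>z. r \<rho> z - r \<kappa> z)" by (rule m_norm_cong_AE)
    also have "\<dots> \<le> ennreal (4 * (5 * t) + t)"
    proof (rule m_norm_diff_le[OF sm[OF \<rho>] sm[OF \<kappa>] m[OF \<rho>] m[OF \<kappa>] q(1) c(1)[OF \<rho>] c(1)[OF \<kappa>]
          c(2)[OF \<rho>] c(3)[OF \<rho>] c(2)[OF \<kappa>] c(3)[OF \<kappa>]])
      show "0 \<le> t" using t by simp
      fix i j assume pos: "0 < ?m i" "0 < ?m j"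
      have "i \<in> I" if "0 < ?m i" for i
      proof -
        have "block M q i \<noteq> {}" using that by auto
        then show ?thesis using that by (auto simp: I_def block_def)
      qed
      then have "(i, j) \<in> I \<times> I" using pos by simp
      then have "\<lfloor>r \<rho> (c \<rho> i, c \<rho> j) / t\<rfloor> = \<lfloor>r \<kappa> (c \<kappa> i, c \<kappa> j) / t\<rfloor>"
        using fun_cong[OF eq, of "(i, j)"] by (simp add: code_def)
      then have "\<bar>r \<rho> (c \<rho> i, c \<rho> j) / t - r \<kappa> (c \<kappa> i, c \<kappa> j) / t\<bar> \<le> 1" by linarith
      then show "\<bar>r \<rho> (c \<rho> i, c \<rho> j) - r \<kappa> (c \<kappa> i, c \<kappa> j)\<bar> \<le> t"
        using t(1) by (simp add: field_simps abs_le_iff)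
    qed
    also have "\<dots> < ennreal \<delta>" using t by (intro ennreal_lessI) auto
    finally show ?thesis .
  qed
  show ?thesis using finite_net_of_code[OF fin, of "\<lambda>\<rho> \<kappa>. m_norm M (\<lambda>z. \<rho> z - \<kappa> z) < ennreal \<delta>"] close by simp
qed

end

section \<open>Completeness of the normed space\<close>

lemma m_norm_lessD:
  assumes "m_norm \<mu> f < c"
  obtains d where "semimetric_on (space \<mu>) d" "integrable (sq \<mu>) d" "AE z in sq \<mu>. \<bar>f z\<bar> \<le> d z"
    "(\<integral>\<^sup>+ z. ennreal \<bar>d z\<bar> \<partial>sq \<mu>) < c"
  using assms unfolding m_norm_def INF_less_iff by auto

lemma m_functions_integrable: "f \<in> m_functions \<mu> \<Longrightarrow> integrable (sq \<mu>) f"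
  by (simp add: m_functions_def)

lemma m_dist_less_iff:
  assumes "f \<in> m_functions \<mu>" "g \<in> m_functions \<mu>"
  shows "m_dist \<mu> (ae_class \<mu> f) (ae_class \<mu> g) < e \<longleftrightarrow> m_norm \<mu> (\<lambda>z. f z - g z) < ennreal e"
proof -
  have fin: "m_norm \<mu> (\<lambda>z. f z - g z) < top" using m_norm_diff_finite[OF assms] by simp
  have "m_dist \<mu> (ae_class \<mu> f) (ae_class \<mu> g) = enn2real (m_norm \<mu> (\<lambda>z. f z - g z))"
    using assms by (intro m_dist_ae_class m_functions_integrable)
  moreover have "enn2real (m_norm \<mu> (\<lambda>z. f z - g z)) < e \<longleftrightarrow>
      ennreal (enn2real (m_norm \<mu> (\<lambda>z. f z - g z))) < ennreal e"
    by (rule ennreal_less_iff[symmetric]) simp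
  ultimately show ?thesis using fin by simp
qed

lemma eps_entropy_le:
  assumes "1 \<le> k" "eps_cover \<epsilon> \<rho> \<mu> k"
  shows "eps_entropy \<epsilon> \<rho> \<mu> \<le> ennreal (log 2 (real k))"
proof -
  let ?P = "\<lambda>k. k \<ge> 1 \<and> eps_cover \<epsilon> \<rho> \<mu> k"
  have "?P k" using assms by simp
  then have "?P (Least ?P)" "Least ?P \<le> k" by (rule LeastI, rule Least_le)
  then have "log 2 (real (Least ?P)) \<le> log 2 (real k)" by simp
  then show ?thesis using assms unfolding eps_entropy_def by (auto intro: ennreal_leI)
qed

text \<open>The real bound rules out the value \<infinity>, so a least cover number exists, and
  inverting the logarithm bounds it.\<close>

lemma eps_cover_of_entropy_le:
  assumes "eps_entropy \<epsilon> \<rho> \<mu> \<le> ennreal C" "0 \<le> C"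
  shows "\<exists>k\<ge>1. real k \<le> 2 powr C \<and> eps_cover \<epsilon> \<rho> \<mu> k"
proof -
  let ?P = "\<lambda>k. k \<ge> 1 \<and> eps_cover \<epsilon> \<rho> \<mu> k"
  have ex: "\<exists>k. ?P k"
  proof (rule ccontr)
    assume "\<not> (\<exists>k. ?P k)"
    then have "eps_entropy \<epsilon> \<rho> \<mu> = \<infinity>" by (auto simp: eps_entropy_def)
    then show False using assms(1) by (simp add: top_unique)
  qed
  from LeastI_ex[OF this] have P: "?P (Least ?P)" .
  have "ennreal (log 2 (real (Least ?P))) \<le> ennreal C"
    using assms(1) ex unfolding eps_entropy_def by simp
  then have "log 2 (real (Least ?P)) \<le> C" using assms(2) by simp
  then have "real (Least ?P) \<le> 2 powr C" using P by (subst (asm) log_le_iff) auto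
  then show ?thesis using P by (intro exI[of _ "Least ?P"]) simp
qed

context prob_space
begin

lemma AE_ex_space: "AE x in M. P x \<Longrightarrow> \<exists>x\<in>space M. P x"
  using AE_space AE_contr[of P] by (metis (mono_tags, lifting) eventually_mono)

text \<open>Completeness makes the exceptional set, and with it its complement, measurable.\<close>

lemma AE_full_set:
  assumes "complete_measure M" "AE x in M. P x"
  shows "{x \<in> space M. P x} \<in> sets M" "space M - {x \<in> space M. P x} \<in> null_sets M"
proof -
  have eq: "{x \<in> space M. \<not> P x} = space M - {x \<in> space M. P x}" by auto
  show "space M - {x \<in> space M. P x} \<in> null_sets M"
    using assms by (simp only: complete_measure.AE_iff_null_sets eq)
  then have "space M - (space M - {x \<in> space M. P x}) \<in> sets M" by auto
  also have "space M - (space M - {x \<in> space M. P x}) = {x \<in> space M. P x}" by auto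
  finally show "{x \<in> space M. P x} \<in> sets M" .
qed

lemma suminf_half_shift: "(\<Sum>k. ennreal ((1 / 2) ^ (k + n))) = ennreal (2 * (1 / 2) ^ n)"
proof -
  have "(\<lambda>k. (1 / 2) ^ k :: real) sums 2" using geometric_sums[of "1 / 2 :: real"] by simp
  then have "(\<lambda>k. (1 / 2) ^ k * (1 / 2) ^ n :: real) sums (2 * (1 / 2) ^ n)" by (rule sums_mult2)
  then have "(\<lambda>k. (1 / 2) ^ (k + n) :: real) sums (2 * (1 / 2) ^ n)" by (simp only: power_add)
  then show ?thesis by (intro suminf_ennreal_eq) auto
qed

text \<open>
  The series of the dominating semimetrics converges on \<open>Y \<times> Y\<close> for some \<open>Y\<close> of full measure, by the
  triangle inequality through a point \<open>x\<^sub>0\<close>; its sum is retracted to a finite semimetric everywhere.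
\<close>

lemma m_functions_rapid_limit:
  assumes compl: "complete_measure M" and f: "\<And>k. f k \<in> m_functions M"
    and rapid: "\<And>k::nat. m_norm M (\<lambda>z. f k z - f (Suc k) z) < ennreal ((1 / 2) ^ k)"
  shows "\<exists>F\<in>m_functions M. \<forall>n. m_norm M (\<lambda>z. f n z - F z) \<le> ennreal (2 * (1 / 2) ^ n)"
proof -
  have "\<exists>d. semimetric_on (space M) d \<and> integrable (sq M) d \<and>
      (AE z in sq M. \<bar>f k z - f (Suc k) z\<bar> \<le> d z) \<and>
      (\<integral>\<^sup>+ z. ennreal \<bar>d z\<bar> \<partial>sq M) < ennreal ((1 / 2) ^ k)" for k
    by (rule m_norm_lessD[OF rapid[of k]]) iprover
  then have "\<exists>d. \<forall>k. semimetric_on (space M) (d k) \<and> integrable (sq M) (d k) \<and>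
      (AE z in sq M. \<bar>f k z - f (Suc k) z\<bar> \<le> d k z) \<and>
      (\<integral>\<^sup>+ z. ennreal \<bar>d k z\<bar> \<partial>sq M) < ennreal ((1 / 2) ^ k)"
    by (intro choice allI)
  then obtain d where d: "\<And>k. semimetric_on (space M) (d k)" "\<And>k. integrable (sq M) (d k)"
      "\<And>k. AE z in sq M. \<bar>f k z - f (Suc k) z\<bar> \<le> d k z"
      "\<And>k. (\<integral>\<^sup>+ z. ennreal \<bar>d k z\<bar> \<partial>sq M) < ennreal ((1 / 2) ^ k)"
    by iprover
  have d0: "0 \<le> d k (x, y)" and dsym: "d k (x, y) = d k (y, x)" if "x \<in> space M" "y \<in> space M" for k x y
    using d(1)[of k] that unfolding semimetric_on_def by blast+
  have dtri: "d k (x, z) \<le> d k (x, y) + d k (y, z)" if "x \<in> space M" "y \<in> space M" "z \<in> space M" for k x y z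
    using d(1)[of k] that unfolding semimetric_on_def by blast
  have drefl: "d k (x, x) = 0" if "x \<in> space M" for k x
    using d(1)[of k] that unfolding semimetric_on_def by blast
  have dm: "d k \<in> borel_measurable (sq M)" for k by (rule borel_measurable_integrable[OF d(2)])
  have fm: "f k \<in> borel_measurable (sq M)" for k by (rule borel_measurable_integrable[OF m_functions_integrable[OF f]])
  have tail: "(\<Sum>k. \<integral>\<^sup>+ z. ennreal \<bar>d (k + n) z\<bar> \<partial>sq M) \<le> ennreal (2 * (1 / 2) ^ n)" for n
    unfolding suminf_half_shift[symmetric] by (intro suminf_le summableI less_imp_le d(4))
  have sumint: "(\<integral>\<^sup>+ z. (\<Sum>k. ennreal \<bar>d (k + n) z\<bar>) \<partial>sq M) \<le> ennreal (2 * (1 / 2) ^ n)" for n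
    using tail[of n] dm by (subst nn_integral_suminf) auto
  have "AE z in sq M. (\<Sum>k. ennreal \<bar>d k z\<bar>) \<noteq> \<infinity>"
  proof (rule nn_integral_PInf_AE)
    have "(\<integral>\<^sup>+ z. (\<Sum>k. ennreal \<bar>d k z\<bar>) \<partial>sq M) \<le> ennreal 2" using sumint[of 0] by simp
    also have "\<dots> < \<infinity>" by simp
    finally show "(\<integral>\<^sup>+ z. (\<Sum>k. ennreal \<bar>d k z\<bar>) \<partial>sq M) \<noteq> \<infinity>" by simp
  qed (use dm in measurable)
  then have "AE z in sq M. summable (\<lambda>k. \<bar>d k z\<bar>)"
    by eventually_elim (auto intro: summable_suminf_not_top)
  then have "AE x in M. AE y in M. summable (\<lambda>k. \<bar>d k (x, y)\<bar>)" by (rule AE_sq_sections)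
  from AE_ex_space[OF this] obtain x0 where x0: "x0 \<in> space M" "AE y in M. summable (\<lambda>k. \<bar>d k (x0, y)\<bar>)"
    by blast
  define Y where "Y = {y \<in> space M. summable (\<lambda>k. \<bar>d k (x0, y)\<bar>)}"
  have Y: "Y \<in> sets M" "space M - Y \<in> null_sets M"
    unfolding Y_def by (rule AE_full_set[OF compl x0(2)])+
  have Ys: "y \<in> space M" if "y \<in> Y" for y using that by (simp add: Y_def)
  have x0Y: "x0 \<in> Y" using x0(1) drefl[OF x0(1)] by (simp add: Y_def)
  have sumY: "summable (\<lambda>k. d k (y, y'))" if y: "y \<in> Y" and y': "y' \<in> Y" for y y'
  proof (rule summable_comparison_test')
    show "summable (\<lambda>k. \<bar>d k (x0, y)\<bar> + \<bar>d k (x0, y')\<bar>)"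
      using y y' by (intro summable_add) (auto simp: Y_def)
    show "norm (d k (y, y')) \<le> \<bar>d k (x0, y)\<bar> + \<bar>d k (x0, y')\<bar>" for k
      using dtri[OF Ys[OF y] x0(1) Ys[OF y'], of k] dsym[OF Ys[OF y] x0(1), of k] d0[OF Ys[OF y] Ys[OF y'], of k]
      by simp
  qed
  define \<pi> where "\<pi> x = (if x \<in> Y then x else x0)" for x
  have \<pi>: "\<pi> x \<in> Y" for x using x0Y by (simp add: \<pi>_def)
  \<comment> \<open>The tail of the series from index \<open>n\<close> on, since this is what
    dominates the distance from \<open>f n\<close> to the limit.\<close>
  define D where "D n z = (\<Sum>k. d (k + n) (\<pi> (fst z), \<pi> (snd z)))" for n :: nat and z
  have sumD: "summable (\<lambda>k. d (k + n) (\<pi> x, \<pi> y))" for n x y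
    by (rule summable_ignore_initial_segment[OF sumY[OF \<pi> \<pi>]])
  have smD: "semimetric_on (space M) (D n)" for n
    unfolding semimetric_on_def D_def fst_conv snd_conv
  proof (intro conjI ballI)
    fix x y z
    note S = Ys[OF \<pi>]
    show "0 \<le> (\<Sum>k. d (k + n) (\<pi> x, \<pi> y))" by (intro suminf_nonneg sumD d0 S)
    show "(\<Sum>k. d (k + n) (\<pi> x, \<pi> x)) = 0" by (simp add: drefl[OF S])
    show "(\<Sum>k. d (k + n) (\<pi> x, \<pi> y)) = (\<Sum>k. d (k + n) (\<pi> y, \<pi> x))" by (simp only: dsym[OF S S, of _ x y])
    show "(\<Sum>k. d (k + n) (\<pi> x, \<pi> z)) \<le> (\<Sum>k. d (k + n) (\<pi> x, \<pi> y)) + (\<Sum>k. d (k + n) (\<pi> y, \<pi> z))"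
      by (subst suminf_add[OF sumD sumD], intro suminf_le summable_add sumD dtri S)
  qed
  have DY: "D n z = (\<Sum>k. d (k + n) z)" "summable (\<lambda>k. d k z)" if z: "z \<in> Y \<times> Y" for n z
    using z sumY by (auto simp: D_def \<pi>_def)
  have D0: "0 \<le> D n z" if "z \<in> space M \<times> space M" for n z
    using smD[of n] that unfolding semimetric_on_def by auto
  note aeY = AE_sq_Times[OF Y]
  \<comment> \<open>The retraction alters the series only off \<open>Y \<times> Y\<close>, which is
    null in the completed square.\<close>
  have Dm: "D n \<in> borel_measurable (sq M)" for n
    unfolding sq_def
  proof (rule completion.borel_measurable_AE_eq)
    show "(\<lambda>z. \<Sum>k. d (k + n) z) \<in> borel_measurable (completion (M \<Otimes>\<^sub>M M))"
      by (rule borel_measurable_suminf[OF dm[unfolded sq_def]])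
    show "AE z in completion (M \<Otimes>\<^sub>M M). D n z = (\<Sum>k. d (k + n) z)"
      using aeY unfolding sq_def by eventually_elim (rule DY(1))
  qed
  have Dint: "(\<integral>\<^sup>+ z. ennreal \<bar>D n z\<bar> \<partial>sq M) \<le> ennreal (2 * (1 / 2) ^ n)" for n
  proof -
    have "(\<integral>\<^sup>+ z. ennreal \<bar>D n z\<bar> \<partial>sq M) \<le> (\<integral>\<^sup>+ z. (\<Sum>k. ennreal \<bar>d (k + n) z\<bar>) \<partial>sq M)"
    proof (rule nn_integral_mono_AE)
      show "AE z in sq M. ennreal \<bar>D n z\<bar> \<le> (\<Sum>k. ennreal \<bar>d (k + n) z\<bar>)"
        using aeY
      proof eventually_elim
        case (elim z)
        have pos: "0 \<le> d k z" for k using elim d0 Ys by (cases z) auto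
        have s: "summable (\<lambda>k. d (k + n) z)" by (rule summable_ignore_initial_segment[OF DY(2)[OF elim]])
        have "ennreal \<bar>D n z\<bar> = ennreal (\<Sum>k. d (k + n) z)"
          using suminf_nonneg[OF s pos] by (simp add: DY(1)[OF elim])
        also have "\<dots> = (\<Sum>k. ennreal (d (k + n) z))" using s pos by (intro suminf_ennreal2[symmetric]) auto
        finally show ?case using pos by simp
      qed
    qed
    also have "\<dots> \<le> ennreal (2 * (1 / 2) ^ n)" by (rule sumint)
    finally show ?thesis .
  qed
  have intD: "integrable (sq M) (D n)" for n
  proof (rule integrableI_bounded[OF Dm])
    show "(\<integral>\<^sup>+ z. ennreal (norm (D n z)) \<partial>sq M) < \<infinity>"
      using Dint[of n] by (simp add: le_less_trans)
  qed
  \<comment> \<open>The pointwise limit as a telescoping series, so that domination by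
    \<open>d\<close> yields absolute convergence almost everywhere.\<close>
  define F where "F z = f 0 z + (\<Sum>k. f (Suc k) z - f k z)" for z
  have Fm: "F \<in> borel_measurable (sq M)"
    unfolding F_def[abs_def] by (intro borel_measurable_add borel_measurable_suminf borel_measurable_diff fm)
  have all: "AE z in sq M. \<forall>k. \<bar>f k z - f (Suc k) z\<bar> \<le> d k z" unfolding AE_all_countable using d(3) by blast
  have near: "AE z in sq M. \<bar>f n z - F z\<bar> \<le> D n z" for n
    using aeY all
  proof eventually_elim
    case (elim z)
    let ?g = "\<lambda>k. f (Suc k) z - f k z"
    have gd: "\<bar>?g k\<bar> \<le> d k z" for k using elim(2) by (simp add: abs_minus_commute)
    have sg: "summable (\<lambda>k. \<bar>?g k\<bar>)"
      by (rule summable_comparison_test'[OF DY(2)[OF elim(1)], of 0]) (use gd in auto)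
    have sgn: "summable (\<lambda>k. \<bar>?g (k + n)\<bar>)" by (rule summable_ignore_initial_segment[OF sg])
    have "(\<Sum>k. ?g k) = (\<Sum>k. ?g (k + n)) + (\<Sum>k<n. ?g k)"
      by (rule suminf_split_initial_segment[OF summable_rabs_cancel[OF sg]])
    also have "(\<Sum>k<n. ?g k) = f n z - f 0 z" by (rule sum_lessThan_telescope)
    finally have "f n z - F z = - (\<Sum>k. ?g (k + n))" by (simp add: F_def)
    then have "\<bar>f n z - F z\<bar> \<le> (\<Sum>k. \<bar>?g (k + n)\<bar>)" using summable_rabs[OF sgn] by simp
    also have "\<dots> \<le> (\<Sum>k. d (k + n) z)"
      by (intro suminf_le gd sgn summable_ignore_initial_segment[OF DY(2)[OF elim(1)]])
    also have "\<dots> = D n z" by (simp only: DY(1)[OF elim(1)])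
    finally show ?case .
  qed
  have norm: "m_norm M (\<lambda>z. f n z - F z) \<le> ennreal (2 * (1 / 2) ^ n)" for n
    using m_norm_le[OF smD intD near] Dint by (rule order_trans)
  have intF: "integrable (sq M) F"
  proof (rule Bochner_Integration.integrable_bound[OF Bochner_Integration.integrable_add[OF
        Bochner_Integration.integrable_abs[OF m_functions_integrable[OF f[of 0]]] intD[of 0]] Fm])
    show "AE z in sq M. norm (F z) \<le> norm (\<bar>f 0 z\<bar> + D 0 z)" using near[of 0] by eventually_elim simp
  qed
  have "m_norm M F < \<infinity>"
  proof -
    have "m_norm M (\<lambda>z. f 0 z + (F z - f 0 z)) \<le> m_norm M (f 0) + m_norm M (\<lambda>z. F z - f 0 z)"
      by (rule m_norm_triangle)
    also have "m_norm M (\<lambda>z. F z - f 0 z) = m_norm M (\<lambda>z. f 0 z - F z)" by (rule m_norm_uminus)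
    also have "m_norm M (f 0) + \<dots> < \<infinity>"
      using f[of 0] norm[of 0] by (simp add: m_functions_def le_less_trans)
    finally show ?thesis by simp
  qed
  then have "F \<in> m_functions M" using intF by (simp add: m_functions_def)
  then show ?thesis using norm by blast
qed

lemma mcomplete_m_space:
  assumes compl: "complete_measure M"
  shows "Metric_space.mcomplete (m_space M) (m_dist M)"
proof -
  interpret MS: Metric_space "m_space M" "m_dist M" by (rule Metric_space_m_space)
  show ?thesis
    unfolding MS.mcomplete_def
  proof (intro allI impI)
    fix \<sigma> assume \<sigma>: "MS.MCauchy \<sigma>"
    have "\<forall>k. \<exists>N. \<forall>n n'. N \<le> n \<longrightarrow> N \<le> n' \<longrightarrow> m_dist M (\<sigma> n) (\<sigma> n') < (1 / 2) ^ k"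
      using \<sigma> unfolding MS.MCauchy_def by simp
    from choice[OF this] obtain N where N: "\<And>k n n'. N k \<le> n \<Longrightarrow> N k \<le> n' \<Longrightarrow> m_dist M (\<sigma> n) (\<sigma> n') < (1 / 2) ^ k"
      by iprover
    \<comment> \<open>Strictly increasing indices that reach the Cauchy threshold \<open>N k\<close>
      at every \<open>k\<close>.\<close>
    define r where "r = rec_nat (N 0) (\<lambda>k a. max (Suc a) (N (Suc k)))"
    have rS: "r (Suc k) = max (Suc (r k)) (N (Suc k))" and r0: "r 0 = N 0" for k by (simp_all add: r_def)
    have mono: "strict_mono r" by (rule strict_monoI_Suc) (simp add: rS)
    have rN: "N k \<le> r k" for k by (cases k) (simp_all add: rS r0)
    have step: "m_dist M (\<sigma> (r k)) (\<sigma> (r (Suc k))) < (1 / 2) ^ k" for k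
    proof (rule N[OF rN])
      have "r k \<le> r (Suc k)" by (simp add: rS)
      then show "N k \<le> r (Suc k)" using rN[of k] by simp
    qed
    have "range \<sigma> \<subseteq> m_space M" using \<sigma> unfolding MS.MCauchy_def by blast
    then have "\<exists>g\<in>m_functions M. \<sigma> (r k) = ae_class M g" for k
      unfolding m_space_def by blast
    then obtain f where f: "\<And>k. f k \<in> m_functions M" "\<And>k. \<sigma> (r k) = ae_class M (f k)" by metis
    have "m_norm M (\<lambda>z. f k z - f (Suc k) z) < ennreal ((1 / 2) ^ k)" for k
      using step[of k] unfolding f(2) m_dist_less_iff[OF f(1) f(1)] .
    from m_functions_rapid_limit[OF compl f(1) this]
    obtain F where F: "F \<in> m_functions M" "\<And>n. m_norm M (\<lambda>z. f n z - F z) \<le> ennreal (2 * (1 / 2) ^ n)" by blast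
    have "limitin MS.mtopology (\<sigma> \<circ> r) (ae_class M F) sequentially"
      unfolding MS.limitin_metric
    proof (intro conjI allI impI)
      show "ae_class M F \<in> m_space M" using F(1) by (simp add: m_space_def)
      fix e :: real assume e: "0 < e"
      have "(\<lambda>n. 2 * (1 / 2) ^ n :: real) \<longlonglongrightarrow> 2 * 0"
        by (intro tendsto_mult tendsto_const LIMSEQ_power_zero) simp
      then have "\<forall>\<^sub>F n in sequentially. 2 * (1 / 2) ^ n < e" using e by (intro order_tendstoD) auto
      then show "\<forall>\<^sub>F n in sequentially. (\<sigma> \<circ> r) n \<in> m_space M \<and> m_dist M ((\<sigma> \<circ> r) n) (ae_class M F) < e"
      proof eventually_elim
        case (elim n)
        have "m_norm M (\<lambda>z. f n z - F z) < ennreal e"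
          by (rule le_less_trans[OF F(2)]) (use elim e in \<open>simp add: ennreal_less_iff\<close>)
        then show ?case using f F(1) by (auto simp: m_dist_less_iff m_space_def)
      qed
    qed
    then show "\<exists>x. limitin MS.mtopology \<sigma> x sequentially"
      using MS.MCauchy_convergent_subsequence[OF \<sigma> mono] by blast
  qed
qed

section \<open>Entropy of nearby semimetrics\<close>

text \<open>
  Most points are close to one point \<open>x\<^sub>0\<close> in the semimetric dominating \<open>\<rho> - \<kappa>\<close>; among them \<open>\<rho>\<close> and
  \<open>\<kappa>\<close> are uniformly close, so a cover for \<open>\<kappa>\<close> serves for all \<open>\<rho>\<close> nearby.
\<close>

lemma eps_cover_near:
  assumes compl: "complete_measure M" and reg: "regular_semimetric M \<kappa>" and \<epsilon>: "0 < \<epsilon>"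
  shows "\<exists>k\<ge>1. \<forall>\<rho>. semimetric_on (space M) \<rho> \<longrightarrow> m_norm M (\<lambda>z. \<rho> z - \<kappa> z) < ennreal (\<epsilon>\<^sup>2 / 64) \<longrightarrow>
    eps_cover \<epsilon> \<rho> M k"
proof -
  have e16: "0 < \<epsilon> / 16" using \<epsilon> by simp
  obtain q c m where q: "labelling M q" "measure M (block M q 0) < \<epsilon> / 16" "\<And>x. q x \<le> m"
      "\<And>x. x \<in> space M \<Longrightarrow> q x \<noteq> 0 \<Longrightarrow> c (q x) \<in> space M \<and> \<kappa> (c (q x), x) < \<epsilon> / 16"
    using labelling_of_regular[OF reg e16] by blast
  have sm\<kappa>: "semimetric_on (space M) \<kappa>" using reg by (simp add: regular_semimetric_def)
  have cover: "eps_cover \<epsilon> \<rho> M (Suc m)"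
    if sm: "semimetric_on (space M) \<rho>" and near: "m_norm M (\<lambda>z. \<rho> z - \<kappa> z) < ennreal (\<epsilon>\<^sup>2 / 64)" for \<rho>
  proof -
    obtain d where d: "semimetric_on (space M) d" "integrable (sq M) d" "AE z in sq M. \<bar>\<rho> z - \<kappa> z\<bar> \<le> d z"
        "(\<integral>\<^sup>+ z. ennreal \<bar>d z\<bar> \<partial>sq M) < ennreal (\<epsilon>\<^sup>2 / 64)"
      by (rule m_norm_lessD[OF near])
    have dm: "d \<in> borel_measurable (sq M)" by (rule borel_measurable_integrable[OF d(2)])
    have dI: "(\<integral>\<^sup>+ x. \<integral>\<^sup>+ y. ennreal \<bar>d (x, y)\<bar> \<partial>M \<partial>M) < ennreal (\<epsilon>\<^sup>2 / 64)"
      using d(4) dm by (subst (asm) nn_integral_sq) auto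
    \<comment> \<open>Otherwise almost every section integral would be at least
      \<open>\<epsilon>\<^sup>2 / 64\<close>, and so would the double integral.\<close>
    have "\<exists>x\<in>space M. (\<lambda>y. d (x, y)) \<in> borel_measurable M \<and> (\<integral>\<^sup>+ y. ennreal \<bar>d (x, y)\<bar> \<partial>M) < ennreal (\<epsilon>\<^sup>2 / 64)"
    proof (rule ccontr)
      assume neg: "\<not> ?thesis"
      have "(\<integral>\<^sup>+ x. ennreal (\<epsilon>\<^sup>2 / 64) \<partial>M) \<le> (\<integral>\<^sup>+ x. \<integral>\<^sup>+ y. ennreal \<bar>d (x, y)\<bar> \<partial>M \<partial>M)"
      proof (rule nn_integral_mono_AE)
        show "AE x in M. ennreal (\<epsilon>\<^sup>2 / 64) \<le> (\<integral>\<^sup>+ y. ennreal \<bar>d (x, y)\<bar> \<partial>M)"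
          using AE_measurable_section[OF compl dm] AE_space
        proof eventually_elim
          case (elim x)
          show ?case
          proof (rule ccontr)
            assume "\<not> ?case"
            then have "(\<integral>\<^sup>+ y. ennreal \<bar>d (x, y)\<bar> \<partial>M) < ennreal (\<epsilon>\<^sup>2 / 64)" by (simp only: not_le)
            with elim have "\<exists>x\<in>space M. (\<lambda>y. d (x, y)) \<in> borel_measurable M \<and>
                (\<integral>\<^sup>+ y. ennreal \<bar>d (x, y)\<bar> \<partial>M) < ennreal (\<epsilon>\<^sup>2 / 64)"
              by (intro bexI[of _ x] conjI)
            with neg show False by (rule notE)
          qed
        qed
      qed
      then show False using dI by (simp add: emeasure_space_1)
    qed
    then obtain x0 where x0: "x0 \<in> space M" "(\<lambda>y. d (x0, y)) \<in> borel_measurable M"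
        "(\<integral>\<^sup>+ y. ennreal \<bar>d (x0, y)\<bar> \<partial>M) < ennreal (\<epsilon>\<^sup>2 / 64)"
      unfolding Bex_def by iprover
    define B where "B = {y \<in> space M. d (x0, y) < \<epsilon> / 16}"
    have B: "B \<in> sets M" unfolding B_def by (rule borel_measurable_iff_less[THEN iffD1, OF x0(2), rule_format])
    have d0: "0 \<le> d (x, y)" if "x \<in> space M" "y \<in> space M" for x y
      using d(1) that unfolding semimetric_on_def by blast
    have dB: "d (x, y) < \<epsilon> / 8" if "x \<in> B" "y \<in> B" for x y
    proof -
      have S: "x \<in> space M" "y \<in> space M" "d (x0, x) < \<epsilon> / 16" "d (x0, y) < \<epsilon> / 16"
        using that by (auto simp: B_def)
      have "d (x, y) \<le> d (x, x0) + d (x0, y)" "d (x, x0) = d (x0, x)"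
        using d(1) S(1,2) x0(1) unfolding semimetric_on_def by blast+
      then show ?thesis using S by simp
    qed
    \<comment> \<open>Markov's inequality: radius \<epsilon>/16 and integral below
      \<open>\<epsilon>\<^sup>2 / 64\<close> leave mass at most \<epsilon>/4 outside
      \<open>B\<close>.\<close>
    have B': "emeasure M (space M - B) \<le> ennreal (\<epsilon> / 4)"
    proof -
      have "ennreal (\<epsilon> / 16) * emeasure M (space M - B) = (\<integral>\<^sup>+ y. ennreal (\<epsilon> / 16) * indicator (space M - B) y \<partial>M)"
        using B by (subst nn_integral_cmult_indicator) auto
      also have "\<dots> \<le> (\<integral>\<^sup>+ y. ennreal \<bar>d (x0, y)\<bar> \<partial>M)"
        by (intro nn_integral_mono) (auto simp: B_def indicator_def intro!: ennreal_leI)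
      also have "\<dots> \<le> ennreal (\<epsilon>\<^sup>2 / 64)" using x0(3) by simp
      finally have *: "ennreal (\<epsilon> / 16) * ennreal (measure M (space M - B)) \<le> ennreal (\<epsilon>\<^sup>2 / 64)"
        by (simp only: emeasure_eq_measure)
      have "ennreal (\<epsilon> / 16 * measure M (space M - B)) = ennreal (\<epsilon> / 16) * ennreal (measure M (space M - B))"
        using \<epsilon> by (intro ennreal_mult) auto
      with * have "ennreal (\<epsilon> / 16 * measure M (space M - B)) \<le> ennreal (\<epsilon>\<^sup>2 / 64)" by simp
      then have "\<epsilon> / 16 * measure M (space M - B) \<le> \<epsilon>\<^sup>2 / 64" by (simp only: ennreal_le_iff zero_le_power2 divide_nonneg_nonneg zero_le_numeral)
      then have "\<epsilon> / 16 * measure M (space M - B) \<le> \<epsilon> / 16 * (\<epsilon> / 4)"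
        using \<epsilon> by (simp add: power2_eq_square)
      then have "measure M (space M - B) \<le> \<epsilon> / 4" using \<epsilon> by (subst (asm) mult_le_cancel_left_pos) auto
      then show ?thesis by (simp add: emeasure_eq_measure ennreal_leI)
    qed
    define G where "G = {x \<in> space M. AE y in M. \<bar>\<rho> (x, y) - \<kappa> (x, y)\<bar> \<le> d (x, y)}"
    have aeG: "AE x in M. x \<in> G"
      using AE_sq_sections[OF d(3)] AE_space unfolding G_def by eventually_elim simp
    \<comment> \<open>The comparison with \<open>d\<close> holds only almost everywhere. So a cell
      is built around one base point of \<open>G\<close> and drops the null set where comparison
      with that point fails; a block without a base point meets \<open>B\<close> in a null set and
      gets the empty cell.\<close>
    have "\<forall>j. \<exists>A. j \<in> {1..Suc m} \<longrightarrow> A \<in> sets M \<and> A \<subseteq> space M \<and> diam \<rho> A < ennreal \<epsilon> \<and>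
        (AE y in M. y \<in> block M q j \<inter> B \<longrightarrow> y \<in> A)"
    proof
      fix j
      show "\<exists>A. j \<in> {1..Suc m} \<longrightarrow> A \<in> sets M \<and> A \<subseteq> space M \<and> diam \<rho> A < ennreal \<epsilon> \<and>
        (AE y in M. y \<in> block M q j \<inter> B \<longrightarrow> y \<in> A)"
      proof (cases "block M q j \<inter> B \<inter> G = {}")
        case True
        have "AE y in M. y \<in> block M q j \<inter> B \<longrightarrow> y \<in> {}" using aeG by eventually_elim (use True in auto)
        moreover have "diam \<rho> {} < ennreal \<epsilon>" using \<epsilon> by (simp add: diam_def bot_ennreal)
        ultimately show ?thesis by (intro exI[of _ "{}"]) simp
      next
        case False
        then obtain x where x: "x \<in> block M q j" "x \<in> B" "x \<in> G" by auto
        have xs: "x \<in> space M" using x(1) by (simp add: block_def)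
        let ?P = "\<lambda>y. \<bar>\<rho> (x, y) - \<kappa> (x, y)\<bar> \<le> d (x, y)"
        define A where "A = block M q j \<inter> B \<inter> {y \<in> space M. ?P y}"
        have ae: "AE y in M. ?P y" using x(3) by (simp add: G_def)
        have "A \<in> sets M" unfolding A_def by (intro sets.Int block_sets[OF q(1)] B AE_full_set(1)[OF compl ae])
        moreover have "A \<subseteq> space M" by (auto simp: A_def)
        moreover have "AE y in M. y \<in> block M q j \<inter> B \<longrightarrow> y \<in> A"
          using ae AE_space by eventually_elim (simp add: A_def)
        moreover have "diam \<rho> A < ennreal \<epsilon>" if j: "j \<in> {1..Suc m}"
        proof -
          \<comment> \<open>Both \<open>\<kappa> (x, y)\<close> and \<open>d (x, y)\<close> are
            below \<epsilon>/8, the first through the centre \<open>c j\<close> and the second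
            through \<open>x0\<close>.\<close>
          have near_x: "\<rho> (x, y) \<le> \<epsilon> / 4" if y: "y \<in> A" for y
          proof -
            have ys: "y \<in> space M" "q y = j" "q x = j" "y \<in> B" "?P y"
              using y x(1) by (auto simp: A_def block_def)
            have cj: "c j \<in> space M" "\<kappa> (c j, x) < \<epsilon> / 16" "\<kappa> (c j, y) < \<epsilon> / 16"
              using q(4)[OF xs] q(4)[OF ys(1)] ys j by auto
            have "\<kappa> (x, y) \<le> \<kappa> (x, c j) + \<kappa> (c j, y)" "\<kappa> (x, c j) = \<kappa> (c j, x)"
              using sm\<kappa> xs ys(1) cj(1) unfolding semimetric_on_def by blast+
            then have "\<kappa> (x, y) < \<epsilon> / 8" using cj by simp
            then show ?thesis using ys(5) dB[OF x(2) ys(4)] by simp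
          qed
          have "\<rho> z \<le> \<epsilon> / 2" if z: "z \<in> A \<times> A" for z
          proof -
            obtain y y' where yy: "z = (y, y')" "y \<in> A" "y' \<in> A" using z by auto
            have S: "y \<in> space M" "y' \<in> space M" using yy by (auto simp: A_def)
            have "\<rho> (y, y') \<le> \<rho> (y, x) + \<rho> (x, y')" "\<rho> (y, x) = \<rho> (x, y)"
              using sm xs S unfolding semimetric_on_def by blast+
            then show ?thesis using near_x[OF yy(2)] near_x[OF yy(3)] yy(1) by simp
          qed
          then have "diam \<rho> A \<le> ennreal (\<epsilon> / 2)" unfolding diam_def by (intro SUP_least ennreal_leI)
          also have "\<dots> < ennreal \<epsilon>" using \<epsilon> by (intro ennreal_lessI) auto
          finally show ?thesis .
        qed
        ultimately show ?thesis by (intro exI[of _ A]) simp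
      qed
    qed
    from choice[OF this] obtain A where A: "\<And>j. j \<in> {1..Suc m} \<Longrightarrow> A j \<in> sets M"
        "\<And>j. j \<in> {1..Suc m} \<Longrightarrow> A j \<subseteq> space M"
        "\<And>j. j \<in> {1..Suc m} \<Longrightarrow> diam \<rho> (A j) < ennreal \<epsilon>"
        "\<And>j. j \<in> {1..Suc m} \<Longrightarrow> AE y in M. y \<in> block M q j \<inter> B \<longrightarrow> y \<in> A j"
      by iprover
    \<comment> \<open>Up to a null set the remainder consists of points with label 0 and points
      outside \<open>B\<close>, of mass at most \<epsilon>/16 + \<epsilon>/4.\<close>
    define R where "R = space M - (\<Union>j\<in>{1..Suc m}. A j)"
    have R: "R \<in> sets M" unfolding R_def using A(1) by auto
    have "emeasure M R \<le> emeasure M (block M q 0 \<union> (space M - B))"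
    proof (rule emeasure_mono_AE)
      have "AE y in M. \<forall>j\<in>{1..Suc m}. y \<in> block M q j \<inter> B \<longrightarrow> y \<in> A j"
        by (rule AE_finite_allI) (use A(4) in auto)
      then show "AE y in M. y \<in> R \<longrightarrow> y \<in> block M q 0 \<union> (space M - B)"
      proof eventually_elim
        case (elim y)
        show ?case
        proof
          assume y: "y \<in> R"
          then have ys: "y \<in> space M" by (simp add: R_def)
          show "y \<in> block M q 0 \<union> (space M - B)"
          proof (cases "q y = 0 \<or> y \<notin> B")
            case True
            then show ?thesis using ys by (auto simp: block_def)
          next
            case False
            then have "q y \<in> {1..Suc m}" "y \<in> block M q (q y) \<inter> B"
              using q(3)[of y] ys by (auto simp: block_def)
            then have "y \<in> (\<Union>j\<in>{1..Suc m}. A j)" using elim by blast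
            then show ?thesis using y by (simp add: R_def)
          qed
        qed
      qed
    qed (use B block_sets[OF q(1)] in auto)
    also have "\<dots> \<le> emeasure M (block M q 0) + emeasure M (space M - B)"
      using B block_sets[OF q(1)] by (intro emeasure_subadditive) auto
    also have "\<dots> \<le> ennreal (\<epsilon> / 16) + ennreal (\<epsilon> / 4)"
      using q(2) by (intro add_mono B') (simp add: emeasure_eq_measure ennreal_leI)
    also have "\<dots> < ennreal \<epsilon>" using \<epsilon> by (simp add: ennreal_less_iff flip: ennreal_plus)
    finally have R\<epsilon>: "emeasure M R < ennreal \<epsilon>" .
    have split: "{..Suc m} = insert 0 {1..Suc m}" by auto
    let ?A = "\<lambda>j. if j = 0 then R else A j"
    show ?thesis
      unfolding eps_cover_def
    proof (intro exI[of _ ?A] conjI allI impI ballI)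
      show "?A j \<in> sets M" if "j \<le> Suc m" for j using that R A(1)[of j] by (cases "j = 0") auto
      have "(\<Union>j\<le>Suc m. ?A j) = R \<union> (\<Union>j\<in>{1..Suc m}. A j)" unfolding split by auto
      also have "\<dots> = space M"
        using UN_least[OF A(2), of "{1..Suc m}" "\<lambda>j. j"] unfolding R_def by blast
      finally show "(\<Union>j\<le>Suc m. ?A j) = space M" .
      show "emeasure M (?A 0) < ennreal \<epsilon>" using R\<epsilon> by simp
      show "diam \<rho> (?A j) < ennreal \<epsilon>" if "j \<in> {1..Suc m}" for j using A(3)[OF that] that by auto
    qed
  qed
  \<comment> \<open>The successor guarantees a positive number of cells even for
    \<open>m = 0\<close>.\<close>
  then show ?thesis by (intro exI[of _ "Suc m"]) auto
qed

end

section \<open>Nets of representatives and the equivalence\<close>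

text \<open>Total boundedness asks for nets with centres in the set itself, so each centre is the
  class of a member of \<open>F\<close> and a net of classes can be read as a net of
  functions.\<close>

lemma Metric_space_mtotally_bounded_ae_class_iff:
  assumes F: "F \<subseteq> m_functions \<mu>"
  shows "Metric_space.mtotally_bounded (m_space \<mu>) (m_dist \<mu>) (ae_class \<mu> ` F) \<longleftrightarrow>
    (\<forall>\<delta>>0. \<exists>K. finite K \<and> K \<subseteq> F \<and> (\<forall>\<rho>\<in>F. \<exists>\<kappa>\<in>K. m_norm \<mu> (\<lambda>z. \<rho> z - \<kappa> z) < ennreal \<delta>))"
proof -
  interpret MS: Metric_space "m_space \<mu>" "m_dist \<mu>" by (rule Metric_space_m_space)
  have cls: "ae_class \<mu> \<rho> \<in> m_space \<mu>" if "\<rho> \<in> F" for \<rho> using that F by (auto simp: m_space_def)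
  have ball: "ae_class \<mu> \<rho> \<in> MS.mball (ae_class \<mu> \<kappa>) \<delta> \<longleftrightarrow> m_norm \<mu> (\<lambda>z. \<rho> z - \<kappa> z) < ennreal \<delta>"
    if "\<rho> \<in> F" "\<kappa> \<in> F" for \<rho> \<kappa> \<delta>
    using cls[OF that(1)] cls[OF that(2)] m_dist_less_iff[of \<rho> \<mu> \<kappa> \<delta>] that F
    by (auto simp: MS.in_mball MS.commute)
  have "(\<exists>C. finite C \<and> C \<subseteq> ae_class \<mu> ` F \<and> ae_class \<mu> ` F \<subseteq> (\<Union>x\<in>C. MS.mball x \<delta>)) \<longleftrightarrow>
      (\<exists>K. finite K \<and> K \<subseteq> F \<and> (\<forall>\<rho>\<in>F. \<exists>\<kappa>\<in>K. m_norm \<mu> (\<lambda>z. \<rho> z - \<kappa> z) < ennreal \<delta>))" for \<delta>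
  proof
    assume "\<exists>C. finite C \<and> C \<subseteq> ae_class \<mu> ` F \<and> ae_class \<mu> ` F \<subseteq> (\<Union>x\<in>C. MS.mball x \<delta>)"
    then obtain K where K: "finite K" "K \<subseteq> F" "ae_class \<mu> ` F \<subseteq> (\<Union>x\<in>ae_class \<mu> ` K. MS.mball x \<delta>)"
      by (metis finite_subset_image)
    have "\<exists>\<kappa>\<in>K. m_norm \<mu> (\<lambda>z. \<rho> z - \<kappa> z) < ennreal \<delta>" if \<rho>: "\<rho> \<in> F" for \<rho>
    proof -
      have "ae_class \<mu> \<rho> \<in> (\<Union>x\<in>ae_class \<mu> ` K. MS.mball x \<delta>)" using \<rho> K(3) by blast
      then obtain \<kappa> where "\<kappa> \<in> K" "ae_class \<mu> \<rho> \<in> MS.mball (ae_class \<mu> \<kappa>) \<delta>" by blast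
      then show ?thesis using ball[OF \<rho>] K(2) by blast
    qed
    then show "\<exists>K. finite K \<and> K \<subseteq> F \<and> (\<forall>\<rho>\<in>F. \<exists>\<kappa>\<in>K. m_norm \<mu> (\<lambda>z. \<rho> z - \<kappa> z) < ennreal \<delta>)"
      using K(1,2) by blast
  next
    assume "\<exists>K. finite K \<and> K \<subseteq> F \<and> (\<forall>\<rho>\<in>F. \<exists>\<kappa>\<in>K. m_norm \<mu> (\<lambda>z. \<rho> z - \<kappa> z) < ennreal \<delta>)"
    then obtain K where K: "finite K" "K \<subseteq> F" "\<And>\<rho>. \<rho> \<in> F \<Longrightarrow> \<exists>\<kappa>\<in>K. m_norm \<mu> (\<lambda>z. \<rho> z - \<kappa> z) < ennreal \<delta>"
      by blast
    have "ae_class \<mu> \<rho> \<in> (\<Union>x\<in>ae_class \<mu> ` K. MS.mball x \<delta>)" if \<rho>: "\<rho> \<in> F" for \<rho>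
    proof -
      obtain \<kappa> where \<kappa>: "\<kappa> \<in> K" "m_norm \<mu> (\<lambda>z. \<rho> z - \<kappa> z) < ennreal \<delta>" using K(3)[OF \<rho>] by blast
      then have "ae_class \<mu> \<rho> \<in> MS.mball (ae_class \<mu> \<kappa>) \<delta>" using ball[OF \<rho>, of \<kappa>] K(2) by blast
      then show ?thesis using \<kappa>(1) by blast
    qed
    then show "\<exists>C. finite C \<and> C \<subseteq> ae_class \<mu> ` F \<and> ae_class \<mu> ` F \<subseteq> (\<Union>x\<in>C. MS.mball x \<delta>)"
      using K(1,2) by (intro exI[of _ "ae_class \<mu> ` K"]) auto
  qed
  then show ?thesis unfolding MS.mtotally_bounded_def by simp
qed

theorem theorem6:
  fixes \<mu> :: "'a measure" and M :: "('a \<times> 'a \<Rightarrow> real) set"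
  assumes "lebesgue_prob_space \<mu>"
    and "\<And>\<rho>. \<rho> \<in> M \<Longrightarrow> admissible \<mu> \<rho>"
    and "M \<subseteq> m_functions \<mu>"
    and "convex_family M"
    and "uniformly_integrable (sq \<mu>) M"
  shows "m_precompact \<mu> M \<longleftrightarrow>
    (\<forall>\<epsilon>>0. (SUP \<rho>\<in>M. eps_entropy \<epsilon> \<rho> \<mu>) < \<infinity>)"
proof -
  have prob: "prob_space \<mu>" and compl: "complete_measure \<mu>"
    using assms(1) by (simp_all add: lebesgue_prob_space_def)
  interpret prob_space \<mu> by (rule prob)
  interpret MS: Metric_space "m_space \<mu>" "m_dist \<mu>" by (rule Metric_space_m_space)
  have sub: "ae_class \<mu> ` M \<subseteq> m_space \<mu>" using assms(3) by (auto simp: m_space_def)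
  let ?net = "\<lambda>\<delta>::real. \<exists>K. finite K \<and> K \<subseteq> M \<and> (\<forall>\<rho>\<in>M. \<exists>\<kappa>\<in>K. m_norm \<mu> (\<lambda>z. \<rho> z - \<kappa> z) < ennreal \<delta>)"
  \<comment> \<open>In a complete metric space, having compact closure is the same as being totally
    bounded.\<close>
  have "m_precompact \<mu> M \<longleftrightarrow> MS.mtotally_bounded (ae_class \<mu> ` M)"
    using MS.mtotally_bounded_eq_compact_closure_of[OF mcomplete_m_space[OF compl]] sub
    by (simp add: m_precompact_def m_topology_def)
  also have "\<dots> \<longleftrightarrow> (\<forall>\<delta>>0. ?net \<delta>)"
    by (rule Metric_space_mtotally_bounded_ae_class_iff[OF assms(3)])
  also have "\<dots> \<longleftrightarrow> (\<forall>\<epsilon>>0. (SUP \<rho>\<in>M. eps_entropy \<epsilon> \<rho> \<mu>) < \<infinity>)"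
  proof (intro iffI allI impI)
    fix \<epsilon> :: real assume net: "\<forall>\<delta>>0. ?net \<delta>" and \<epsilon>: "0 < \<epsilon>"
    \<comment> \<open>At this radius the size of one cover around a net member serves all its
      neighbours.\<close>
    then have "?net (\<epsilon>\<^sup>2 / 64)" by simp
    then obtain K where K: "finite K" "K \<subseteq> M"
        "\<And>\<rho>. \<rho> \<in> M \<Longrightarrow> \<exists>\<kappa>\<in>K. m_norm \<mu> (\<lambda>z. \<rho> z - \<kappa> z) < ennreal (\<epsilon>\<^sup>2 / 64)" by blast
    have "\<forall>\<kappa>. \<exists>k. \<kappa> \<in> K \<longrightarrow> k \<ge> 1 \<and> (\<forall>\<rho>\<in>M. m_norm \<mu> (\<lambda>z. \<rho> z - \<kappa> z) < ennreal (\<epsilon>\<^sup>2 / 64) \<longrightarrow> eps_cover \<epsilon> \<rho> \<mu> k)"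
    proof
      fix \<kappa>
      show "\<exists>k. \<kappa> \<in> K \<longrightarrow> k \<ge> 1 \<and> (\<forall>\<rho>\<in>M. m_norm \<mu> (\<lambda>z. \<rho> z - \<kappa> z) < ennreal (\<epsilon>\<^sup>2 / 64) \<longrightarrow> eps_cover \<epsilon> \<rho> \<mu> k)"
      proof (cases "\<kappa> \<in> K")
        case True
        then have "admissible \<mu> \<kappa>" using K(2) assms(2) by blast
        from admissible_regular_version[OF compl this] obtain \<kappa>' where \<kappa>': "regular_version \<mu> \<kappa> \<kappa>'" ..
        have "regular_semimetric \<mu> \<kappa>'" using \<kappa>' by (simp add: regular_version_def)
        from eps_cover_near[OF compl this \<epsilon>] obtain k where k: "k \<ge> 1"
          "\<And>\<rho>. semimetric_on (space \<mu>) \<rho> \<Longrightarrow> m_norm \<mu> (\<lambda>z. \<rho> z - \<kappa>' z) < ennreal (\<epsilon>\<^sup>2 / 64) \<Longrightarrow> eps_cover \<epsilon> \<rho> \<mu> k"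
          by blast
        \<comment> \<open>Passing to the regular version leaves all m-distances unchanged.\<close>
        have "m_norm \<mu> (\<lambda>z. \<rho> z - \<kappa> z) = m_norm \<mu> (\<lambda>z. \<rho> z - \<kappa>' z)" for \<rho>
          using regular_version_AE[OF \<kappa>'] by (intro m_norm_cong_AE) (auto elim: eventually_mono)
        moreover have "semimetric_on (space \<mu>) \<rho>" if "\<rho> \<in> M" for \<rho>
          using assms(2)[OF that] by (simp add: admissible_def)
        ultimately show ?thesis using k by (intro exI[of _ k]) simp
      qed simp
    qed
    from choice[OF this] obtain k where k: "\<And>\<kappa>. \<kappa> \<in> K \<Longrightarrow> k \<kappa> \<ge> 1"
        "\<And>\<kappa> \<rho>. \<kappa> \<in> K \<Longrightarrow> \<rho> \<in> M \<Longrightarrow> m_norm \<mu> (\<lambda>z. \<rho> z - \<kappa> z) < ennreal (\<epsilon>\<^sup>2 / 64) \<Longrightarrow> eps_cover \<epsilon> \<rho> \<mu> (k \<kappa>)"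
      by blast
    \<comment> \<open>The sum over the finite net replaces a maximum and also covers the empty
      net.\<close>
    have "(SUP \<rho>\<in>M. eps_entropy \<epsilon> \<rho> \<mu>) \<le> (\<Sum>\<kappa>\<in>K. ennreal (log 2 (real (k \<kappa>))))"
    proof (rule SUP_least)
      fix \<rho> assume \<rho>: "\<rho> \<in> M"
      obtain \<kappa> where \<kappa>: "\<kappa> \<in> K" "m_norm \<mu> (\<lambda>z. \<rho> z - \<kappa> z) < ennreal (\<epsilon>\<^sup>2 / 64)" using K(3)[OF \<rho>] by blast
      have "eps_entropy \<epsilon> \<rho> \<mu> \<le> ennreal (log 2 (real (k \<kappa>)))"
        by (rule eps_entropy_le[OF k(1)[OF \<kappa>(1)] k(2)[OF \<kappa>(1) \<rho> \<kappa>(2)]])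
      also have "\<dots> \<le> (\<Sum>\<kappa>\<in>K. ennreal (log 2 (real (k \<kappa>))))"
        using \<kappa>(1) K(1) by (intro member_le_sum) auto
      finally show "eps_entropy \<epsilon> \<rho> \<mu> \<le> (\<Sum>\<kappa>\<in>K. ennreal (log 2 (real (k \<kappa>))))" .
    qed
    also have "\<dots> < \<infinity>" using K(1) by (simp add: sum_Pinfty less_top)
    finally show "(SUP \<rho>\<in>M. eps_entropy \<epsilon> \<rho> \<mu>) < \<infinity>" .
  next
    fix \<delta> :: real
    assume fin: "\<forall>\<epsilon>>0. (SUP \<rho>\<in>M. eps_entropy \<epsilon> \<rho> \<mu>) < \<infinity>" and \<delta>: "0 < \<delta>"
    \<comment> \<open>A uniform entropy bound \<open>C\<close> becomes the uniform bound
      \<open>2 powr C\<close> on cover numbers.\<close>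
    have ent: "\<exists>K::nat. \<forall>\<rho>\<in>M. \<exists>k\<le>K. eps_cover e \<rho> \<mu> k" if e: "0 < e" for e
    proof -
      have lt: "(SUP \<rho>\<in>M. eps_entropy e \<rho> \<mu>) < top" using fin e by simp
      define C where "C = enn2real (SUP \<rho>\<in>M. eps_entropy e \<rho> \<mu>)"
      have C: "ennreal C = (SUP \<rho>\<in>M. eps_entropy e \<rho> \<mu>)" "0 \<le> C" using lt by (simp_all add: C_def)
      have "\<exists>k\<le>nat \<lceil>2 powr C\<rceil>. eps_cover e \<rho> \<mu> k" if \<rho>: "\<rho> \<in> M" for \<rho>
      proof -
        have "eps_entropy e \<rho> \<mu> \<le> ennreal C" unfolding C(1) by (rule SUP_upper[OF \<rho>])
        from eps_cover_of_entropy_le[OF this C(2)] obtain k where "real k \<le> 2 powr C" "eps_cover e \<rho> \<mu> k" by blast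
        moreover from this(1) have "k \<le> nat \<lceil>2 powr C\<rceil>" by linarith
        ultimately show ?thesis by blast
      qed
      then show ?thesis by blast
    qed
    show "?net \<delta>" by (rule finite_m_norm_net[OF compl assms(2) assms(4) assms(5) ent \<delta>])
  qed
  finally show ?thesis .
qed

end
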